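(* Let $k\ge1$, $\alpha,\beta>0$, and consider $I_{2k}$ with multiplicity $(\alpha,\beta)$. For $z=|z|e^{i\phi_1},w=|w|e^{i\phi_2}$ and $u,v\in[-1,1]$ let $a_j=|zw|\cos\big(\frac{q_{u,v}(k\phi_1,k\phi_2)+2\pi j}{k}\big)$ for $j=0,\dots,k-1$, $a_k=\mathrm{Re}(z\bar w)$, and for $\gamma>0$ $$h_\gamma(z,w,u,v)=\Phi_2^{(k+1)}(\gamma,\dots,\gamma,1;k\gamma+1;a_0,\dots,a_{k-1},a_k)=e^{a_k}\Phi_2^{(k)}(\gamma,\dots,\gamma;k\gamma+1;a_0-a_k,\dots,a_{k-1}-a_k).$$ Then $$E_\kappa(z,w)=\int_{-1}^1\int_{-1}^1\Big[h_{\alpha+\beta}(z,w,u,v)+\frac{2^{1-k}\Gamma(k(\alpha+\beta)+1)}{\Gamma(k(\alpha+\beta+1)+1)}|zw|^k\,\xi_{u-1,v-1}(k\phi_1,k\phi_2)\,h_{\alpha+\beta+1}(z,w,u,v)\Big]d\mu^\alpha(u)\,d\mu^\beta(v).$$ Equivalently, with $t_k=1-\sum_{j=0}^{k-1}t_j$ and $d\omega_\nu=\prod_{j=0}^{k-1}t_j^{\nu-1}dt_0\cdots dt_{k-1}$ on $T^k$, $$E_\kappa(z,w)=\frac{\Gamma(k(\alpha+\beta)+1)}{\Gamma(\alpha+\beta)^k}\int_{-1}^1\!\int_{-1}^1\!\int_{T^k}e^{\sum_{j=0}^ka_jt_j}d\omega_{\alpha+\beta}\,d\mu^\alpha(u)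d\mu^\beta(v)+\frac{2^{1-k}\Gamma(k(\alpha+\beta)+1)}{\Gamma(\alpha+\beta+1)^k}\int_{-1}^1\!\int_{-1}^1\!\int_{T^k}|zw|^k\xi_{u-1,v-1}(k\phi_1,k\phi_2)e^{\sum_{j=0}^ka_jt_j}d\omega_{\alpha+\beta+1}\,d\mu^\alpha(u)d\mu^\beta(v).$$
   Context: Identify $\mathbb{R}^2$ with $\mathbb{C}$, $\langle z,w\rangle=\mathrm{Re}(z\bar w)$, $z=|z|e^{i\phi_1}$, $w=|w|e^{i\phi_2}$. The dihedral group $I_{2k}$ (order $4k$) contains the reflections $z\mapsto\bar ze^{ij\pi/k}$, $j=0,\dots,2k-1$, forming two conjugacy classes ($j$ even, containing $z\mapsto\bar z$; $j$ odd); $\kappa=(\alpha,\beta)$ is $\alpha$ on the class with $j$ even and $\beta$ on the class with $j$ odd. The Dunkl kernel is $E_\kappa(z,w)=V_\kappa(e^{\langle\cdot,w\rangle})(z)$, i.e. the joint eigenfunction $T_j^{(z)}E_\kappa=w_jE_\kappa$ of the Dunkl operators with $E_\kappa(0,w)=1$. Measures on $[-1,1]$: $d\mu^\alpha(u)=\frac{\Gamma(\alpha+1/2)}{\sqrt\pi\Gamma(\alpha)}(1+u)(1-u^2)^{\alpha-1}du$. $\xi_{u,v}(\theta_1,\theta_2)=v\cos\theta_1\cos\theta_2+u\sin\theta_1\sin\theta_2$ (for any real $u,v$), $q_{u,v}=\arccos\xi_{u,v}\in[0,\pi]$ for $u,v\in[-1,1]$. The Humbert function is $\Phi_2^{(m)}(\beta_1,\dots,\beta_m;\gamma;x_1,\dots,x_m)=\sum_{j_1,\dots,j_m\ge0}\frac{(\beta_1)_{j_1}\cdots(\beta_m)_{j_m}}{(\gamma)_{j_1+\cdots+j_m}}\frac{x_1^{j_1}}{j_1!}\cdots\frac{x_m^{j_m}}{j_m!}$,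 $(\cdot)_j$ the Pochhammer symbol. $T^k=\{(t_0,\dots,t_{k-1}):t_j>0,\sum t_j<1\}$. *)

theory Defs
  imports "HOL-Analysis.Analysis" "HOL-Probability.Probability"
begin

text \<open>R^2 is identified with the complex plane; inner product Re(z * cnj w).\<close>
definition cinner :: "complex \<Rightarrow> complex \<Rightarrow> real" where
  "cinner z w = Re (z * cnj w)"

definition dih_refl :: "nat \<Rightarrow> nat \<Rightarrow> complex \<Rightarrow> complex" where
  "dih_refl k j z = cnj z * cis (real j * pi / real k)"

text \<open>A root (normal vector of the mirror) of the reflection dih_refl k j.\<close>
definition dih_root :: "nat \<Rightarrow> nat \<Rightarrow> complex" where
  "dih_root k j = \<i> * cis (real j * pi / (2 * real k))"

text \<open>Multiplicity: alpha on the class with j even (containing conjugation), beta on j odd.\<close>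
definition dih_mult :: "real \<Rightarrow> real \<Rightarrow> nat \<Rightarrow> real" where
  "dih_mult \<alpha> \<beta> j = (if even j then \<alpha> else \<beta>)"

text \<open>Dunkl operator in direction xi (one positive root per reflection).\<close>
definition dunkl_op :: "nat \<Rightarrow> real \<Rightarrow> real \<Rightarrow> complex \<Rightarrow> (complex \<Rightarrow> real) \<Rightarrow> complex \<Rightarrow> real" where
  "dunkl_op k \<alpha> \<beta> \<xi> f x =
     frechet_derivative f (at x) \<xi>
     + (\<Sum>j<2*k. dih_mult \<alpha> \<beta> j * cinner (dih_root k j) \<xi>
                  * (f x - f (dih_refl k j x)) / cinner (dih_root k j) x)"

text \<open>Points off all mirrors (where the difference quotients are literally defined).\<close>
definition dih_regular :: "nat \<Rightarrow> complex \<Rightarrow> bool" where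
  "dih_regular k x \<longleftrightarrow> (\<forall>j<2*k. cinner (dih_root k j) x \<noteq> 0)"

definition is_dunkl_kernel :: "nat \<Rightarrow> real \<Rightarrow> real \<Rightarrow> complex \<Rightarrow> (complex \<Rightarrow> real) \<Rightarrow> bool" where
  "is_dunkl_kernel k \<alpha> \<beta> w f \<longleftrightarrow>
     f 0 = 1 \<and> (\<forall>x. f differentiable (at x))
     \<and> continuous_on UNIV (\<lambda>x. frechet_derivative f (at x) 1)
     \<and> continuous_on UNIV (\<lambda>x. frechet_derivative f (at x) \<i>)
     \<and> (\<forall>x. dih_regular k x \<longrightarrow>
           dunkl_op k \<alpha> \<beta> 1 f x = cinner 1 w * f x \<and>
           dunkl_op k \<alpha> \<beta> \<i> f x = cinner \<i> w * f x)"

definition dunkl_kernel :: "nat \<Rightarrow> real \<Rightarrow> real \<Rightarrow> complex \<Rightarrow> complex \<Rightarrow> real" where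
  "dunkl_kernel k \<alpha> \<beta> z w = (THE f. is_dunkl_kernel k \<alpha> \<beta> w f) z"

definition mu_dens :: "real \<Rightarrow> real \<Rightarrow> real" where
  "mu_dens \<alpha> u = Gamma (\<alpha> + 1/2) / (sqrt pi * Gamma \<alpha>) * (1 + u) * (1 - u\<^sup>2) powr (\<alpha> - 1)"

definition xi_uv :: "real \<Rightarrow> real \<Rightarrow> real \<Rightarrow> real \<Rightarrow> real" where
  "xi_uv u v \<theta>1 \<theta>2 = v * cos \<theta>1 * cos \<theta>2 + u * sin \<theta>1 * sin \<theta>2"

definition q_uv :: "real \<Rightarrow> real \<Rightarrow> real \<Rightarrow> real \<Rightarrow> real" where
  "q_uv u v \<theta>1 \<theta>2 = arccos (xi_uv u v \<theta>1 \<theta>2)"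

definition humbert2 :: "nat \<Rightarrow> (nat \<Rightarrow> real) \<Rightarrow> real \<Rightarrow> (nat \<Rightarrow> real) \<Rightarrow> real" where
  "humbert2 m b c x =
     (\<Sum>\<^sub>\<infinity> js \<in> {js :: nat \<Rightarrow> nat. \<forall>i\<ge>m. js i = 0}.
        (\<Prod>i<m. pochhammer (b i) (js i) * x i ^ js i / fact (js i))
        / pochhammer c (\<Sum>i<m. js i))"

definition a_coef :: "nat \<Rightarrow> complex \<Rightarrow> complex \<Rightarrow> real \<Rightarrow> real \<Rightarrow> nat \<Rightarrow> real" where
  "a_coef k z w u v j =
     (if j < k then cmod z * cmod w *
        cos ((q_uv u v (real k * Arg z) (real k * Arg w) + 2 * pi * real j) / real k)
      else Re (z * cnj w))"

definition h_fun :: "nat \<Rightarrow> real \<Rightarrow> complex \<Rightarrow> complex \<Rightarrow> real \<Rightarrow> real \<Rightarrow> real" where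
  "h_fun k \<gamma> z w u v =
     humbert2 (k + 1) (\<lambda>i. if i < k then \<gamma> else 1) (real k * \<gamma> + 1) (a_coef k z w u v)"

definition simplexT :: "nat \<Rightarrow> (nat \<Rightarrow> real) set" where
  "simplexT k = {t \<in> PiE {..<k} (\<lambda>_. UNIV). (\<forall>j<k. t j > 0) \<and> (\<Sum>j<k. t j) < 1}"

end

theory Submission
  imports Defs "HOL-Computational_Algebra.Polynomial_FPS"
    "HOL-Computational_Algebra.Fundamental_Theorem_Algebra"
begin

text \<open>
  Write \<open>g = \<alpha> + \<beta>\<close>. If the Humbert function is expanded into its homogeneous parts and the part of degree \<open>n\<close>
  is multiplied by \<open>(k g + 1)\<^sub>n\<close> (a formal Laplace transform), then \<open>h\<^sub>\<gamma>\<close> becomes the product of the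
  \<open>(1 - a\<^sub>j X)\<^sup>-\<^sup>\<gamma>\<close>, \<open>j < k\<close>, divided by \<open>1 - a\<^sub>k X\<close>. The product of the factors \<open>1 - a\<^sub>j X\<close>, \<open>j < k\<close>, is a polynomial
  \<open>F = P - v p - u q\<close> with \<open>P\<close> depending on \<open>|z w|\<close> only and \<open>p\<close>, \<open>q\<close> the products of the real and imaginary
  parts of \<open>z\<^sup>k\<close>, \<open>w\<^sup>k\<close>, up to a constant times \<open>X\<^sup>k\<close>. At \<open>u = v = 1\<close> it contains the factor \<open>1 - a\<^sub>k X\<close>, and the
  bracket of the theorem collapses to \<open>M F\<^sup>-\<^sup>g\<^sup>-\<^sup>1\<close>, where \<open>M\<close> is the product of \<open>1 - \<langle>\<rho> z, w\<rangle> X\<close> over the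
  nontrivial rotations \<open>\<rho>\<close> of order dividing \<open>k\<close>.

  Let \<open>J\<close> be the integral of \<open>F\<^sup>-\<^sup>g\<^sup>-\<^sup>1\<close>. Integration by parts in \<open>u\<close> and \<open>v\<close> expresses the values of \<open>J\<close> at
  reflected points through \<open>J\<close> itself, and logarithmic differentiation of the products over the reflections turns
  the Dunkl equation for \<open>M J\<close> into one ring identity that holds for every derivation acting on \<open>P\<close>, \<open>p\<close>, \<open>q\<close>.
  Dividing the coefficients by \<open>(k g + 1)\<^sub>n\<close> again gives a solution of the Dunkl system. It is the only one: the
  difference \<open>d\<close> of two solutions satisfies the radial equation, and a positive maximum of \<open>d exp (- C |z|)\<close>
  over a ball contradicts it. The simplex form is the termwise Dirichlet integral of the exponential series.
\<close>

text \<open>The \<open>a_j\<close> involve \<open>Arg\<close> and an arccosine, so they are not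
  smooth in \<open>z\<close>. Only their symmetric functions are: the coefficients of
  \<open>F\<close> are polynomials in Re z, Im z, u, v. All calculus is therefore done on
  \<open>F\<close>, coefficient by coefficient, and convergence matters only once the factor
  \<open>1 / (k g + 1)_n\<close> is restored. The weight \<open>(k g + 1)_n\<close> serves twice. By
  \<open>(c)_(n+1) = (c)_n (c + n)\<close> the eigenvalue equation becomes
  \<open>T_h L = <h, w> X (k g + 1 + X d/dX) L\<close> for the weighted series \<open>L\<close>. By
  \<open>(k g + 1)_(n+k) = (k g + 1)_k (k (g + 1) + 1)_n\<close> it absorbs the \<open>X^k\<close>
  of the second summand; this is the quotient of Gamma values in the theorem, while
  \<open>2^(1-k)\<close> comes from the product of the \<open>x - cos ((t + 2 pi j) / k)\<close>.
  The difference quotients are tamed by multiplying with \<open>A = 1 - a_k X\<close>. A reflection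
  changes \<open>A\<close> by a multiple of the linear form of its root, which cancels the
  denominator. The rest has the same numerator for all reflections of a class, so its denominators
  add up to a logarithmic derivative: of Im z^k for even \<open>j\<close>, of Re z^k for odd
  \<open>j\<close>.\<close>

unbundle no vec_syntax
unbundle fps_syntax

section \<open>Real powers and coefficientwise calculus of formal power series\<close>

text \<open>The power \<open>D\<^sup>c\<close>; composition of series is only meaningful here if \<open>D\<close> has constant coefficient 1.\<close>
definition fpow :: "real \<Rightarrow> real fps \<Rightarrow> real fps" where
  "fpow c D = fps_compose (fps_binomial c) (D - 1)"

lemma fpow_nth_0 [simp]: "fpow c D $ 0 = 1"
  by (simp add: fpow_def)

lemma fps_deriv_binomial: "fps_deriv (fps_binomial c) = fps_const c * fps_binomial (c - 1 :: real)"
  by (rule fps_ext) (simp add: gbinomial_absorption flip: of_nat_Suc add: add.commute)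

lemma fps_deriv_fpow:
  assumes "D $ 0 = 1"
  shows "fps_deriv (fpow c D) = fps_const c * fpow (c - 1) D * fps_deriv D"
  using assms by (simp add: fpow_def fps_compose_deriv fps_deriv_binomial
      fps_compose_mult_distrib fps_const_compose)

lemma fpow_add:
  assumes "D $ 0 = 1"
  shows "fpow (a + b) D = fpow a D * fpow b D"
  using assms by (simp add: fpow_def fps_binomial_add_mult fps_compose_mult_distrib)

lemma fpow_0 [simp]: "fpow 0 D = 1"
proof -
  have "fps_binomial (0::real) = 1"
    by (rule fps_ext) (simp add: gbinomial_0_left)
  then show ?thesis by (simp add: fpow_def)
qed

lemma fpow_1: assumes "D $ 0 = 1" shows "fpow 1 D = D"
proof -
  have "(1::real) gchoose n = (if n \<le> 1 then 1 else 0)" for n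
    using binomial_gbinomial[of 1 n, where ?'a = real] by (cases n; cases "n - 1") auto
  then have "fps_binomial (1::real) = 1 + fps_X"
    by (intro fps_ext) (auto simp: fps_X_def)
  then show ?thesis using assms by (simp add: fpow_def fps_compose_add_distrib)
qed

lemma fpow_shift:
  assumes "D $ 0 = 1"
  shows "D * fpow c D = fpow (c + 1) D"
  using fpow_add[OF assms, of 1 c] fpow_1[OF assms] by (simp add: add.commute)

text \<open>A power is determined by its logarithmic derivative: \<open>G\<close> times the power
  \<open>- c\<close> of \<open>D\<close> has derivative 0 and constant coefficient 1.
  Multiplicativity in the base is obtained from this.\<close>

lemma fpow_unique:
  assumes "D $ 0 = 1" "G $ 0 = 1" "D * fps_deriv G = fps_const c * fps_deriv D * G"
  shows "G = fpow c D"
proof -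
  let ?H = "fpow (- c) D"
  have sh: "D * fpow (- c - 1) D = ?H" using fpow_shift[OF assms(1), of "- c - 1"] by simp
  have "D * fps_deriv (G * ?H)
      = (D * fps_deriv G) * ?H + G * (fps_const (- c) * (D * fpow (- c - 1) D) * fps_deriv D)"
    by (simp add: fps_deriv_fpow[OF assms(1)] algebra_simps)
  also have "\<dots> = 0"
    unfolding assms(3) sh by (simp add: algebra_simps flip: fps_const_neg)
  finally have "fps_deriv (G * ?H) = 0" using assms(1) by auto
  then have "G * ?H = fps_const ((G * ?H) $ 0)" by (metis fps_deriv_eq_0_iff)
  then have "G * ?H = 1" using assms(2) by simp
  moreover have "?H * fpow c D = 1" using fpow_add[OF assms(1), of "- c" c] by simp
  ultimately show ?thesis by (metis mult.assoc mult_1 mult.right_neutral)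
qed

lemma fpow_mult:
  assumes "A $ 0 = 1" "B $ 0 = 1"
  shows "fpow c (A * B) = fpow c A * fpow c B"
proof (rule fpow_unique[symmetric])
  have A: "A * fpow (c - 1) A = fpow c A" and B: "B * fpow (c - 1) B = fpow c B"
    using fpow_shift[OF assms(1), of "c - 1"] fpow_shift[OF assms(2), of "c - 1"] by auto
  have "A * B * fps_deriv (fpow c A * fpow c B)
     = fps_const c * ((A * fpow (c - 1) A) * B * fps_deriv A * fpow c B
        + fpow c A * (B * fpow (c - 1) B) * A * fps_deriv B)"
    using assms by (simp add: fps_deriv_fpow algebra_simps)
  then show "A * B * fps_deriv (fpow c A * fpow c B)
     = fps_const c * fps_deriv (A * B) * (fpow c A * fpow c B)"
    unfolding A B by (simp add: algebra_simps)
qed (use assms in auto)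

lemma fpow_prod:
  assumes "\<And>i. i \<in> S \<Longrightarrow> f i $ 0 = 1"
  shows "fpow c (prod f S) = (\<Prod>i\<in>S. fpow c (f i))"
proof -
  have "fpow c (prod f S) = (\<Prod>i\<in>S. fpow c (f i)) \<and> prod f S $ 0 = 1"
    using assms
  proof (induction S rule: infinite_finite_induct)
    case (insert x F)
    then show ?case by (auto simp: fpow_mult)
  qed (auto simp: fpow_1 fpow_def)
  then show ?thesis by blast
qed

abbreviation lin :: "real \<Rightarrow> real fps" where
  "lin a \<equiv> 1 - fps_const a * fps_X"

text \<open>The link to the Humbert function: its terms are products of these coefficients, so its
  part of degree \<open>n\<close> is the coefficient of \<open>X^n\<close> in a product of such
  powers, divided by \<open>(c)_n\<close>.\<close>

lemma fpow_lin_nth: "fpow (- b) (lin x) $ n = pochhammer b n * x ^ n / fact n"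
proof -
  have eq: "lin x - 1 = fps_const (- x) * fps_X"
    by (simp flip: fps_const_neg)
  show ?thesis
    unfolding fpow_def eq fps_compose_linear
    by (simp add: gbinomial_pochhammer flip: power_mult_distrib)
qed

section \<open>Continuity of families of series, coefficient by coefficient\<close>

definition fps_continuous_on :: "'a::topological_space set \<Rightarrow> ('a \<Rightarrow> real fps) \<Rightarrow> bool" where
  "fps_continuous_on S f \<longleftrightarrow> (\<forall>n. continuous_on S (\<lambda>x. f x $ n))"

lemma fps_continuous_on_const: "fps_continuous_on S (\<lambda>x. c)"
  by (auto simp: fps_continuous_on_def)

lemma fps_continuous_on_fps_const:
  assumes "continuous_on S f"
  shows "fps_continuous_on S (\<lambda>x. fps_const (f x))"
  unfolding fps_continuous_on_def
proof
  show "continuous_on S (\<lambda>x. fps_const (f x) $ n)" for n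
    using assms by (cases n) auto
qed

lemma fps_continuous_on_add:
  "fps_continuous_on S f \<Longrightarrow> fps_continuous_on S g \<Longrightarrow> fps_continuous_on S (\<lambda>x. f x + g x)"
  by (auto simp: fps_continuous_on_def intro!: continuous_intros)

lemma fps_continuous_on_diff:
  "fps_continuous_on S f \<Longrightarrow> fps_continuous_on S g \<Longrightarrow> fps_continuous_on S (\<lambda>x. f x - g x)"
  by (auto simp: fps_continuous_on_def intro!: continuous_intros)

lemma fps_continuous_on_uminus:
  "fps_continuous_on S f \<Longrightarrow> fps_continuous_on S (\<lambda>x. - f x)"
  by (auto simp: fps_continuous_on_def intro!: continuous_intros)

lemma fps_continuous_on_mult:
  "fps_continuous_on S f \<Longrightarrow> fps_continuous_on S g \<Longrightarrow> fps_continuous_on S (\<lambda>x. f x * g x)"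
  by (auto simp: fps_continuous_on_def fps_mult_nth intro!: continuous_intros)

lemma fps_continuous_on_power:
  "fps_continuous_on S f \<Longrightarrow> fps_continuous_on S (\<lambda>x. f x ^ m)"
  by (induction m) (auto intro: fps_continuous_on_mult fps_continuous_on_const)

lemma fps_continuous_on_sum:
  "(\<And>i. i \<in> A \<Longrightarrow> fps_continuous_on S (f i)) \<Longrightarrow> fps_continuous_on S (\<lambda>x. \<Sum>i\<in>A. f i x)"
  by (induction A rule: infinite_finite_induct) (auto intro: fps_continuous_on_add fps_continuous_on_const)

lemma fps_continuous_on_prod:
  "(\<And>i. i \<in> A \<Longrightarrow> fps_continuous_on S (f i)) \<Longrightarrow> fps_continuous_on S (\<lambda>x. \<Prod>i\<in>A. f i x)"
  by (induction A rule: infinite_finite_induct) (auto intro: fps_continuous_on_mult fps_continuous_on_const)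

lemma fps_continuous_on_fpow:
  assumes "fps_continuous_on S f"
  shows "fps_continuous_on S (\<lambda>x. fpow c (f x))"
proof -
  have "fps_continuous_on S (\<lambda>x. (f x - 1) ^ i)" for i
    using assms by (intro fps_continuous_on_power fps_continuous_on_diff fps_continuous_on_const)
  then show ?thesis
    by (auto simp: fps_continuous_on_def fpow_def fps_compose_nth intro!: continuous_intros)
qed

lemmas fps_continuous_intros = fps_continuous_on_const fps_continuous_on_fps_const
  fps_continuous_on_add fps_continuous_on_diff fps_continuous_on_mult fps_continuous_on_uminus
  fps_continuous_on_power fps_continuous_on_sum fps_continuous_on_prod fps_continuous_on_fpow

section \<open>Frechet derivatives of families of series, coefficient by coefficient\<close>

definition fps_has_derivative ::
  "('a::real_normed_vector \<Rightarrow> real fps) \<Rightarrow> ('a \<Rightarrow> real fps) \<Rightarrow> 'a \<Rightarrow> bool" where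
  "fps_has_derivative f f' x \<longleftrightarrow>
     (\<forall>n. ((\<lambda>x. f x $ n) has_derivative (\<lambda>h. f' h $ n)) (at x))"

lemma fps_has_derivative_unique:
  "fps_has_derivative f f' x \<Longrightarrow> fps_has_derivative f f'' x \<Longrightarrow> f' h = f'' h"
  unfolding fps_has_derivative_def
  by (rule fps_ext) (metis has_derivative_unique)

lemma fps_has_derivative_const: "fps_has_derivative (\<lambda>x. c) (\<lambda>h. 0) x"
  by (simp add: fps_has_derivative_def)

lemma fps_has_derivative_fps_const:
  assumes "(f has_derivative f') (at x)"
  shows "fps_has_derivative (\<lambda>x. fps_const (f x)) (\<lambda>h. fps_const (f' h)) x"
  unfolding fps_has_derivative_def
proof
  show "((\<lambda>x. fps_const (f x) $ n) has_derivative (\<lambda>h. fps_const (f' h) $ n)) (at x)" for n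
    using assms by (cases n) auto
qed

lemma fps_has_derivative_add:
  "fps_has_derivative f f' x \<Longrightarrow> fps_has_derivative g g' x \<Longrightarrow>
    fps_has_derivative (\<lambda>x. f x + g x) (\<lambda>h. f' h + g' h) x"
  by (auto simp: fps_has_derivative_def intro!: derivative_intros)

lemma fps_has_derivative_diff:
  "fps_has_derivative f f' x \<Longrightarrow> fps_has_derivative g g' x \<Longrightarrow>
    fps_has_derivative (\<lambda>x. f x - g x) (\<lambda>h. f' h - g' h) x"
  by (auto simp: fps_has_derivative_def intro!: derivative_intros)

lemma fps_has_derivative_mult:
  assumes "fps_has_derivative f f' x" "fps_has_derivative g g' x"
  shows "fps_has_derivative (\<lambda>x. f x * g x) (\<lambda>h. f x * g' h + f' h * g x) x"
  unfolding fps_has_derivative_def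
proof
  fix n
  have "((\<lambda>x. \<Sum>i=0..n. f x $ i * g x $ (n - i)) has_derivative
      (\<lambda>h. \<Sum>i=0..n. f x $ i * g' h $ (n - i) + f' h $ i * g x $ (n - i))) (at x)"
    using assms unfolding fps_has_derivative_def
    by (intro has_derivative_sum has_derivative_mult) auto
  then show "((\<lambda>x. (f x * g x) $ n) has_derivative (\<lambda>h. (f x * g' h + f' h * g x) $ n)) (at x)"
    by (simp add: fps_mult_nth sum.distrib)
qed

lemma fps_has_derivative_prod:
  assumes "finite S" "\<And>i. i \<in> S \<Longrightarrow> fps_has_derivative (f i) (f' i) x"
  shows "fps_has_derivative (\<lambda>x. \<Prod>i\<in>S. f i x) (\<lambda>h. \<Sum>i\<in>S. f' i h * (\<Prod>j\<in>S - {i}. f j x)) x"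
  using assms
proof (induction S rule: finite_induct)
  case empty
  then show ?case by (simp add: fps_has_derivative_const)
next
  case (insert a S)
  have "fps_has_derivative (\<lambda>x. f a x * (\<Prod>i\<in>S. f i x))
     (\<lambda>h. f a x * (\<Sum>i\<in>S. f' i h * (\<Prod>j\<in>S - {i}. f j x)) + f' a h * (\<Prod>i\<in>S. f i x)) x"
    using insert by (intro fps_has_derivative_mult) auto
  moreover have "f a x * (\<Sum>i\<in>S. f' i h * (\<Prod>j\<in>S - {i}. f j x)) + f' a h * (\<Prod>i\<in>S. f i x)
     = (\<Sum>i\<in>insert a S. f' i h * (\<Prod>j\<in>insert a S - {i}. f j x))" for h
  proof -
    have "(\<Prod>j\<in>insert a S - {i}. f j x) = f a x * (\<Prod>j\<in>S - {i}. f j x)" if "i \<in> S" for i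
    proof -
      have "insert a S - {i} = insert a (S - {i})" using that insert.hyps by auto
      then show ?thesis using insert.hyps by simp
    qed
    moreover have "insert a S - {a} = S" using insert.hyps by auto
    ultimately show ?thesis using insert.hyps
      by (simp add: sum_distrib_left algebra_simps cong: sum.cong)
  qed
  ultimately show ?case using insert.hyps by simp
qed

lemma fps_has_derivative_power:
  assumes "fps_has_derivative f f' x"
  shows "fps_has_derivative (\<lambda>x. f x ^ m) (\<lambda>h. of_nat m * f x ^ (m - 1) * f' h) x"
proof (induction m)
  case 0
  then show ?case by (simp add: fps_has_derivative_const)
next
  case (Suc m)
  have eq: "f x * (of_nat m * f x ^ (m - 1) * f' h) + f' h * f x ^ m = of_nat (Suc m) * f x ^ m * f' h" for h
    by (cases m) (simp_all add: algebra_simps)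
  show ?case using fps_has_derivative_mult[OF assms Suc] by (simp only: eq power_Suc diff_Suc_1)
qed

text \<open>Coefficient \<open>n\<close> of the power involves only \<open>(D - 1)^i\<close> with
  \<open>i \<le> n\<close>. So a finite sum is differentiated, and the derived binomial series is
  reassembled afterwards.\<close>

lemma fps_has_derivative_fpow:
  assumes "fps_has_derivative D D' x" "\<And>y. D y $ 0 = 1"
  shows "fps_has_derivative (\<lambda>x. fpow c (D x)) (\<lambda>h. fps_const c * fpow (c - 1) (D x) * D' h) x"
  unfolding fps_has_derivative_def
proof
  fix n
  define E where "E = (\<lambda>x. D x - 1)"
  have E0: "E y $ 0 = 0" for y by (simp add: E_def assms(2))
  \<comment> \<open>The constant coefficient of \<open>D\<close> is 1 for every argument, so its
    derivative vanishes. This removes the surplus top term that the index shift creates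
    below.\<close>
  have D'0: "D' h $ 0 = 0" for h
  proof -
    have "((\<lambda>x. D x $ 0) has_derivative (\<lambda>h. D' h $ 0)) (at x)"
      using assms(1) unfolding fps_has_derivative_def by blast
    moreover have "((\<lambda>x. D x $ 0) has_derivative (\<lambda>h. 0)) (at x)" by (simp add: assms(2))
    ultimately show ?thesis using has_derivative_unique by metis
  qed
  have E': "fps_has_derivative E D' x"
    unfolding E_def using fps_has_derivative_diff[OF assms(1) fps_has_derivative_const] by simp
  have pw0: "(E y ^ i) $ l = 0" if "l < i" for y i l
    using startsby_zero_power_prefix[OF E0] that by auto
  have sum_ext: "(a oo E x) $ l = (\<Sum>i=0..n. a $ i * (E x ^ i) $ l)" if "l \<le> n" for a l
    unfolding fps_compose_nth using that pw0 by (intro sum.mono_neutral_left) auto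
  have "((\<lambda>x. \<Sum>i=0..n. (c gchoose i) * (E x ^ i) $ n) has_derivative
      (\<lambda>h. \<Sum>i=0..n. (c gchoose i) * (of_nat i * E x ^ (i - 1) * D' h) $ n)) (at x)"
    using fps_has_derivative_power[OF E'] unfolding fps_has_derivative_def
    by (intro has_derivative_sum has_derivative_mult_right) auto
  moreover have "(\<Sum>i=0..n. (c gchoose i) * (of_nat i * E x ^ (i - 1) * D' h) $ n)
      = (fps_const c * fpow (c - 1) (D x) * D' h) $ n" for h
  proof -
    have "(fps_const c * fpow (c - 1) (D x) * D' h) $ n = ((fps_deriv (fps_binomial c) oo E x) * D' h) $ n"
      using E0 by (simp add: fpow_def fps_deriv_binomial fps_compose_mult_distrib fps_const_compose E_def)
    also have "\<dots> = (\<Sum>l=0..n. (\<Sum>i=0..n. fps_deriv (fps_binomial c) $ i * (E x ^ i) $ l) * D' h $ (n - l))"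
      unfolding fps_mult_nth by (intro sum.cong refl) (simp add: sum_ext del: fps_deriv_nth)
    also have "\<dots> = (\<Sum>i=0..n. fps_deriv (fps_binomial c) $ i * (E x ^ i * D' h) $ n)"
      unfolding fps_mult_nth sum_distrib_left sum_distrib_right
      by (subst sum.swap) (simp add: mult.assoc)
    also have "\<dots> = (\<Sum>i=0..n. (c gchoose Suc i) * (of_nat (Suc i) * E x ^ (Suc i - 1) * D' h) $ n)"
      by (intro sum.cong refl) (simp add: fps_of_nat[symmetric] mult.assoc del: of_nat_Suc)
    also have "\<dots> = (\<Sum>i\<in>{Suc 0..Suc n}. (c gchoose i) * (of_nat i * E x ^ (i - 1) * D' h) $ n)"
      by (subst sum.shift_bounds_cl_Suc_ivl) simp
    also have "\<dots> = (\<Sum>i\<in>{0..Suc n}. (c gchoose i) * (of_nat i * E x ^ (i - 1) * D' h) $ n)"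
      by (intro sum.mono_neutral_left) (auto simp: not_less_eq_eq)
    also have "\<dots> = (\<Sum>i\<in>{0..n}. (c gchoose i) * (of_nat i * E x ^ (i - 1) * D' h) $ n)"
    proof -
      \<comment> \<open>\<open>E x ^ n\<close> has order at least \<open>n\<close> and
        \<open>D' h\<close> has order at least 1.\<close>
      have "(E x ^ n * D' h) $ n = 0"
        unfolding fps_mult_nth using pw0 D'0
        by (intro sum.neutral ballI) (metis atLeastAtMost_iff diff_self_eq_0 le_neq_implies_less mult_eq_0_iff)
      then have "(of_nat (Suc n) * E x ^ n * D' h) $ n = 0"
        by (simp add: fps_of_nat[symmetric] mult.assoc del: of_nat_Suc)
      then show ?thesis by simp
    qed
    finally show ?thesis by simp
  qed
  ultimately show "((\<lambda>x. fpow c (D x) $ n) has_derivative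
      (\<lambda>h. (fps_const c * fpow (c - 1) (D x) * D' h) $ n)) (at x)"
    by (simp add: fpow_def fps_compose_nth E_def)
qed

section \<open>Products over equally spaced cosines\<close>

lemma prod_roots_unity:
  fixes x y :: complex
  assumes "k \<ge> 1"
  shows "(\<Prod>j<k. x - cis (2 * pi * real j / real k) * y) = x ^ k - y ^ k"
proof (cases "y = 0")
  case True
  then show ?thesis using assms by simp
next
  case False
  define p :: "complex poly" where "p = monom 1 k + [:- 1:]"
  have deg: "degree p = k"
    unfolding p_def using assms by (subst degree_add_eq_left) (auto simp: degree_monom_eq)
  have lc: "lead_coeff p = 1"
    unfolding deg unfolding p_def using assms by (cases k) auto
  have "rsquarefree p"
    unfolding rsquarefree_roots
  proof (intro allI notI)
    fix a assume *: "poly p a = 0 \<and> poly (pderiv p) a = 0"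
    then have "a ^ k = 1" "of_nat k * a ^ (k - 1) = 0"
      by (auto simp: p_def poly_monom pderiv_add pderiv_monom pderiv_pCons)
    then show False using assms by (auto simp: power_0_left split: if_splits)
  qed
  from complex_poly_decompose_rsquarefree[OF this] lc
  have "p = (\<Prod>z | poly p z = 0. [:- z, 1:])" by simp
  also have "{z. poly p z = 0} = {z. z ^ k = 1}" by (auto simp: p_def poly_monom)
  also have "(\<Prod>z\<in>\<dots>. [:- z, 1:]) = (\<Prod>j<k. [:- cis (2 * pi * real j / real k), 1:])"
    using assms by (intro prod.reindex_bij_betw[symmetric] Complex.bij_betw_roots_unity) auto
  finally have "poly p (x / y) = (\<Prod>j<k. x / y - cis (2 * pi * real j / real k))"
    by (simp add: poly_prod)
  then have "(x / y) ^ k - 1 = (\<Prod>j<k. x / y - cis (2 * pi * real j / real k))"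
    by (simp add: p_def poly_monom)
  then have "y ^ k * ((x / y) ^ k - 1) = y ^ k * (\<Prod>j<k. x / y - cis (2 * pi * real j / real k))"
    by simp
  also have "y ^ k * (\<Prod>j<k. x / y - cis (2 * pi * real j / real k))
      = (\<Prod>j<k. y * (x / y - cis (2 * pi * real j / real k)))"
    by (simp add: prod.distrib)
  also have "\<dots> = (\<Prod>j<k. x - cis (2 * pi * real j / real k) * y)"
    using False by (intro prod.cong) (auto simp: field_simps)
  finally have "y ^ k * ((x / y) ^ k - 1) = (\<Prod>j<k. x - cis (2 * pi * real j / real k) * y)" .
  moreover have "y ^ k * ((x / y) ^ k - 1) = x ^ k - y ^ k"
    using False by (simp add: power_divide right_diff_distrib)
  ultimately show ?thesis by simp
qed

text \<open>Write \<open>x = (y + 1/y) / 2\<close>. Then \<open>2 y (x - cos \<theta>)\<close> is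
  the product of \<open>y - cis \<theta>\<close> and \<open>y - cis (- \<theta>)\<close>, so by the
  roots of unity the product times \<open>(2 y)^k\<close> equals
  \<open>y^(2k) - 2 y^k cos t + 1\<close>. The shift \<open>t\<close> enters only through
  \<open>cos t\<close>; comparing with \<open>t = 0\<close> gives the claim.\<close>

lemma prod_diff_cos:
  fixes x t :: real
  assumes "k \<ge> 1"
  shows "(\<Prod>j<k. x - cos ((t + 2 * pi * real j) / real k))
     = (\<Prod>j<k. x - cos (2 * pi * real j / real k)) - 2 / 2 ^ k * (cos t - 1)"
proof -
  define y where "y = complex_of_real x + csqrt ((of_real x)\<^sup>2 - 1)"
  have y2: "y\<^sup>2 + 1 = 2 * of_real x * y"
  proof -
    have "(csqrt ((of_real x)\<^sup>2 - 1))\<^sup>2 = (of_real x)\<^sup>2 - 1" by simp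
    then show ?thesis unfolding y_def by (simp only: power2_sum) (simp add: power2_eq_square algebra_simps)
  qed
  have y0: "y \<noteq> 0" using y2 by auto
  have key: "(2 * y) ^ k * (\<Prod>j<k. of_real x - of_real (cos ((t + 2 * pi * real j) / real k)))
     = y ^ k * y ^ k - 2 * y ^ k * of_real (cos t) + 1" for t
  proof -
    have cisk: "cis (t / real k) ^ k = cis t" "cis (- (t / real k)) ^ k = cis (- t)"
      using assms by (simp_all add: Complex.DeMoivre)
    have fac: "2 * y * (of_real x - of_real (cos ((t + 2 * pi * real j) / real k)))
       = (y - cis (2 * pi * real j / real k) * cis (t / real k))
         * (y - cnj (cis (2 * pi * real j / real k) * cis (t / real k)))" for j
    proof -
      let ?th = "(t + 2 * pi * real j) / real k"
      have c: "cis (2 * pi * real j / real k) * cis (t / real k) = cis ?th"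
        by (simp add: cis_mult add_divide_distrib add.commute)
      have "(y - cis ?th) * (y - cnj (cis ?th)) = y\<^sup>2 - y * (cis ?th + cnj (cis ?th)) + cis ?th * cnj (cis ?th)"
        by (simp add: algebra_simps power2_eq_square)
      also have "cis ?th + cnj (cis ?th) = 2 * of_real (cos ?th)"
        by (simp add: complex_eq_iff)
      also have "cis ?th * cnj (cis ?th) = 1" by (simp add: cis_cnj cis_mult)
      also have "y\<^sup>2 - y * (2 * of_real (cos ?th)) + 1 = 2 * of_real x * y - y * (2 * of_real (cos ?th))"
        using y2 by (simp add: algebra_simps)
      finally show ?thesis unfolding c by (simp add: algebra_simps)
    qed
    have "(2 * y) ^ k * (\<Prod>j<k. of_real x - of_real (cos ((t + 2 * pi * real j) / real k)))
      = (\<Prod>j<k. 2 * y * (of_real x - of_real (cos ((t + 2 * pi * real j) / real k))))"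
      by (subst prod.distrib) simp
    \<comment> \<open>The second factor is written as the conjugate of a product in
      \<open>cnj y\<close>, so that \<open>prod_roots_unity\<close> applies with the same
      roots.\<close>
    also have "\<dots> = (\<Prod>j<k. y - cis (2 * pi * real j / real k) * cis (t / real k))
        * cnj (\<Prod>j<k. cnj y - cis (2 * pi * real j / real k) * cis (t / real k))"
      unfolding fac by (simp add: prod.distrib)
    also have "\<dots> = (y ^ k - cis t) * (y ^ k - cnj (cis t))"
      unfolding prod_roots_unity[OF assms] cisk by simp
    also have "\<dots> = y ^ k * y ^ k - y ^ k * (cis t + cnj (cis t)) + cis t * cnj (cis t)"
      by (simp add: algebra_simps)
    also have "cis t + cnj (cis t) = 2 * of_real (cos t)" by (simp add: complex_eq_iff)
    also have "cis t * cnj (cis t) = 1" by (simp add: cis_cnj cis_mult)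
    finally show ?thesis by (simp add: algebra_simps)
  qed
  have "(2 * y) ^ k * (\<Prod>j<k. of_real x - of_real (cos ((t + 2 * pi * real j) / real k)))
      = (2 * y) ^ k * ((\<Prod>j<k. of_real x - of_real (cos (2 * pi * real j / real k)))
          - of_real (2 / 2 ^ k * (cos t - 1)))"
  proof -
    have "(2 * y) ^ k * of_real (2 / 2 ^ k * (cos t - 1)) = 2 * y ^ k * (of_real (cos t) - 1)"
      by (simp add: power_mult_distrib)
    moreover have "(2 * y) ^ k * (\<Prod>j<k. of_real x - of_real (cos (2 * pi * real j / real k)))
        = y ^ k * y ^ k - 2 * y ^ k + 1"
      using key[of 0] by simp
    ultimately show ?thesis
      unfolding right_diff_distrib[of "(2 * y) ^ k"] key[of t] by (simp only:) (simp add: algebra_simps)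
  qed
  then have "(\<Prod>j<k. of_real x - of_real (cos ((t + 2 * pi * real j) / real k)))
      = (\<Prod>j<k. of_real x - of_real (cos (2 * pi * real j / real k)))
          - complex_of_real (2 / 2 ^ k * (cos t - 1))"
    using y0 by simp
  then have "complex_of_real (\<Prod>j<k. x - cos ((t + 2 * pi * real j) / real k))
     = complex_of_real ((\<Prod>j<k. x - cos (2 * pi * real j / real k)) - 2 / 2 ^ k * (cos t - 1))"
    by simp
  then show ?thesis using of_real_eq_iff by blast
qed

text \<open>This is \<open>2\<^sup>1\<^sup>-\<^sup>k (r X)\<^sup>k T\<^sub>k(1 / (r X))\<close> for the Chebyshev polynomial \<open>T\<^sub>k\<close>.\<close>
definition chebP :: "nat \<Rightarrow> real \<Rightarrow> real fps" where
  "chebP k r = (\<Prod>j<k. lin (r * cos (2 * pi * real j / real k))) + fps_const (2 / 2 ^ k * r ^ k) * fps_X ^ k"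

lemma prod_lin_cos:
  assumes "k \<ge> 1"
  shows "(\<Prod>j<k. lin (r * cos ((t + 2 * pi * real j) / real k)))
     = chebP k r - fps_const (2 / 2 ^ k * r ^ k * cos t) * fps_X ^ k"
proof -
  \<comment> \<open>Polynomials in place of series: the identity can then be checked by evaluation
    at every real \<open>s\<close>, where \<open>prod_diff_cos\<close> is used at
    \<open>x = 1 / (r s)\<close>.\<close>
  define p where "p = (\<lambda>c. [:1, - (r * c):])"
  have lin: "lin (r * c) = fps_of_poly (p c)" for c
    by (simp add: p_def fps_of_poly_pCons mult.commute flip: fps_const_neg)
  have "(\<Prod>j<k. p (cos ((t + 2 * pi * real j) / real k)))
     = (\<Prod>j<k. p (cos (2 * pi * real j / real k))) - monom (2 / 2 ^ k * r ^ k * (cos t - 1)) k"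
  proof (rule poly_eq_poly_eq_iff[THEN iffD1])
    show "poly (\<Prod>j<k. p (cos ((t + 2 * pi * real j) / real k)))
      = poly ((\<Prod>j<k. p (cos (2 * pi * real j / real k))) - monom (2 / 2 ^ k * r ^ k * (cos t - 1)) k)"
    proof
      fix s
      show "poly (\<Prod>j<k. p (cos ((t + 2 * pi * real j) / real k))) s
      = poly ((\<Prod>j<k. p (cos (2 * pi * real j / real k))) - monom (2 / 2 ^ k * r ^ k * (cos t - 1)) k) s"
      proof (cases "r * s = 0")
        case True
        then have "poly (p c) s = 1" for c by (auto simp: p_def)
        moreover have "r ^ k * s ^ k = 0" using True assms by auto
        then have "r ^ k * (cos t - 1) * s ^ k = 0" by auto
        ultimately show ?thesis by (auto simp: poly_prod poly_monom)
      next
        case False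
        then have e: "poly (p c) s = (r * s) * (1 / (r * s) - c)" for c
          by (simp add: p_def field_simps)
        have "poly (\<Prod>j<k. p (cos ((t + 2 * pi * real j) / real k))) s
           = (r * s) ^ k * (\<Prod>j<k. 1 / (r * s) - cos ((t + 2 * pi * real j) / real k))"
          unfolding poly_prod e by (subst prod.distrib) simp
        also have "\<dots> = (r * s) ^ k * (\<Prod>j<k. 1 / (r * s) - cos (2 * pi * real j / real k))
            - (r * s) ^ k * (2 / 2 ^ k * (cos t - 1))"
          unfolding prod_diff_cos[OF assms] by (simp only: right_diff_distrib)
        also have "(r * s) ^ k * (\<Prod>j<k. 1 / (r * s) - cos (2 * pi * real j / real k))
          = poly (\<Prod>j<k. p (cos (2 * pi * real j / real k))) s"
          unfolding poly_prod e by (subst prod.distrib) simp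
        finally show ?thesis by (simp add: poly_monom power_mult_distrib algebra_simps)
      qed
    qed
  qed
  then have "(\<Prod>j<k. fps_of_poly (p (cos ((t + 2 * pi * real j) / real k))))
     = (\<Prod>j<k. fps_of_poly (p (cos (2 * pi * real j / real k))))
       - fps_const (2 / 2 ^ k * r ^ k * (cos t - 1)) * fps_X ^ k"
    by (metis fps_of_poly_prod fps_of_poly_diff fps_of_poly_monom)
  moreover have "fps_const (2 / 2 ^ k * r ^ k * (cos t - 1))
      = fps_const (2 / 2 ^ k * r ^ k * cos t) - fps_const (2 / 2 ^ k * r ^ k)"
    unfolding fps_const_sub right_diff_distrib by simp
  ultimately show ?thesis
    unfolding chebP_def lin by (simp only: left_diff_distrib) simp
qed

section \<open>Uniqueness of the Dunkl kernel\<close>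

lemma cinner_eq_inner: "cinner z w = inner z w"
  by (simp add: cinner_def inner_complex_def)

lemma norm_dih_refl [simp]: "cmod (dih_refl k j z) = cmod z"
  by (simp add: dih_refl_def norm_mult)

text \<open>The mirrors are finitely many lines, hence negligible. Density lets identities known off
  the mirrors be extended by continuity.\<close>

lemma dense_dih_regular: "closure {x. dih_regular k x} = UNIV"
proof -
  have eq: "{x. dih_regular k x} = - (\<Union>j\<in>{..<2*k}. {x. dih_root k j \<bullet> x = 0})"
    by (auto simp: dih_regular_def cinner_eq_inner)
  have "negligible (\<Union>j\<in>{..<2*k}. {x. dih_root k j \<bullet> x = 0})"
    by (rule negligible_Union) (auto simp: dih_root_def intro!: negligible_hyperplane)
  then have "interior (\<Union>j\<in>{..<2*k}. {x. dih_root k j \<bullet> x = 0}) = {}"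
    using negligible_subset open_interior interior_subset open_not_negligible by metis
  then show ?thesis unfolding eq closure_complement by simp
qed

text \<open>Weighting the directions 1 and \<open>\<i>\<close> with \<open>Re x\<close> and
  \<open>Im x\<close> turns the numerators \<open><root, direction>\<close> into
  \<open><root, x>\<close>, which cancels the denominators. The result makes sense on the mirrors
  too and extends to them by density; this is where the continuity of the partial derivatives
  enters.\<close>

lemma dunkl_kernel_radial:
  assumes "is_dunkl_kernel k \<alpha> \<beta> w f"
  shows "frechet_derivative f (at x) x + (\<Sum>j<2*k. dih_mult \<alpha> \<beta> j * (f x - f (dih_refl k j x)))
    = cinner x w * f x"
proof -
  define fd where "fd = (\<lambda>x. frechet_derivative f (at x))"
  have diff: "f differentiable (at x)" for x
    using assms unfolding is_dunkl_kernel_def by auto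
  have c1: "continuous_on UNIV (\<lambda>x. fd x 1)" and c2: "continuous_on UNIV (\<lambda>x. fd x \<i>)"
    using assms unfolding is_dunkl_kernel_def fd_def by auto
  have T: "dih_regular k x \<Longrightarrow> dunkl_op k \<alpha> \<beta> 1 f x = cinner 1 w * f x"
      "dih_regular k x \<Longrightarrow> dunkl_op k \<alpha> \<beta> \<i> f x = cinner \<i> w * f x" for x
    using assms unfolding is_dunkl_kernel_def fd_def by auto
  have lin: "fd x h = Re h * fd x 1 + Im h * fd x \<i>" for x h
  proof -
    have "linear (fd x)" unfolding fd_def by (rule linear_frechet_derivative[OF diff])
    then have "fd x (Re h *\<^sub>R 1 + Im h *\<^sub>R \<i>) = Re h * fd x 1 + Im h * fd x \<i>"
      by (simp add: linear_add linear_scale)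
    moreover have "Re h *\<^sub>R 1 + Im h *\<^sub>R \<i> = h" by (simp add: complex_eq_iff)
    ultimately show ?thesis by simp
  qed
  have cf: "continuous_on UNIV f"
    using diff by (intro continuous_at_imp_continuous_on ballI differentiable_imp_continuous_within)
  let ?l = "\<lambda>x. fd x x + (\<Sum>j<2*k. dih_mult \<alpha> \<beta> j * (f x - f (dih_refl k j x)))"
  let ?r = "\<lambda>x. cinner x w * f x"
  have reg: "?l x = ?r x" if "dih_regular k x" for x
  proof -
    have "?r x = Re x * (cinner 1 w * f x) + Im x * (cinner \<i> w * f x)"
      by (simp add: cinner_def algebra_simps)
    also have "\<dots> = Re x * dunkl_op k \<alpha> \<beta> 1 f x + Im x * dunkl_op k \<alpha> \<beta> \<i> f x"
      using T[OF that] by simp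
    also have "\<dots> = fd x x + (\<Sum>j<2*k. (Re x * cinner (dih_root k j) 1 + Im x * cinner (dih_root k j) \<i>)
       * dih_mult \<alpha> \<beta> j * (f x - f (dih_refl k j x)) / cinner (dih_root k j) x)"
    proof -
      let ?S = "\<lambda>\<xi>. \<Sum>j<2*k. dih_mult \<alpha> \<beta> j * cinner (dih_root k j) \<xi>
                  * (f x - f (dih_refl k j x)) / cinner (dih_root k j) x"
      have "Re x * ?S 1 + Im x * ?S \<i>
        = (\<Sum>j<2*k. (Re x * cinner (dih_root k j) 1 + Im x * cinner (dih_root k j) \<i>)
       * dih_mult \<alpha> \<beta> j * (f x - f (dih_refl k j x)) / cinner (dih_root k j) x)"
        unfolding sum_distrib_left sum.distrib[symmetric]
        by (intro sum.cong refl) (simp add: algebra_simps add_divide_distrib diff_divide_distrib)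
      then show ?thesis
        unfolding dunkl_op_def lin[of x x] by (simp add: fd_def algebra_simps)
    qed
    also have "(\<Sum>j<2*k. (Re x * cinner (dih_root k j) 1 + Im x * cinner (dih_root k j) \<i>)
       * dih_mult \<alpha> \<beta> j * (f x - f (dih_refl k j x)) / cinner (dih_root k j) x)
       = (\<Sum>j<2*k. dih_mult \<alpha> \<beta> j * (f x - f (dih_refl k j x)))"
    proof (intro sum.cong refl)
      fix j assume "j \<in> {..<2*k}"
      then have "cinner (dih_root k j) x \<noteq> 0" using that by (auto simp: dih_regular_def)
      moreover have "Re x * cinner (dih_root k j) 1 + Im x * cinner (dih_root k j) \<i> = cinner (dih_root k j) x"
        by (simp add: cinner_def algebra_simps)
      ultimately show "(Re x * cinner (dih_root k j) 1 + Im x * cinner (dih_root k j) \<i>)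
       * dih_mult \<alpha> \<beta> j * (f x - f (dih_refl k j x)) / cinner (dih_root k j) x
        = dih_mult \<alpha> \<beta> j * (f x - f (dih_refl k j x))" by simp
    qed
    finally show ?thesis by simp
  qed
  have cr: "continuous_on UNIV (\<lambda>x. f (dih_refl k j x))" for j
    unfolding dih_refl_def by (intro continuous_on_compose2[OF cf] continuous_intros) auto
  have "closed {x. ?l x = ?r x}"
    unfolding lin[of x x for x] cinner_def
    by (intro closed_Collect_eq continuous_intros c1 c2 cf cr)
  then have "closure {x. dih_regular k x} \<subseteq> {x. ?l x = ?r x}"
    using reg by (intro closure_minimal) auto
  then show ?thesis unfolding dense_dih_regular fd_def by auto
qed

text \<open>At a positive maximum of the damped function the reflected points have the same modulus
  and no larger value, so the reflection terms are nonnegative and the equation bounds the radial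
  derivative of \<open>d\<close> by \<open>|z| |w| d\<close>. As \<open>C > |w|\<close>, the damped
  function strictly increases towards the origin. Moving inwards stays in the ball, so a maximum on
  its boundary is covered as well.\<close>

lemma radial_solution_nonpos:
  fixes d :: "complex \<Rightarrow> real"
  assumes der: "\<And>x. (d has_derivative d' x) (at x)"
    and eq: "\<And>x. d' x x + (\<Sum>j\<in>A. \<kappa> j * (d x - d (s j x))) = cinner x w * d x"
    and \<kappa>: "\<And>j. j \<in> A \<Longrightarrow> \<kappa> j \<ge> 0" and s: "\<And>j x. cmod (s j x) = cmod x" and d0: "d 0 = 0"
  shows "d x \<le> 0"
proof (rule ccontr)
  assume "\<not> d x \<le> 0"
  define C where "C = cmod w + 1"
  define \<phi> where "\<phi> = (\<lambda>y. d y * exp (- (C * cmod y)))"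
  have "continuous_on UNIV d"
    using der by (intro continuous_at_imp_continuous_on ballI) (metis has_derivative_continuous)
  then have "continuous_on (cball 0 (cmod x)) \<phi>"
    unfolding \<phi>_def by (intro continuous_intros) (auto intro: continuous_on_subset)
  then obtain z where z: "z \<in> cball 0 (cmod x)" "\<And>y. y \<in> cball 0 (cmod x) \<Longrightarrow> \<phi> y \<le> \<phi> z"
    using continuous_attains_sup[of "cball 0 (cmod x)" \<phi>] by (metis compact_cball norm_ge_zero cball_eq_empty not_less)
  have "\<phi> x > 0" using \<open>\<not> d x \<le> 0\<close> by (simp add: \<phi>_def)
  moreover have "\<phi> x \<le> \<phi> z" by (intro z) auto
  ultimately have "\<phi> z > 0" by simp
  then have dz: "d z > 0" by (simp add: \<phi>_def zero_less_mult_iff)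
  then have z0: "z \<noteq> 0" using d0 by auto
  have "d (s j z) \<le> d z" for j
  proof -
    have "\<phi> (s j z) \<le> \<phi> z" using z s by (intro z) auto
    then show ?thesis by (simp add: \<phi>_def s)
  qed
  then have "(\<Sum>j\<in>A. \<kappa> j * (d z - d (s j z))) \<ge> 0" using \<kappa> by (intro sum_nonneg) auto
  moreover have "cinner z w * d z \<le> cmod z * cmod w * d z"
    unfolding cinner_eq_inner using dz norm_cauchy_schwarz[of z w] by (intro mult_right_mono) auto
  ultimately have "d' z z \<le> cmod z * cmod w * d z" using eq[of z] by linarith
  moreover have "cmod z * d z > 0" using z0 dz by simp
  ultimately have neg: "d' z z - C * cmod z * d z < 0" by (simp add: C_def algebra_simps)
  \<comment> \<open>\<open>\<phi>\<close> along the ray through \<open>z\<close>, with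
    \<open>|t z|\<close> replaced by \<open>t |z|\<close>, which is differentiable in
    \<open>t\<close>.\<close>
  define \<psi> where "\<psi> = (\<lambda>t. d (t *\<^sub>R z) * exp (- (C * cmod z * t)))"
  have "(d has_derivative d' z) (at (1 *\<^sub>R z))" using der by simp
  moreover have "((\<lambda>t. t *\<^sub>R z) has_derivative (\<lambda>t. t *\<^sub>R z)) (at (1::real))"
    by (auto intro!: derivative_eq_intros)
  ultimately have "((\<lambda>t. d (t *\<^sub>R z)) has_derivative (\<lambda>t. d' z (t *\<^sub>R z))) (at 1)"
    by (rule has_derivative_compose[rotated])
  moreover have "linear (d' z)" using der has_derivative_linear by blast
  ultimately have "((\<lambda>t. d (t *\<^sub>R z)) has_real_derivative d' z z) (at 1)"
    by (simp add: has_field_derivative_def linear_scale mult_commute_abs)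
  then have "(\<psi> has_real_derivative (d' z z - C * cmod z * d z) * exp (- (C * cmod z))) (at 1)"
    unfolding \<psi>_def by (auto intro!: derivative_eq_intros simp: algebra_simps)
  moreover have "(d' z z - C * cmod z * d z) * exp (- (C * cmod z)) < 0"
    using neg by (simp add: mult_less_0_iff)
  ultimately obtain \<delta> where \<delta>: "\<delta> > 0" "\<And>h. h > 0 \<Longrightarrow> h < \<delta> \<Longrightarrow> \<psi> 1 < \<psi> (1 - h)"
    using DERIV_neg_dec_left by blast
  define h where "h = min (\<delta> / 2) (1 / 2)"
  have h: "h > 0" "h < \<delta>" "h < 1" using \<delta>(1) by (auto simp: h_def min_def)
  have "cmod ((1 - h) *\<^sub>R z) = (1 - h) * cmod z" using h by simp
  then have "\<psi> (1 - h) = \<phi> ((1 - h) *\<^sub>R z)"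
    unfolding \<psi>_def \<phi>_def by (simp only: mult.assoc mult.commute[of "cmod z"])
  also have "\<dots> \<le> \<phi> z"
  proof (rule z)
    have "(1 - h) * cmod z \<le> cmod z" using h by (simp add: mult_left_le_one_le)
    then show "(1 - h) *\<^sub>R z \<in> cball 0 (cmod x)" using z(1) h by simp
  qed
  also have "\<dots> = \<psi> 1" by (simp add: \<phi>_def \<psi>_def)
  finally show False using \<delta>(2)[of h] h by simp
qed

lemma is_dunkl_kernel_unique:
  assumes "\<alpha> > 0" "\<beta> > 0" "is_dunkl_kernel k \<alpha> \<beta> w f" "is_dunkl_kernel k \<alpha> \<beta> w g"
  shows "f = g"
proof -
  have le: "f x - g x \<le> 0" if f: "is_dunkl_kernel k \<alpha> \<beta> w f" and g: "is_dunkl_kernel k \<alpha> \<beta> w g" for f g x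
  proof (rule radial_solution_nonpos[where s = "dih_refl k" and A = "{..<2*k}" and \<kappa> = "dih_mult \<alpha> \<beta>"
        and d' = "\<lambda>x h. frechet_derivative f (at x) h - frechet_derivative g (at x) h" and w = w])
    show "((\<lambda>x. f x - g x) has_derivative
        (\<lambda>h. frechet_derivative f (at x) h - frechet_derivative g (at x) h)) (at x)" for x
      using f g unfolding is_dunkl_kernel_def
      by (intro has_derivative_diff) (auto simp: frechet_derivative_works)
    show "(frechet_derivative f (at x) x - frechet_derivative g (at x) x) +
      (\<Sum>j<2*k. dih_mult \<alpha> \<beta> j * (f x - g x - (f (dih_refl k j x) - g (dih_refl k j x))))
        = cinner x w * (f x - g x)" for x
      using dunkl_kernel_radial[OF f, of x] dunkl_kernel_radial[OF g, of x]
      by (simp add: algebra_simps sum.distrib sum_subtractf)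
    show "f 0 - g 0 = 0" using f g by (simp add: is_dunkl_kernel_def)
  qed (use assms in \<open>auto simp: dih_mult_def\<close>)
  show ?thesis
  proof
    show "f x = g x" for x using le[OF assms(3,4), of x] le[OF assms(4,3), of x] by simp
  qed
qed

lemma dunkl_kernel_eqI:
  assumes "\<alpha> > 0" "\<beta> > 0" "is_dunkl_kernel k \<alpha> \<beta> w f"
  shows "dunkl_kernel k \<alpha> \<beta> z w = f z"
  unfolding dunkl_kernel_def using is_dunkl_kernel_unique[OF assms(1,2) _ assms(3)] assms(3)
  by (metis the_equality)

section \<open>Humbert series and geometric coefficient bounds\<close>

text \<open>This kind of bound is stable under the ring operations, and for \<open>c \<ge> 1\<close>
  division by \<open>(c)_n \<ge> n!\<close> turns it into uniform convergence on
  \<open>S\<close>.\<close>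

definition geo_bounded :: "'a set \<Rightarrow> ('a \<Rightarrow> real fps) \<Rightarrow> bool" where
  "geo_bounded S f \<longleftrightarrow> (\<exists>C R. C \<ge> 0 \<and> R \<ge> 0 \<and> (\<forall>x\<in>S. \<forall>n. \<bar>f x $ n\<bar> \<le> C * R ^ n))"

lemma geo_boundedI: "C \<ge> 0 \<Longrightarrow> R \<ge> 0 \<Longrightarrow> (\<And>x n. x \<in> S \<Longrightarrow> \<bar>f x $ n\<bar> \<le> C * R ^ n) \<Longrightarrow> geo_bounded S f"
  unfolding geo_bounded_def by blast

lemma geo_bounded_add:
  assumes "geo_bounded S f" "geo_bounded S g"
  shows "geo_bounded S (\<lambda>x. f x + g x)"
proof -
  obtain C R where f: "C \<ge> 0" "R \<ge> 0" "\<And>x n. x \<in> S \<Longrightarrow> \<bar>f x $ n\<bar> \<le> C * R ^ n"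
    using assms(1) unfolding geo_bounded_def by blast
  obtain C' R' where g: "C' \<ge> 0" "R' \<ge> 0" "\<And>x n. x \<in> S \<Longrightarrow> \<bar>g x $ n\<bar> \<le> C' * R' ^ n"
    using assms(2) unfolding geo_bounded_def by blast
  define M where "M = max R R'"
  show ?thesis
  proof (rule geo_boundedI[of "C + C'" M])
    fix x n assume x: "x \<in> S"
    have "\<bar>f x $ n\<bar> \<le> C * M ^ n" "\<bar>g x $ n\<bar> \<le> C' * M ^ n"
      using f g x unfolding M_def
      by (auto intro!: order.trans[OF f(3)] order.trans[OF g(3)] mult_left_mono power_mono)
    then show "\<bar>(f x + g x) $ n\<bar> \<le> (C + C') * M ^ n" by (simp add: algebra_simps)
  qed (use f g in \<open>auto simp: M_def\<close>)
qed

lemma geo_bounded_mult: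
  assumes "geo_bounded S f" "geo_bounded S g"
  shows "geo_bounded S (\<lambda>x. f x * g x)"
proof -
  obtain C R where f: "C \<ge> 0" "R \<ge> 0" "\<And>x n. x \<in> S \<Longrightarrow> \<bar>f x $ n\<bar> \<le> C * R ^ n"
    using assms(1) unfolding geo_bounded_def by blast
  obtain C' R' where g: "C' \<ge> 0" "R' \<ge> 0" "\<And>x n. x \<in> S \<Longrightarrow> \<bar>g x $ n\<bar> \<le> C' * R' ^ n"
    using assms(2) unfolding geo_bounded_def by blast
  define M where "M = max R R'"
  have M: "M \<ge> 0" using f by (simp add: M_def)
  show ?thesis
  proof (rule geo_boundedI[of "C * C'" "2 * M"])
    fix x n assume x: "x \<in> S"
    have fb: "\<bar>f x $ n\<bar> \<le> C * M ^ n" and gb: "\<bar>g x $ n\<bar> \<le> C' * M ^ n" for n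
      using f g x unfolding M_def
      by (auto intro!: order.trans[OF f(3)] order.trans[OF g(3)] mult_left_mono power_mono)
    have "\<bar>(f x * g x) $ n\<bar> \<le> (\<Sum>i=0..n. \<bar>f x $ i * g x $ (n - i)\<bar>)"
      unfolding fps_mult_nth by (rule sum_abs)
    also have "\<dots> \<le> (\<Sum>i=0..n. C * C' * M ^ n)"
    proof (rule sum_mono)
      fix i assume i: "i \<in> {0..n}"
      have "\<bar>f x $ i * g x $ (n - i)\<bar> \<le> (C * M ^ i) * (C' * M ^ (n - i))"
        unfolding abs_mult using f(1) M by (intro mult_mono fb gb) auto
      also have "\<dots> = C * C' * M ^ n" using i by (simp flip: power_add)
      finally show "\<bar>f x $ i * g x $ (n - i)\<bar> \<le> C * C' * M ^ n" .
    qed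
    also have "\<dots> = real (n + 1) * (C * C' * M ^ n)" by simp
    \<comment> \<open>The \<open>n + 1\<close> terms of the convolution are absorbed by doubling the
      radius.\<close>
    also have "\<dots> \<le> 2 ^ n * (C * C' * M ^ n)"
    proof -
      have "n + 1 \<le> 2 ^ n" by (induction n) auto
      then have "real (n + 1) \<le> 2 ^ n" using of_nat_le_iff[of "n + 1" "2 ^ n", where ?'a = real] by simp
      then show ?thesis using f(1) g(1) M by (intro mult_right_mono) auto
    qed
    finally show "\<bar>(f x * g x) $ n\<bar> \<le> C * C' * (2 * M) ^ n" by (simp add: power_mult_distrib algebra_simps)
  qed (use f g M in auto)
qed

lemma geo_bounded_fps_const:
  assumes "\<And>x. x \<in> S \<Longrightarrow> \<bar>f x\<bar> \<le> B"
  shows "geo_bounded S (\<lambda>x. fps_const (f x))"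
  by (rule geo_boundedI[of "\<bar>B\<bar>" 1]) (use assms in \<open>force+\<close>)

lemma geo_bounded_const_real: "geo_bounded S (\<lambda>x. fps_const c)"
  by (rule geo_bounded_fps_const) auto

lemma geo_bounded_1: "geo_bounded S (\<lambda>x. 1)"
  using geo_bounded_const_real[of S 1] by simp

lemma geo_bounded_X: "geo_bounded S (\<lambda>x. fps_X)"
  by (rule geo_boundedI[of 1 1]) (auto simp: fps_X_def)

lemma geo_bounded_diff:
  assumes "geo_bounded S f" "geo_bounded S g"
  shows "geo_bounded S (\<lambda>x. f x - g x)"
proof -
  have "geo_bounded S (\<lambda>x. f x + fps_const (- 1) * g x)"
    using assms by (intro geo_bounded_add geo_bounded_mult geo_bounded_const_real)
  moreover have "f x + fps_const (- 1) * g x = f x - g x" for x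
    by (simp flip: fps_const_neg)
  ultimately show ?thesis by simp
qed

lemma geo_bounded_uminus: "geo_bounded S f \<Longrightarrow> geo_bounded S (\<lambda>x. - f x)"
  unfolding geo_bounded_def by simp

lemma geo_bounded_prod:
  "(\<And>i. i \<in> A \<Longrightarrow> geo_bounded S (f i)) \<Longrightarrow> geo_bounded S (\<lambda>x. \<Prod>i\<in>A. f i x)"
  by (induction A rule: infinite_finite_induct) (auto intro: geo_bounded_mult geo_bounded_1)

lemma geo_bounded_sum:
  "(\<And>i. i \<in> A \<Longrightarrow> geo_bounded S (f i)) \<Longrightarrow> geo_bounded S (\<lambda>x. \<Sum>i\<in>A. f i x)"
  using geo_bounded_const_real[of S 0]
  by (induction A rule: infinite_finite_induct) (auto intro: geo_bounded_add)

lemma geo_bounded_power: "geo_bounded S f \<Longrightarrow> geo_bounded S (\<lambda>x. f x ^ m)"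
  by (induction m) (auto intro: geo_bounded_mult geo_bounded_1)

lemmas geo_bounded_intros = geo_bounded_add geo_bounded_mult geo_bounded_diff geo_bounded_uminus
  geo_bounded_const_real geo_bounded_1 geo_bounded_X geo_bounded_prod geo_bounded_sum geo_bounded_power

lemma pochhammer_le_fact:
  assumes "(b::real) > 0"
  shows "pochhammer b n \<le> max 1 b ^ n * fact n"
proof (induction n)
  case (Suc n)
  have "b + real n \<le> max 1 b * (1 + real n)"
  proof (cases "b \<le> 1")
    case False
    then have "1 * real n \<le> b * real n" by (intro mult_right_mono) auto
    then show ?thesis using False by (simp add: max_def algebra_simps)
  qed (auto simp: max_def)
  then have "pochhammer b n * (b + real n) \<le> (max 1 b ^ n * fact n) * (max 1 b * (1 + real n))"
    using Suc assms by (intro mult_mono) (auto simp: pochhammer_nonneg)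
  then show ?case by (simp add: pochhammer_Suc algebra_simps)
qed auto

lemma geo_bounded_fpow_lin:
  assumes "b > 0" "\<And>x. x \<in> S \<Longrightarrow> \<bar>a x\<bar> \<le> B"
  shows "geo_bounded S (\<lambda>x. fpow (- b) (lin (a x)))"
proof (rule geo_boundedI[of 1 "max 1 b * \<bar>B\<bar>"])
  fix x n assume x: "x \<in> S"
  have "\<bar>fpow (- b) (lin (a x)) $ n\<bar> = pochhammer b n / fact n * \<bar>a x\<bar> ^ n"
    using assms(1) by (simp add: fpow_lin_nth abs_mult power_abs pochhammer_nonneg)
  also have "\<dots> \<le> max 1 b ^ n * \<bar>B\<bar> ^ n"
    using assms(2)[OF x] pochhammer_le_fact[OF assms(1), of n]
    by (intro mult_mono power_mono) (auto simp: divide_le_eq)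
  finally show "\<bar>fpow (- b) (lin (a x)) $ n\<bar> \<le> 1 * (max 1 b * \<bar>B\<bar>) ^ n" by (simp add: power_mult_distrib)
qed (use assms in auto)

lemma pochhammer_ge_fact:
  assumes "(c::real) \<ge> 1"
  shows "pochhammer c n \<ge> fact n"
proof (induction n)
  case (Suc n)
  have "fact n * (1 + real n) \<le> pochhammer c n * (c + real n)"
    using Suc assms by (intro mult_mono) (auto simp: pochhammer_nonneg)
  then show ?case by (simp add: pochhammer_Suc algebra_simps)
qed auto

lemma pochhammer_summable_majorant:
  assumes "(c::real) \<ge> 1"
  shows "summable (\<lambda>n. C * R ^ n / pochhammer c n)"
proof (rule summable_comparison_test')
  show "summable (\<lambda>n. \<bar>C\<bar> * (inverse (fact n) * \<bar>R\<bar> ^ n))"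
    by (intro summable_mult summable_exp)
  fix n
  have "\<bar>C * R ^ n / pochhammer c n\<bar> = \<bar>C\<bar> * \<bar>R\<bar> ^ n / pochhammer c n"
    using assms by (simp add: abs_mult power_abs pochhammer_nonneg)
  also have "\<dots> \<le> \<bar>C\<bar> * \<bar>R\<bar> ^ n / fact n"
    using pochhammer_ge_fact[OF assms, of n] pochhammer_pos[of c n] assms
    by (intro divide_left_mono mult_nonneg_nonneg mult_pos_pos) auto
  finally show "norm (C * R ^ n / pochhammer c n) \<le> \<bar>C\<bar> * (inverse (fact n) * \<bar>R\<bar> ^ n)"
    by (simp add: field_simps)
qed

lemma geo_bounded_summable:
  assumes "geo_bounded S f" "x \<in> S" "(c::real) \<ge> 1"
  shows "summable (\<lambda>n. \<bar>f x $ n\<bar> / pochhammer c n)"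
proof -
  obtain C R where f: "C \<ge> 0" "R \<ge> 0" "\<And>x n. x \<in> S \<Longrightarrow> \<bar>f x $ n\<bar> \<le> C * R ^ n"
    using assms(1) unfolding geo_bounded_def by blast
  show ?thesis
  proof (rule summable_comparison_test'[OF pochhammer_summable_majorant[OF assms(3), of C R]])
    show "norm (\<bar>f x $ n\<bar> / pochhammer c n) \<le> C * R ^ n / pochhammer c n" for n
      using f(3)[OF assms(2)] assms(3) by (auto simp: pochhammer_nonneg intro!: divide_right_mono)
  qed
qed

section \<open>Regrouping a multiple series by total degree\<close>

definition multi :: "nat \<Rightarrow> nat \<Rightarrow> (nat \<Rightarrow> nat) set" where
  "multi m n = {js. (\<forall>i\<ge>m. js i = 0) \<and> (\<Sum>i<m. js i) = n}"

lemma finite_multi: "finite (multi m n)"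
proof (rule finite_subset)
  show "multi m n \<subseteq> (\<lambda>f i. if i < m then f i else 0) ` (PiE {..<m} (\<lambda>_. {..n}))"
  proof
    fix js assume js: "js \<in> multi m n"
    have "js i \<le> n" if "i < m" for i
      using js that member_le_sum[of i "{..<m}" js] by (auto simp: multi_def)
    then show "js \<in> (\<lambda>f i. if i < m then f i else 0) ` (PiE {..<m} (\<lambda>_. {..n}))"
      using js by (intro image_eqI[of _ _ "restrict js {..<m}"]) (auto simp: multi_def fun_eq_iff)
  qed
qed (auto intro: finite_PiE)

lemma fps_prod_nth_multi:
  fixes f :: "nat \<Rightarrow> real fps"
  shows "(\<Prod>i<m. f i) $ n = (\<Sum>js\<in>multi m n. \<Prod>i<m. f i $ js i)"
proof (induction m arbitrary: n)
  case 0
  have "multi 0 n = (if n = 0 then {\<lambda>_. 0} else {})" by (auto simp: multi_def)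
  then show ?case by simp
next
  case (Suc m)
  have "(\<Sum>js\<in>multi (Suc m) n. \<Prod>i<Suc m. f i $ js i)
     = (\<Sum>(l, js)\<in>Sigma {0..n} (\<lambda>l. multi m l). (\<Prod>i<m. f i $ js i) * f m $ (n - l))"
  proof (rule sum.reindex_bij_witness[where j = "\<lambda>js. (n - js m, js(m := 0))"
        and i = "\<lambda>(l, js). js(m := n - l)"])
    fix a assume a: "a \<in> multi (Suc m) n"
    show "(case (n - a m, a(m := 0)) of (l, js) \<Rightarrow> js(m := n - l)) = a"
      using a by (auto simp: multi_def fun_eq_iff)
    show "(n - a m, a(m := 0)) \<in> Sigma {0..n} (\<lambda>l. multi m l)"
      using a by (auto simp: multi_def)
    show "(case (n - a m, a(m := 0)) of (l, js) \<Rightarrow> (\<Prod>i<m. f i $ js i) * f m $ (n - l)) = (\<Prod>i<Suc m. f i $ a i)"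
      using a by (auto simp: multi_def)
  next
    fix b assume b: "b \<in> Sigma {0..n} (\<lambda>l. multi m l)"
    then obtain l js where [simp]: "b = (l, js)" and l: "l \<le> n" "js \<in> multi m l" by auto
    have "js m = 0" using l by (auto simp: multi_def)
    then show "(n - (case b of (l, js) \<Rightarrow> js(m := n - l)) m, (case b of (l, js) \<Rightarrow> js(m := n - l))(m := 0)) = b"
      using l by (auto simp: fun_eq_iff)
    show "(case b of (l, js) \<Rightarrow> js(m := n - l)) \<in> multi (Suc m) n"
      using l by (auto simp: multi_def)
  qed
  also have "\<dots> = (\<Sum>l=0..n. (\<Prod>i<m. f i) $ l * f m $ (n - l))"
    by (subst sum.Sigma[symmetric]) (auto simp: finite_multi Suc sum_distrib_right)
  finally show ?case by (simp add: fps_mult_nth)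
qed

text \<open>The index set of \<open>humbert2\<close> is partitioned by total degree, and each slice
  sums to one coefficient of the product. The regrouping needs absolute summability: taking absolute
  values of the terms amounts to replacing every \<open>x i\<close> by its absolute value, and the
  product so obtained is geometrically bounded.\<close>

lemma humbert2_sums:
  assumes "(c::real) \<ge> 1" "\<And>i. i < m \<Longrightarrow> b i > 0"
  shows "(\<lambda>n. (\<Prod>i<m. fpow (- b i) (lin (x i))) $ n / pochhammer c n) sums humbert2 m b c x"
proof -
  define T where "T = (\<lambda>x js. (\<Prod>i<m. pochhammer (b i) (js i) * x i ^ js i / fact (js i))
        / pochhammer c (\<Sum>i<m. js i))"
  have sumT: "(\<Sum>js\<in>multi m n. T x js) = (\<Prod>i<m. fpow (- b i) (lin (x i))) $ n / pochhammer c n" for x n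
    unfolding fps_prod_nth_multi fpow_lin_nth sum_divide_distrib
    by (intro sum.cong refl) (auto simp: T_def multi_def)
  have normT: "norm (T x js) = T (\<lambda>i. \<bar>x i\<bar>) js" for js
    using assms by (auto simp: T_def abs_mult prod_dividef power_abs abs_prod pochhammer_nonneg less_imp_le
        intro!: arg_cong2[where f = "(/)"] prod.cong)
  have bij: "bij_betw snd (Sigma (UNIV::nat set) (multi m)) {js. \<forall>i\<ge>m. js i = 0}"
    by (rule bij_betwI[where g = "\<lambda>js. (\<Sum>i<m. js i, js)"]) (auto simp: multi_def)
  have "geo_bounded UNIV (\<lambda>_::unit. \<Prod>i<m. fpow (- b i) (lin \<bar>x i\<bar>))"
    using assms by (intro geo_bounded_prod geo_bounded_fpow_lin) auto
  from geo_bounded_summable[OF this, of "()" c] assms(1)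
  have sm: "summable (\<lambda>n. \<bar>(\<Prod>i<m. fpow (- b i) (lin \<bar>x i\<bar>)) $ n\<bar> / pochhammer c n)" by simp
  have "(\<lambda>p. norm (T x (snd p))) summable_on Sigma UNIV (multi m)"
    unfolding Infinite_Sum.abs_summable_on_Sigma_iff
  proof (intro conjI ballI)
    show "(\<lambda>y. norm (T x (snd (n, y)))) summable_on multi m n" for n
      by (simp add: finite_multi)
    have "infsum (\<lambda>y. norm (T x (snd (n, y)))) (multi m n)
       = (\<Prod>i<m. fpow (- b i) (lin \<bar>x i\<bar>)) $ n / pochhammer c n" for n
      by (simp add: finite_multi normT[unfolded real_norm_def] sumT)
    then show "(\<lambda>n. norm (infsum (\<lambda>y. norm (T x (snd (n, y)))) (multi m n))) summable_on UNIV"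
      using sm assms(1) by (auto intro!: norm_summable_imp_summable_on simp: pochhammer_nonneg)
  qed
  then have s: "(\<lambda>p. T x (snd p)) summable_on Sigma UNIV (multi m)" by (rule Infinite_Sum.abs_summable_summable)
  then have s': "(\<lambda>(n, js). T x js) summable_on Sigma UNIV (multi m)" by (simp add: case_prod_unfold)
  have "humbert2 m b c x = infsum (T x) {js. \<forall>i\<ge>m. js i = 0}"
    by (simp add: humbert2_def T_def)
  also have "\<dots> = infsum (\<lambda>p. T x (snd p)) (Sigma UNIV (multi m))"
    by (rule infsum_reindex_bij_betw[OF bij, symmetric])
  also have "\<dots> = (\<Sum>\<^sub>\<infinity>n. \<Sum>\<^sub>\<infinity>js\<in>multi m n. T x js)"
    using infsum_Sigma'_banach[OF s'] by (simp add: case_prod_unfold)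
  also have "\<dots> = (\<Sum>\<^sub>\<infinity>n. (\<Prod>i<m. fpow (- b i) (lin (x i))) $ n / pochhammer c n)"
    by (simp add: finite_multi sumT)
  finally have eq: "humbert2 m b c x = \<dots>" .
  have "(\<lambda>n. \<Sum>\<^sub>\<infinity>js\<in>multi m n. T x js) summable_on UNIV"
    by (rule summable_on_Sigma_banach[OF s'])
  then have "(\<lambda>n. (\<Prod>i<m. fpow (- b i) (lin (x i))) $ n / pochhammer c n) summable_on UNIV"
    by (simp add: finite_multi sumT)
  then show ?thesis unfolding eq by (intro has_sum_imp_sums has_sum_infsum)
qed

section \<open>Dirichlet integrals over the simplex\<close>

lemma simplexT_measurable [measurable]: "simplexT k \<in> sets (PiM {..<k} (\<lambda>_. lborel))"
proof -
  have "simplexT k = {t \<in> space (PiM {..<k} (\<lambda>_. lborel :: real measure)). (\<forall>j<k. t j > 0) \<and> (\<Sum>j<k. t j) < 1}"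
    by (auto simp: simplexT_def space_PiM)
  also have "\<dots> = {t \<in> space (PiM {..<k} (\<lambda>_. lborel :: real measure)). (\<forall>j\<in>{..<k}. t j > 0) \<and> (\<Sum>j<k. t j) < 1}"
    by auto
  also have "\<dots> \<in> sets (PiM {..<k} (\<lambda>_. lborel))" by measurable
  finally show ?thesis .
qed

lemma nn_integral_Beta_unit:
  assumes "a > 0" "c > (0::real)"
  shows "(\<integral>\<^sup>+y. ennreal (indicator {0<..<1} y * (y powr (a - 1) * (1 - y) powr (c - 1))) \<partial>lborel) = ennreal (Beta a c)"
proof -
  let ?f = "\<lambda>t. t powr (a - 1) * (1 - t) powr (c - 1)"
  have "(\<integral>\<^sup>+y. ennreal (indicator {0<..<1} y * ?f y) \<partial>lborel) = (\<integral>\<^sup>+y. ennreal (indicator {0..1} y *\<^sub>R ?f y) \<partial>lborel)"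
    by (intro nn_integral_cong) (auto simp: indicator_def)
  also have "\<dots> = ennreal (\<integral>y. indicator {0..1} y *\<^sub>R ?f y \<partial>lborel)"
    using integrable_Beta[OF assms] unfolding set_integrable_def
    by (intro nn_integral_eq_integral) auto
  also have "(\<integral>y. indicator {0..1} y *\<^sub>R ?f y \<partial>lborel) = Beta a c"
    using set_borel_integral_eq_integral(2)[OF integrable_Beta[OF assms]]
      integral_unique[OF has_integral_Beta_real[OF assms]]
    unfolding set_lebesgue_integral_def by simp
  finally show ?thesis .
qed

lemma nn_integral_Beta_scaled:
  assumes "a > 0" "c > (0::real)" "r > 0"
  shows "(\<integral>\<^sup>+y. ennreal (indicator {0<..<r} y * (y powr (a - 1) * (r - y) powr (c - 1))) \<partial>lborel)
     = ennreal (r powr (a + c - 1) * Beta a c)"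
proof -
  have "(\<integral>\<^sup>+y. ennreal (indicator {0<..<r} y * (y powr (a - 1) * (r - y) powr (c - 1))) \<partial>lborel)
     = ennreal \<bar>r\<bar> * (\<integral>\<^sup>+y. ennreal (indicator {0<..<r} (0 + r * y) * ((0 + r * y) powr (a - 1) * (r - (0 + r * y)) powr (c - 1))) \<partial>lborel)"
    using assms by (intro nn_integral_real_affine) auto
  also have "(\<integral>\<^sup>+y. ennreal (indicator {0<..<r} (0 + r * y) * ((0 + r * y) powr (a - 1) * (r - (0 + r * y)) powr (c - 1))) \<partial>lborel)
     = (\<integral>\<^sup>+y. ennreal (r powr (a + c - 2)) * ennreal (indicator {0<..<1} y * (y powr (a - 1) * (1 - y) powr (c - 1))) \<partial>lborel)"
  proof (intro nn_integral_cong)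
    fix y
    have "indicator {0<..<r} (0 + r * y) = (indicator {0<..<1} y :: real)"
      using assms by (auto simp: indicator_def zero_less_mult_iff)
    moreover have "(r * y) powr (a - 1) * (r - r * y) powr (c - 1)
        = r powr (a + c - 2) * (y powr (a - 1) * (1 - y) powr (c - 1))" if "0 < y" "y < 1"
    proof -
      have "(r - r * y) powr (c - 1) = r powr (c - 1) * (1 - y) powr (c - 1)"
        using that assms powr_mult[of r "1 - y" "c - 1"] by (simp add: algebra_simps)
      moreover have "(r * y) powr (a - 1) = r powr (a - 1) * y powr (a - 1)"
        using that assms by (simp add: powr_mult)
      moreover have "r powr (a + c - 2) = r powr (a - 1) * r powr (c - 1)"
        unfolding powr_add[symmetric] by (simp add: algebra_simps)
      ultimately show ?thesis by simp
    qed
    ultimately show "ennreal (indicator {0<..<r} (0 + r * y) * ((0 + r * y) powr (a - 1) * (r - (0 + r * y)) powr (c - 1)))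
      = ennreal (r powr (a + c - 2)) * ennreal (indicator {0<..<1} y * (y powr (a - 1) * (1 - y) powr (c - 1)))"
      by (auto simp: indicator_def ennreal_mult[symmetric])
  qed
  also have "\<dots> = ennreal (r powr (a + c - 2)) * ennreal (Beta a c)"
    by (subst nn_integral_cmult) (auto simp: nn_integral_Beta_unit[OF assms(1,2)])
  also have "ennreal \<bar>r\<bar> * (ennreal (r powr (a + c - 2)) * ennreal (Beta a c))
      = ennreal (r powr (a + c - 1) * Beta a c)"
  proof -
    have "\<bar>r\<bar> * r powr (a + c - 2) = r powr (a + c - 1)"
      using assms powr_add[of r 1 "a + c - 2"] by simp
    then show ?thesis by (simp add: ennreal_mult'[symmetric] mult.assoc[symmetric])
  qed
  finally show ?thesis .
qed

definition dirichlet_dens :: "nat \<Rightarrow> (nat \<Rightarrow> real) \<Rightarrow> real \<Rightarrow> (nat \<Rightarrow> real) \<Rightarrow> real" where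
  "dirichlet_dens k b c t =
     indicator (simplexT k) t * ((\<Prod>j<k. t j powr (b j - 1)) * (1 - (\<Sum>j<k. t j)) powr (c - 1))"

lemma dirichlet_dens_measurable [measurable]:
  "dirichlet_dens k b c \<in> borel_measurable (PiM {..<k} (\<lambda>_. lborel))"
  unfolding dirichlet_dens_def by measurable

lemma dirichlet_dens_nonneg: "dirichlet_dens k b c t \<ge> 0"
  unfolding dirichlet_dens_def by (intro mult_nonneg_nonneg prod_nonneg) auto

lemma dirichlet_dens_Suc:
  assumes "x \<in> extensional {..<k}"
  shows "dirichlet_dens (Suc k) b c (x(k := y))
    = indicator (simplexT k) x * (\<Prod>j<k. x j powr (b j - 1))
      * (indicator {0<..<1 - (\<Sum>j<k. x j)} y * (y powr (b k - 1) * (1 - (\<Sum>j<k. x j) - y) powr (c - 1)))"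
proof -
  have "x(k := y) \<in> simplexT (Suc k) \<longleftrightarrow> x \<in> simplexT k \<and> y \<in> {0<..<1 - (\<Sum>j<k. x j)}"
    using assms by (auto simp: simplexT_def PiE_def extensional_def less_Suc_eq)
  then show ?thesis
    unfolding dirichlet_dens_def indicator_def by (auto simp: algebra_simps)
qed

text \<open>Integrating out the last coordinate yields a Beta value and leaves the density in one
  coordinate less with last parameter \<open>b k + c\<close>; hence the induction is for arbitrary
  \<open>c\<close>. The nonnegative integral gives integrability together with the value.\<close>

theorem nn_integral_dirichlet:
  assumes "\<And>j. j < k \<Longrightarrow> b j > 0" "c > 0"
  shows "(\<integral>\<^sup>+t. ennreal (dirichlet_dens k b c t) \<partial>PiM {..<k} (\<lambda>_. lborel))
    = ennreal ((\<Prod>j<k. Gamma (b j)) * Gamma c / Gamma ((\<Sum>j<k. b j) + c))"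
  using assms
proof (induction k arbitrary: c)
  case 0
  \<comment> \<open>For \<open>k = 0\<close> the product measure is the point mass at
    \<open>\<lambda>_. undefined\<close>, where the density is 1; the claimed value is
    \<open>Gamma c / Gamma c\<close>.\<close>
  have "Gamma c > 0" using 0 by simp
  then have "Gamma c \<noteq> 0" by linarith
  moreover have "(\<lambda>_. undefined) \<in> simplexT 0" by (simp add: simplexT_def)
  ultimately show ?case by (simp add: PiM_empty nn_integral_count_space_finite dirichlet_dens_def)
next
  case (Suc k)
  interpret product_sigma_finite "\<lambda>_::nat. lborel :: real measure" by standard
  let ?M = "PiM {..<k} (\<lambda>_. lborel :: real measure)"
  have "(\<integral>\<^sup>+t. ennreal (dirichlet_dens (Suc k) b c t) \<partial>PiM {..<Suc k} (\<lambda>_. lborel))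
    = (\<integral>\<^sup>+x. (\<integral>\<^sup>+y. ennreal (dirichlet_dens (Suc k) b c (x(k := y))) \<partial>lborel) \<partial>?M)"
    unfolding lessThan_Suc
    by (rule product_nn_integral_insert) (auto simp flip: lessThan_Suc)
  also have "\<dots> = (\<integral>\<^sup>+x. ennreal (Beta (b k) c) * ennreal (dirichlet_dens k b (b k + c) x) \<partial>?M)"
  proof (intro nn_integral_cong)
    fix x assume "x \<in> space ?M"
    then have ext: "x \<in> extensional {..<k}" by (auto simp: space_PiM PiE_def)
    let ?s = "\<Sum>j<k. x j" and ?p = "indicator (simplexT k) x * (\<Prod>j<k. x j powr (b j - 1))"
    have p: "?p \<ge> 0" by (intro mult_nonneg_nonneg prod_nonneg) auto
    have "(\<integral>\<^sup>+y. ennreal (dirichlet_dens (Suc k) b c (x(k := y))) \<partial>lborel)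
      = ennreal ?p * (\<integral>\<^sup>+y. ennreal (indicator {0<..<1 - ?s} y * (y powr (b k - 1) * (1 - ?s - y) powr (c - 1))) \<partial>lborel)"
      unfolding dirichlet_dens_Suc[OF ext]
      by (subst nn_integral_cmult[symmetric]) (auto simp: ennreal_mult'[OF p])
    also have "\<dots> = ennreal (Beta (b k) c) * ennreal (dirichlet_dens k b (b k + c) x)"
    proof (cases "x \<in> simplexT k")
      case True
      then have "1 - ?s > 0" by (simp add: simplexT_def)
      have "Gamma (b k) > 0" "Gamma c > 0" "Gamma (b k + c) > 0" using Suc.prems by (auto simp: add_pos_pos)
      then have B: "Beta (b k) c \<ge> 0" by (simp add: Beta_def)
      have "ennreal ?p * ennreal ((1 - ?s) powr (b k + c - 1) * Beta (b k) c)
        = ennreal (Beta (b k) c) * ennreal (dirichlet_dens k b (b k + c) x)"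
        unfolding ennreal_mult'[OF p, symmetric] ennreal_mult'[OF B, symmetric]
        by (simp add: dirichlet_dens_def mult_ac)
      then show ?thesis using Suc.prems \<open>1 - ?s > 0\<close>
        by (subst nn_integral_Beta_scaled) auto
    qed (simp add: dirichlet_dens_def)
    finally show "(\<integral>\<^sup>+y. ennreal (dirichlet_dens (Suc k) b c (x(k := y))) \<partial>lborel)
       = ennreal (Beta (b k) c) * ennreal (dirichlet_dens k b (b k + c) x)" .
  qed
  also have "\<dots> = ennreal (Beta (b k) c) *
      ennreal ((\<Prod>j<k. Gamma (b j)) * Gamma (b k + c) / Gamma ((\<Sum>j<k. b j) + (b k + c)))"
    using Suc.prems by (subst nn_integral_cmult) (auto simp: Suc.IH add_pos_pos)
  also have "\<dots> = ennreal ((\<Prod>j<Suc k. Gamma (b j)) * Gamma c / Gamma ((\<Sum>j<Suc k. b j) + c))"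
  proof -
    have pos: "Gamma (b k) > 0" "Gamma c > 0" "Gamma (b k + c) > 0" using Suc.prems by (auto simp: add_pos_pos)
    then have "Beta (b k) c \<ge> 0" by (simp add: Beta_def)
    then show ?thesis using pos by (simp add: ennreal_mult'[symmetric] Beta_def algebra_simps)
  qed
  finally show ?case .
qed

corollary
  assumes "\<And>j. j < k \<Longrightarrow> b j > 0" "c > 0"
  shows integrable_dirichlet: "integrable (PiM {..<k} (\<lambda>_. lborel)) (dirichlet_dens k b c)"
    and integral_dirichlet: "(\<integral>t. dirichlet_dens k b c t \<partial>PiM {..<k} (\<lambda>_. lborel))
      = (\<Prod>j<k. Gamma (b j)) * Gamma c / Gamma ((\<Sum>j<k. b j) + c)"
proof -
  let ?v = "(\<Prod>j<k. Gamma (b j)) * Gamma c / Gamma ((\<Sum>j<k. b j) + c)"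
  have "(\<Sum>j<k. b j) + c > 0" using assms by (intro add_nonneg_pos sum_nonneg) (auto intro: less_imp_le)
  then have "?v \<ge> 0" using assms
    by (intro divide_nonneg_nonneg mult_nonneg_nonneg prod_nonneg) (auto intro!: less_imp_le Gamma_real_pos)
  then have "has_bochner_integral (PiM {..<k} (\<lambda>_. lborel)) (dirichlet_dens k b c) ?v"
    using nn_integral_dirichlet[OF assms] 
    by (intro has_bochner_integral_nn_integral) (auto simp: dirichlet_dens_nonneg)
  then show "integrable (PiM {..<k} (\<lambda>_. lborel)) (dirichlet_dens k b c)"
     "(\<integral>t. dirichlet_dens k b c t \<partial>PiM {..<k} (\<lambda>_. lborel)) = ?v"
    by (auto simp: has_bochner_integral_iff)
qed

section \<open>The simplex representation of the Humbert function\<close>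

lemma exp_sum_multi:
  fixes y :: "nat \<Rightarrow> real"
  shows "(\<Sum>i<m. y i) ^ n / fact n = (\<Sum>js\<in>multi m n. \<Prod>i<m. y i ^ js i / fact (js i))"
proof -
  have "fps_exp (\<Sum>i<m. y i) = (\<Prod>i<m. fps_exp (y i))"
    by (induction m) (auto simp: fps_exp_add_mult)
  then have "fps_exp (\<Sum>i<m. y i) $ n = (\<Sum>js\<in>multi m n. \<Prod>i<m. fps_exp (y i) $ js i)"
    using fps_prod_nth_multi by metis
  then show ?thesis by simp
qed

text \<open>Barycentric coordinates; every index from \<open>m\<close> on stands for the last one.\<close>
definition bary :: "nat \<Rightarrow> (nat \<Rightarrow> real) \<Rightarrow> nat \<Rightarrow> real" where
  "bary m t i = (if i < m then t i else 1 - (\<Sum>j<m. t j))"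

text \<open>A monomial in the barycentric coordinates only raises the exponents, so every moment of
  the density is again a Dirichlet integral.\<close>

lemma dirichlet_dens_mult_bary:
  "dirichlet_dens m b (b m) t * (\<Prod>i<Suc m. bary m t i ^ js i)
    = dirichlet_dens m (\<lambda>i. b i + real (js i)) (b m + real (js m)) t"
proof (cases "t \<in> simplexT m")
  case True
  then have pos: "t j > 0" if "j < m" for j using that by (auto simp: simplexT_def)
  have pos': "1 - (\<Sum>j<m. t j) > 0" using True by (auto simp: simplexT_def)
  have pw: "x powr (a - 1) * x ^ n = x powr (a + real n - 1)" if "x > 0" for x a n
    using that powr_add[of x "a - 1" "real n"] by (simp add: powr_realpow algebra_simps)
  have "(\<Prod>j<m. t j powr (b j - 1)) * (\<Prod>j<m. t j ^ js j) = (\<Prod>j<m. t j powr (b j + real (js j) - 1))"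
    unfolding prod.distrib[symmetric] using pw pos by (intro prod.cong) auto
  moreover have "(\<Prod>i<m. bary m t i ^ js i) = (\<Prod>j<m. t j ^ js j)"
    by (intro prod.cong) (auto simp: bary_def)
  ultimately show ?thesis
    using pw[OF pos', of "b m" "js m"] True by (simp add: dirichlet_dens_def bary_def algebra_simps)
qed (simp add: dirichlet_dens_def)

theorem humbert2_simplex:
  assumes "\<And>i. i \<le> m \<Longrightarrow> b i > 0" "(\<Sum>i\<le>m. b i) \<ge> 1"
  shows "(\<integral>t. dirichlet_dens m b (b m) t * exp (\<Sum>i\<le>m. x i * bary m t i) \<partial>PiM {..<m} (\<lambda>_. lborel))
    = (\<Prod>i\<le>m. Gamma (b i)) / Gamma (\<Sum>i\<le>m. b i) * humbert2 (m + 1) b (\<Sum>i\<le>m. b i) x"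
    (is "?I = ?G * _")
proof -
  let ?M = "PiM {..<m} (\<lambda>_. lborel :: real measure)"
  define B where "B = (\<Sum>i\<le>m. b i)"
  define S where "S = (\<lambda>t. \<Sum>i\<le>m. x i * bary m t i)"
  \<comment> \<open>Barycentric coordinates lie in \<open>[0, 1]\<close>, so \<open>K\<close> bounds
    \<open>S\<close> on the simplex; the majorant \<open>K^n / n!\<close> then justifies integrating
    the exponential series termwise.\<close>
  define K where "K = (\<Sum>i\<le>m. \<bar>x i\<bar>)"
  define f where "f = (\<lambda>n t. dirichlet_dens m b (b m) t * (S t ^ n / fact n))"
  have Smeas [measurable]: "S \<in> borel_measurable ?M"
  proof -
    have "(\<lambda>t. bary m t i) \<in> borel_measurable ?M" for i
      unfolding bary_def by (cases "i < m") (auto, measurable)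
    then show ?thesis unfolding S_def by measurable
  qed
  have int0: "integrable ?M (dirichlet_dens m b (b m))"
    using assms by (intro integrable_dirichlet) auto
  have Sb: "\<bar>S t\<bar> \<le> K" if "t \<in> simplexT m" for t
  proof -
    have t: "t j > 0" "t j \<le> 1" if "j < m" for j
    proof -
      show "t j > 0" using \<open>t \<in> simplexT m\<close> that by (auto simp: simplexT_def)
      have "t j \<le> (\<Sum>j<m. t j)" using \<open>t \<in> simplexT m\<close> that
        by (intro member_le_sum) (auto simp: simplexT_def intro: less_imp_le)
      then show "t j \<le> 1" using \<open>t \<in> simplexT m\<close> by (auto simp: simplexT_def)
    qed
    have "\<bar>bary m t i\<bar> \<le> 1" for i
    proof (cases "i < m")
      case False
      have "(\<Sum>j<m. t j) \<ge> 0" using t by (intro sum_nonneg) (auto intro: less_imp_le)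
      then show ?thesis using False that by (auto simp: bary_def simplexT_def)
    qed (use t[of i] in \<open>auto simp: bary_def\<close>)
    then have "\<bar>x i * bary m t i\<bar> \<le> \<bar>x i\<bar>" for i
      by (simp add: abs_mult mult_left_le)
    then show ?thesis unfolding S_def K_def by (intro order.trans[OF sum_abs] sum_mono) auto
  qed
  have K: "K \<ge> 0" unfolding K_def by (intro sum_nonneg) auto
  have fb: "norm (f n t) \<le> K ^ n / fact n * dirichlet_dens m b (b m) t" for n t
  proof (cases "t \<in> simplexT m")
    case True
    then have "\<bar>S t\<bar> ^ n \<le> K ^ n" using Sb by (intro power_mono) auto
    then have "\<bar>S t\<bar> ^ n / fact n \<le> K ^ n / fact n" by (intro divide_right_mono) auto
    then have "dirichlet_dens m b (b m) t * (\<bar>S t\<bar> ^ n / fact n) \<le> dirichlet_dens m b (b m) t * (K ^ n / fact n)"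
      by (intro mult_left_mono dirichlet_dens_nonneg)
    then show ?thesis by (simp add: f_def abs_mult power_abs dirichlet_dens_nonneg mult.commute)
  qed (simp add: f_def dirichlet_dens_def)
  have fint: "integrable ?M (f n)" for n
  proof (rule Bochner_Integration.integrable_bound)
    show "integrable ?M (\<lambda>t. K ^ n / fact n * dirichlet_dens m b (b m) t)" using int0 by simp
    show "AE t in ?M. norm (f n t) \<le> norm (K ^ n / fact n * dirichlet_dens m b (b m) t)"
      by (rule AE_I2, rule order.trans[OF fb]) (simp only: real_norm_def abs_ge_self)
  qed (simp add: f_def)
  have "(\<lambda>n. \<integral>t. f n t \<partial>?M) sums (\<integral>t. (\<Sum>n. f n t) \<partial>?M)"
  proof (rule sums_integral[OF fint])
    have "summable (\<lambda>n. norm (S t ^ n / fact n))" for t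
      using summable_exp[of "\<bar>S t\<bar>"] by (simp add: power_abs field_simps)
    then show "AE t in ?M. summable (\<lambda>n. norm (f n t))"
      unfolding f_def norm_mult by (intro AE_I2 summable_mult)
    show "summable (\<lambda>n. \<integral>t. norm (f n t) \<partial>?M)"
    proof (rule summable_comparison_test')
      show "summable (\<lambda>n. inverse (fact n) * K ^ n * (\<integral>t. dirichlet_dens m b (b m) t \<partial>?M))"
        by (intro summable_mult2 summable_exp)
      fix n
      have "(\<integral>t. norm (f n t) \<partial>?M) \<le> (\<integral>t. K ^ n / fact n * dirichlet_dens m b (b m) t \<partial>?M)"
        using int0 fint fb by (intro integral_mono integrable_norm) auto
      then show "norm (\<integral>t. norm (f n t) \<partial>?M) \<le> inverse (fact n) * K ^ n * (\<integral>t. dirichlet_dens m b (b m) t \<partial>?M)"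
        by (simp add: field_simps)
    qed
  qed
  moreover have "(\<Sum>n. f n t) = dirichlet_dens m b (b m) t * exp (S t)" for t
  proof -
    have "(\<lambda>n. S t ^ n / fact n) sums exp (S t)"
      using exp_converges[of "S t"] by (simp add: field_simps)
    then have "(\<lambda>n. dirichlet_dens m b (b m) t * (S t ^ n / fact n)) sums (dirichlet_dens m b (b m) t * exp (S t))"
      by (rule sums_mult)
    then show ?thesis unfolding f_def by (rule sums_unique[symmetric])
  qed
  moreover have "(\<integral>t. f n t \<partial>?M) = ?G * ((\<Prod>i<m + 1. fpow (- b i) (lin (x i))) $ n / pochhammer B n)" for n
  proof -
    have bpos: "b i \<notin> \<int>\<^sub>\<le>\<^sub>0" "b i > 0" "Gamma (b i) \<noteq> 0" if "i \<le> m" for i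
      using assms(1)[OF that] by (auto simp: nonpos_Ints_def Gamma_eq_zero_iff)
    have Bpos: "B > 0" using assms(2) by (simp add: B_def)
    have moment: "integrable ?M (\<lambda>t. dirichlet_dens m b (b m) t * (\<Prod>i<Suc m. bary m t i ^ js i)) \<and>
      (\<integral>t. dirichlet_dens m b (b m) t * (\<Prod>i<Suc m. bary m t i ^ js i) \<partial>?M)
       = ?G * ((\<Prod>i<Suc m. pochhammer (b i) (js i)) / pochhammer B n)" if js: "js \<in> multi (Suc m) n" for js
    proof -
      have sum: "(\<Sum>i<m. b i + real (js i)) + (b m + real (js m)) = B + real n"
        using js unfolding B_def multi_def lessThan_Suc_atMost[symmetric]
        by (auto simp: sum.distrib algebra_simps simp flip: of_nat_sum of_nat_add)
      have "(\<integral>t. dirichlet_dens m b (b m) t * (\<Prod>i<Suc m. bary m t i ^ js i) \<partial>?M)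
        = (\<Prod>i<m. Gamma (b i + real (js i))) * Gamma (b m + real (js m)) / Gamma (B + real n)"
        unfolding dirichlet_dens_mult_bary sum[symmetric]
        using bpos by (intro integral_dirichlet) (auto intro: add_pos_nonneg)
      also have "\<dots> = (\<Prod>i<Suc m. Gamma (b i + real (js i))) / Gamma (B + real n)" by simp
      also have "(\<Prod>i<Suc m. Gamma (b i + real (js i))) = (\<Prod>i<Suc m. Gamma (b i) * pochhammer (b i) (js i))"
        using bpos by (intro prod.cong refl) (auto simp: pochhammer_Gamma less_Suc_eq_le)
      also have "Gamma (B + real n) = Gamma B * pochhammer B n"
      proof -
        have "B \<notin> \<int>\<^sub>\<le>\<^sub>0" "Gamma B \<noteq> 0" using Bpos by (auto simp: nonpos_Ints_def Gamma_eq_zero_iff)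
        then show ?thesis by (simp add: pochhammer_Gamma)
      qed
      also have "(\<Prod>i<Suc m. Gamma (b i) * pochhammer (b i) (js i)) / (Gamma B * pochhammer B n)
          = ?G * ((\<Prod>i<Suc m. pochhammer (b i) (js i)) / pochhammer B n)"
        unfolding prod.distrib B_def[symmetric] lessThan_Suc_atMost by simp
      finally show ?thesis
        unfolding dirichlet_dens_mult_bary using bpos by (auto intro!: integrable_dirichlet add_pos_nonneg)
    qed
    have "f n t = (\<Sum>js\<in>multi (Suc m) n. (\<Prod>i<Suc m. x i ^ js i / fact (js i)) *
         (dirichlet_dens m b (b m) t * (\<Prod>i<Suc m. bary m t i ^ js i)))" for t
      unfolding f_def S_def lessThan_Suc_atMost[symmetric] exp_sum_multi sum_distrib_left
      by (intro sum.cong refl) (simp add: prod.distrib prod_dividef power_mult_distrib)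
    then have "(\<integral>t. f n t \<partial>?M) = (\<Sum>js\<in>multi (Suc m) n. (\<Prod>i<Suc m. x i ^ js i / fact (js i)) *
        (\<integral>t. dirichlet_dens m b (b m) t * (\<Prod>i<Suc m. bary m t i ^ js i) \<partial>?M))"
      using moment by (simp add: Bochner_Integration.integral_sum del: prod.lessThan_Suc)
    also have "\<dots> = (\<Sum>js\<in>multi (Suc m) n. (\<Prod>i<Suc m. x i ^ js i / fact (js i)) *
        (?G * ((\<Prod>i<Suc m. pochhammer (b i) (js i)) / pochhammer B n)))"
      using moment by (intro sum.cong refl) simp
    also have "\<dots> = (\<Sum>js\<in>multi (Suc m) n. ?G * ((\<Prod>i<Suc m. fpow (- b i) (lin (x i)) $ js i) / pochhammer B n))"
      unfolding fpow_lin_nth prod_dividef prod.distrib by (intro sum.cong refl) (simp add: field_simps)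
    finally show ?thesis
      unfolding fps_prod_nth_multi Suc_eq_plus1 by (simp add: sum_distrib_left sum_divide_distrib)
  qed
  ultimately have "(\<lambda>n. ?G * ((\<Prod>i<m + 1. fpow (- b i) (lin (x i))) $ n / pochhammer B n)) sums ?I"
    by (simp add: S_def)
  moreover have "(\<lambda>n. ?G * ((\<Prod>i<m + 1. fpow (- b i) (lin (x i))) $ n / pochhammer B n)) sums (?G * humbert2 (m + 1) b B x)"
    using assms by (intro sums_mult humbert2_sums) (auto simp: B_def)
  ultimately show ?thesis unfolding B_def using sums_unique2 by blast
qed

text \<open>The last Dirichlet parameter is 1, so the exponent of the coordinate
  \<open>1 - (t_0 + ... + t_(k-1))\<close> is 0 and that coordinate carries no weight.\<close>

lemma simplex_integral_humbert2:
  assumes "\<gamma> > 0"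
  shows "(LINT t:simplexT k|PiM {..<k} (\<lambda>_. lborel).
      exp ((\<Sum>j<k. x j * t j) + x k * (1 - (\<Sum>j<k. t j))) * (\<Prod>j<k. t j powr (\<gamma> - 1)))
    = Gamma \<gamma> ^ k / Gamma (real k * \<gamma> + 1)
      * humbert2 (k + 1) (\<lambda>i. if i < k then \<gamma> else 1) (real k * \<gamma> + 1) x"
proof -
  let ?b = "\<lambda>i. if i < k then \<gamma> else 1"
  have S: "(\<Sum>i\<le>k. ?b i) = real k * \<gamma> + 1"
    unfolding lessThan_Suc_atMost[symmetric] by simp
  have G: "(\<Prod>i\<le>k. Gamma (?b i)) = Gamma \<gamma> ^ k"
    unfolding lessThan_Suc_atMost[symmetric] by simp
  have "indicator (simplexT k) t *\<^sub>R
      (exp ((\<Sum>j<k. x j * t j) + x k * (1 - (\<Sum>j<k. t j))) * (\<Prod>j<k. t j powr (\<gamma> - 1)))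
    = dirichlet_dens k ?b (?b k) t * exp (\<Sum>i\<le>k. x i * bary k t i)" for t
  proof (cases "t \<in> simplexT k")
    case True
    then have "1 - (\<Sum>j<k. t j) > 0" by (simp add: simplexT_def)
    moreover have "(\<Sum>i\<le>k. x i * bary k t i) = (\<Sum>j<k. x j * t j) + x k * (1 - (\<Sum>j<k. t j))"
      unfolding lessThan_Suc_atMost[symmetric] by (simp add: bary_def)
    ultimately show ?thesis using True by (simp add: dirichlet_dens_def)
  qed (simp add: dirichlet_dens_def)
  then have "(LINT t:simplexT k|PiM {..<k} (\<lambda>_. lborel).
      exp ((\<Sum>j<k. x j * t j) + x k * (1 - (\<Sum>j<k. t j))) * (\<Prod>j<k. t j powr (\<gamma> - 1)))
    = (\<integral>t. dirichlet_dens k ?b (?b k) t * exp (\<Sum>i\<le>k. x i * bary k t i) \<partial>PiM {..<k} (\<lambda>_. lborel))"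
    unfolding set_lebesgue_integral_def by simp
  also have "\<dots> = (\<Prod>i\<le>k. Gamma (?b i)) / Gamma (\<Sum>i\<le>k. ?b i) * humbert2 (k + 1) ?b (\<Sum>i\<le>k. ?b i) x"
    by (rule humbert2_simplex) (use assms in \<open>auto simp: S\<close>)
  finally show ?thesis unfolding S G .
qed

lemma fpow_lin_0: "fpow c (lin 0) = 1"
  by (simp add: fpow_def)

text \<open>Read off from the simplex integral: barycentric coordinates sum to 1, so subtracting
  \<open>x k\<close> from all variables pulls out \<open>exp (x k)\<close>. The last variable
  becomes 0, its factor in the generating product becomes 1, and \<open>k\<close> variables
  remain.\<close>

theorem humbert2_shift:
  assumes "\<gamma> > 0"
  shows "humbert2 (k + 1) (\<lambda>i. if i < k then \<gamma> else 1) (real k * \<gamma> + 1) x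
    = exp (x k) * humbert2 k (\<lambda>_. \<gamma>) (real k * \<gamma> + 1) (\<lambda>j. x j - x k)"
proof -
  let ?b = "\<lambda>i. if i < k then \<gamma> else 1" and ?c = "real k * \<gamma> + 1"
  define y where "y = (\<lambda>j. if j < k then x j - x k else 0)"
  have c: "?c \<ge> 1" using assms by simp
  have pos: "Gamma \<gamma> ^ k / Gamma ?c \<noteq> 0"
  proof -
    have "Gamma \<gamma> > 0" using assms by (rule Gamma_real_pos)
    moreover have "Gamma ?c > 0" using c by (intro Gamma_real_pos) linarith
    ultimately show ?thesis by (metis divide_eq_0_iff less_irrefl power_not_zero)
  qed
  have "humbert2 (k + 1) ?b ?c y = humbert2 k (\<lambda>_. \<gamma>) ?c (\<lambda>j. x j - x k)"
  proof (rule sums_unique2)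
    show "(\<lambda>n. (\<Prod>i<k + 1. fpow (- ?b i) (lin (y i))) $ n / pochhammer ?c n) sums humbert2 (k + 1) ?b ?c y"
      using assms by (intro humbert2_sums c) auto
    have "(\<Prod>i<k + 1. fpow (- ?b i) (lin (y i))) = (\<Prod>i<k. fpow (- \<gamma>) (lin (x i - x k)))"
      by (simp add: y_def fpow_lin_0[simplified])
    then show "(\<lambda>n. (\<Prod>i<k + 1. fpow (- ?b i) (lin (y i))) $ n / pochhammer ?c n)
        sums humbert2 k (\<lambda>_. \<gamma>) ?c (\<lambda>j. x j - x k)"
      using assms humbert2_sums[OF c, of k "\<lambda>_. \<gamma>" "\<lambda>j. x j - x k"] by simp
  qed
  moreover have "Gamma \<gamma> ^ k / Gamma ?c * humbert2 (k + 1) ?b ?c x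
      = exp (x k) * (Gamma \<gamma> ^ k / Gamma ?c * humbert2 (k + 1) ?b ?c y)"
  proof -
    have "exp ((\<Sum>j<k. x j * t j) + x k * (1 - (\<Sum>j<k. t j)))
       = exp (x k) * exp ((\<Sum>j<k. y j * t j) + y k * (1 - (\<Sum>j<k. t j)))" for t
      by (simp add: y_def algebra_simps sum_subtractf sum_distrib_left flip: exp_add)
    then show ?thesis
      unfolding simplex_integral_humbert2[OF assms, symmetric] by (simp only: mult.assoc set_integral_mult_right)
  qed
  ultimately show ?thesis using pos by auto
qed

section \<open>Differentiation under the integral and the measures on the interval\<close>

lemma integrable_continuous_AE_compact:
  fixes g :: "'b::{metric_space, second_countable_topology} \<Rightarrow> real"
  assumes "finite_measure M" "sets M = sets borel" "AE t in M. t \<in> K" "compact K" "continuous_on UNIV g"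
  shows "integrable M g"
proof -
  interpret finite_measure M by fact
  have "bounded (g ` K)"
    using assms by (intro compact_imp_bounded compact_continuous_image) (auto intro: continuous_on_subset)
  then obtain B where B: "\<And>t. t \<in> K \<Longrightarrow> norm (g t) \<le> B" by (auto simp: bounded_iff)
  have "AE t in M. norm (g t) \<le> B" using assms(3) by eventually_elim (rule B)
  moreover have "g \<in> borel_measurable M"
    using borel_measurable_continuous_onI[OF assms(5)] assms(2) measurable_cong_sets by blast
  ultimately show ?thesis by (intro integrable_const_bound)
qed

text \<open>Joint continuity makes the derivatives uniformly continuous on the compact product of a
  ball around \<open>z\<close> with \<open>K\<close>, so the mean value inequality controls the
  remainder uniformly in \<open>t\<close>. By linearity it suffices to treat the directions 1 and
  \<open>\<i>\<close>.\<close>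

lemma has_derivative_integral_compact:
  fixes f :: "complex \<Rightarrow> 'b::{metric_space, second_countable_topology} \<Rightarrow> real"
  assumes M: "finite_measure M" "sets M = sets borel" "AE t in M. t \<in> K" "compact K"
    and der: "\<And>z t. ((\<lambda>z. f z t) has_derivative (\<lambda>h. f' z h t)) (at z)"
    and cf: "\<And>z. continuous_on UNIV (f z)"
    and cf': "\<And>h. continuous_on UNIV (\<lambda>(z, t). f' z h t)"
  shows "((\<lambda>z. \<integral>t. f z t \<partial>M) has_derivative (\<lambda>h. \<integral>t. f' z h t \<partial>M)) (at z)"
proof -
  interpret finite_measure M by fact
  have cf't: "continuous_on UNIV (f' z h)" for z h
  proof -
    have "continuous_on UNIV (\<lambda>t. (\<lambda>(z, t). f' z h t) (z, t))"
      by (rule continuous_on_compose2[OF cf'[of h] continuous_on_Pair[OF continuous_on_const continuous_on_id]]) simp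
    then show ?thesis by simp
  qed
  have intf: "integrable M (f z)" for z by (intro integrable_continuous_AE_compact[OF M] cf)
  have intf': "integrable M (f' z h)" for z h by (intro integrable_continuous_AE_compact[OF M] cf't)
  have lin: "f' z h t = Re h * f' z 1 t + Im h * f' z \<i> t" for z h t
  proof -
    have "linear (\<lambda>h. f' z h t)" using der has_derivative_linear by blast
    then have "f' z (Re h *\<^sub>R 1 + Im h *\<^sub>R \<i>) t = Re h * f' z 1 t + Im h * f' z \<i> t"
      by (simp add: linear_iff)
    moreover have "Re h *\<^sub>R 1 + Im h *\<^sub>R \<i> = h" by (simp add: complex_eq_iff)
    ultimately show ?thesis by simp
  qed
  show ?thesis unfolding has_derivative_at_alt
  proof (intro conjI allI impI)
    have "(\<lambda>h. \<integral>t. f' z h t \<partial>M) = (\<lambda>h. Re h * (\<integral>t. f' z 1 t \<partial>M) + Im h * (\<integral>t. f' z \<i> t \<partial>M))"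
      using intf' by (subst lin) simp
    moreover have "bounded_linear (\<lambda>h. Re h * (\<integral>t. f' z 1 t \<partial>M) + Im h * (\<integral>t. f' z \<i> t \<partial>M))"
      by (intro bounded_linear_add bounded_linear_mult_const bounded_linear_Re bounded_linear_Im)
    ultimately show "bounded_linear (\<lambda>h. \<integral>t. f' z h t \<partial>M)" by simp
  next
    fix e :: real assume e: "e > 0"
    \<comment> \<open>The \<open>+ 1\<close> keeps \<open>m\<close> positive for the zero measure.
      The factor 2 in \<open>e'\<close> accounts for the two real directions.\<close>
    define m where "m = measure M (space M) + 1"
    have m: "m > 0" "measure M (space M) \<le> m" unfolding m_def by (auto simp: add_nonneg_pos)
    define e' where "e' = e / m / 2"
    have e': "e' > 0" using e m by (simp add: e'_def)
    have unif: "\<exists>d>0. \<forall>y t. t \<in> K \<longrightarrow> norm (y - z) < d \<longrightarrow> \<bar>f' y h t - f' z h t\<bar> \<le> e'" for h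
    proof -
      have "uniformly_continuous_on (cball z 1 \<times> K) (\<lambda>(z, t). f' z h t)"
        using M(4) cf' by (intro compact_uniformly_continuous compact_Times) (auto intro: continuous_on_subset)
      then obtain d where d: "d > 0" "\<And>x x'. x \<in> cball z 1 \<times> K \<Longrightarrow> x' \<in> cball z 1 \<times> K \<Longrightarrow> dist x' x < d \<Longrightarrow>
          dist ((\<lambda>(z, t). f' z h t) x') ((\<lambda>(z, t). f' z h t) x) < e'"
        unfolding uniformly_continuous_on_def using e' by meson
      have "\<bar>f' y h t - f' z h t\<bar> \<le> e'" if "t \<in> K" "norm (y - z) < min d 1" for y t
        using d(2)[of "(z, t)" "(y, t)"] that by (auto simp: dist_norm dist_Pair_Pair norm_minus_commute)
      moreover have "min d 1 > 0" using d(1) by auto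
      ultimately show ?thesis by blast
    qed
    obtain d1 d2 where d1: "d1 > 0" "\<And>y t. t \<in> K \<Longrightarrow> norm (y - z) < d1 \<Longrightarrow> \<bar>f' y 1 t - f' z 1 t\<bar> \<le> e'"
      and d2: "d2 > 0" "\<And>y t. t \<in> K \<Longrightarrow> norm (y - z) < d2 \<Longrightarrow> \<bar>f' y \<i> t - f' z \<i> t\<bar> \<le> e'"
      using unif[of 1] unif[of \<i>] by blast
    define d where "d = min d1 d2"
    have "norm ((\<integral>t. f y t \<partial>M) - (\<integral>t. f z t \<partial>M) - (\<integral>t. f' z (y - z) t \<partial>M)) \<le> e * norm (y - z)"
      if y: "norm (y - z) < d" for y
    proof -
      have pt: "\<bar>f y t - f z t - f' z (y - z) t\<bar> \<le> (2 * e') * norm (y - z)" if t: "t \<in> K" for t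
      proof -
        have lz: "linear (\<lambda>h. f' z h t)" using der has_derivative_linear by blast
        have bl: "bounded_linear (\<lambda>h. f' z h t)" using der has_derivative_bounded_linear by blast
        have "norm ((f y t - f' z y t) - (f z t - f' z z t)) \<le> (2 * e') * norm (y - z)"
        proof (rule differentiable_bound[where S = "ball z d" and f' = "\<lambda>x h. f' x h t - f' z h t"])
          fix x assume x: "x \<in> ball z d"
          show "((\<lambda>y. f y t - f' z y t) has_derivative (\<lambda>h. f' x h t - f' z h t)) (at x within ball z d)"
            by (intro has_derivative_diff has_derivative_at_withinI[OF der]
                bounded_linear_imp_has_derivative bl)
          show "onorm (\<lambda>h. f' x h t - f' z h t) \<le> 2 * e'"
          proof (rule onorm_bound)
            fix h
            have "norm (x - z) < d1" "norm (x - z) < d2"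
              using x by (auto simp: d_def dist_norm norm_minus_commute)
            then have b: "\<bar>f' x 1 t - f' z 1 t\<bar> \<le> e'" "\<bar>f' x \<i> t - f' z \<i> t\<bar> \<le> e'"
              using d1(2) d2(2) t by auto
            have "f' x h t - f' z h t = Re h * (f' x 1 t - f' z 1 t) + Im h * (f' x \<i> t - f' z \<i> t)"
              unfolding lin[of x h] lin[of z h] by (simp add: algebra_simps)
            also have "\<bar>\<dots>\<bar> \<le> \<bar>Re h\<bar> * \<bar>f' x 1 t - f' z 1 t\<bar> + \<bar>Im h\<bar> * \<bar>f' x \<i> t - f' z \<i> t\<bar>"
              by (rule order.trans[OF abs_triangle_ineq]) (simp add: abs_mult)
            also have "\<dots> \<le> cmod h * e' + cmod h * e'"
              using b by (intro add_mono mult_mono abs_Re_le_cmod abs_Im_le_cmod) auto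
            finally show "norm (f' x h t - f' z h t) \<le> 2 * e' * norm h" by (simp add: algebra_simps)
          qed (use e' in auto)
        qed (use y d1(1) d2(1) in \<open>auto simp: dist_norm d_def norm_minus_commute\<close>)
        then show ?thesis by (simp add: linear_diff[OF lz] algebra_simps)
      qed
      have "(\<integral>t. f y t \<partial>M) - (\<integral>t. f z t \<partial>M) - (\<integral>t. f' z (y - z) t \<partial>M)
          = (\<integral>t. f y t - f z t - f' z (y - z) t \<partial>M)"
        using intf intf' by simp
      also have "norm \<dots> \<le> (\<integral>t. norm (f y t - f z t - f' z (y - z) t) \<partial>M)"
        by (rule integral_norm_bound)
      also have "\<dots> \<le> (\<integral>t. (2 * e') * norm (y - z) \<partial>M)"
        using intf intf' M(3) pt by (intro integral_mono_AE) (auto elim!: eventually_mono)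
      also have "\<dots> = (2 * e') * norm (y - z) * measure M (space M)" by simp
      also have "\<dots> \<le> (2 * e') * norm (y - z) * m"
        using m e' by (intro mult_left_mono) auto
      also have "\<dots> = e * norm (y - z)" using m by (simp add: e'_def)
      finally show ?thesis .
    qed
    moreover have "d > 0" using d1 d2 by (simp add: d_def)
    ultimately show "\<exists>d>0. \<forall>y. norm (y - z) < d \<longrightarrow>
       norm ((\<integral>t. f y t \<partial>M) - (\<integral>t. f z t \<partial>M) - (\<integral>t. f' z (y - z) t \<partial>M)) \<le> e * norm (y - z)" by blast
  qed
qed

section \<open>The measures on the interval: normalisation and integration by parts\<close>

lemma Gamma_legendre_duplication_real:
  fixes x :: real
  assumes "x > 0"
  shows "Gamma x * Gamma (x + 1/2) = 2 powr (1 - 2 * x) * sqrt pi * Gamma (2 * x)"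
proof -
  have n: "complex_of_real x \<notin> \<int>\<^sub>\<le>\<^sub>0" "complex_of_real x + 1/2 \<notin> \<int>\<^sub>\<le>\<^sub>0"
    using assms by (auto simp: nonpos_Ints_def complex_eq_iff)
  have "complex_of_real (Gamma x * Gamma (x + 1/2)) = Gamma (complex_of_real x) * Gamma (complex_of_real x + 1/2)"
    by (simp flip: Gamma_complex_of_real)
  also have "\<dots> = exp ((1 - 2 * complex_of_real x) * of_real (ln 2)) * of_real (sqrt pi) * Gamma (2 * complex_of_real x)"
    by (rule Gamma_legendre_duplication[OF n])
  also have "\<dots> = complex_of_real (exp ((1 - 2 * x) * ln 2) * sqrt pi * Gamma (2 * x))"
    by (simp add: exp_of_real[symmetric] flip: Gamma_complex_of_real)
  also have "exp ((1 - 2 * x) * ln 2) = 2 powr (1 - 2 * x)" by (simp add: powr_def)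
  finally show ?thesis using of_real_eq_iff by blast
qed

definition mu_meas :: "real \<Rightarrow> real measure" where
  "mu_meas \<alpha> = density lborel (\<lambda>u. ennreal (indicator {-1..1} u * mu_dens \<alpha> u))"

lemma sets_mu_meas [simp, measurable_cong]: "sets (mu_meas \<alpha>) = sets borel"
  by (simp add: mu_meas_def)

lemma space_mu_meas [simp]: "space (mu_meas \<alpha>) = UNIV"
  by (simp add: mu_meas_def)

lemma mu_dens_measurable [measurable]: "mu_dens \<alpha> \<in> borel_measurable borel"
  unfolding mu_dens_def by measurable

lemma mu_dens_nonneg: "\<alpha> > 0 \<Longrightarrow> u \<in> {-1..1} \<Longrightarrow> mu_dens \<alpha> u \<ge> 0"
  unfolding mu_dens_def
  by (intro mult_nonneg_nonneg divide_nonneg_nonneg) (auto intro!: less_imp_le[OF Gamma_real_pos])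

lemma mu_dens_ind_nonneg: "\<alpha> > 0 \<Longrightarrow> indicator {-1..1} u * mu_dens \<alpha> u \<ge> 0"
  using mu_dens_nonneg by (auto simp: indicator_def)

text \<open>The substitution \<open>u = 2 s - 1\<close> reduces the total mass to
  \<open>Beta (\<alpha> + 1) \<alpha>\<close>, and Legendre duplication matches this with the
  constant in \<open>mu_dens\<close>.\<close>

lemma prob_space_mu_meas:
  assumes "\<alpha> > 0"
  shows "prob_space (mu_meas \<alpha>)"
proof
  define C where "C = Gamma (\<alpha> + 1/2) / (sqrt pi * Gamma \<alpha>)"
  have pos: "Gamma \<alpha> > 0" "Gamma (\<alpha> + 1/2) > 0" "Gamma (2 * \<alpha>) > 0" using assms by (auto intro!: Gamma_real_pos)
  then have C: "C \<ge> 0" by (simp add: C_def)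
  have "emeasure (mu_meas \<alpha>) (space (mu_meas \<alpha>)) = (\<integral>\<^sup>+u. ennreal (indicator {-1..1} u * mu_dens \<alpha> u) \<partial>lborel)"
    unfolding mu_meas_def by (simp add: emeasure_density)
  also have "\<dots> = ennreal \<bar>2\<bar> * (\<integral>\<^sup>+s. ennreal (indicator {-1..1} (-1 + 2 * s) * mu_dens \<alpha> (-1 + 2 * s)) \<partial>lborel)"
    by (intro nn_integral_real_affine) auto
  also have "(\<integral>\<^sup>+s. ennreal (indicator {-1..1} (-1 + 2 * s) * mu_dens \<alpha> (-1 + 2 * s)) \<partial>lborel)
     = (\<integral>\<^sup>+s. ennreal (C * 2 * 4 powr (\<alpha> - 1)) * ennreal (indicator {0<..<1} s * (s powr ((\<alpha> + 1) - 1) * (1 - s) powr (\<alpha> - 1))) \<partial>lborel)"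
  proof (intro nn_integral_cong)
    fix s :: real
    have "indicator {-1..1} (-1 + 2 * s) * mu_dens \<alpha> (-1 + 2 * s)
       = (C * 2 * 4 powr (\<alpha> - 1)) * (indicator {0<..<1} s * (s powr ((\<alpha> + 1) - 1) * (1 - s) powr (\<alpha> - 1)))"
    proof (cases "0 < s \<and> s < 1")
      case True
      have "1 - (-1 + 2 * s)\<^sup>2 = 4 * (s * (1 - s))" by (simp add: power2_eq_square algebra_simps)
      then have "(1 - (-1 + 2 * s)\<^sup>2) powr (\<alpha> - 1) = 4 powr (\<alpha> - 1) * (s powr (\<alpha> - 1) * (1 - s) powr (\<alpha> - 1))"
        using True by (simp add: powr_mult)
      moreover have "s powr \<alpha> = s * s powr (\<alpha> - 1)"
        using True powr_add[of s 1 "\<alpha> - 1"] by simp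
      ultimately show ?thesis using True by (simp add: mu_dens_def C_def)
    next
      case False
      \<comment> \<open>At the end points both sides vanish: \<open>0 powr x\<close> is 0 also for
        negative \<open>x\<close>.\<close>
      then have "s = 0 \<or> s = 1 \<or> s < 0 \<or> s > 1" by linarith
      then show ?thesis by (auto simp: mu_dens_def)
    qed
    then show "ennreal (indicator {-1..1} (-1 + 2 * s) * mu_dens \<alpha> (-1 + 2 * s))
       = ennreal (C * 2 * 4 powr (\<alpha> - 1)) * ennreal (indicator {0<..<1} s * (s powr ((\<alpha> + 1) - 1) * (1 - s) powr (\<alpha> - 1)))"
      using C by (simp add: ennreal_mult'[symmetric])
  qed
  also have "\<dots> = ennreal (C * 2 * 4 powr (\<alpha> - 1)) * ennreal (Beta (\<alpha> + 1) \<alpha>)"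
    using assms by (subst nn_integral_cmult) (auto simp: nn_integral_Beta_unit[of "\<alpha> + 1" \<alpha>, simplified])
  also have "ennreal \<bar>2\<bar> * \<dots> = ennreal (2 * (C * 2 * 4 powr (\<alpha> - 1) * Beta (\<alpha> + 1) \<alpha>))"
  proof -
    have A: "C * 2 * 4 powr (\<alpha> - 1) \<ge> 0" using C by simp
    show ?thesis
      unfolding abs_numeral
      by (simp only: ennreal_mult'[OF A, symmetric] ennreal_mult'[of 2, symmetric] zero_le_numeral)
  qed
  also have "2 * (C * 2 * 4 powr (\<alpha> - 1) * Beta (\<alpha> + 1) \<alpha>) = 1"
  proof -
    have g1: "Gamma (\<alpha> + 1) = \<alpha> * Gamma \<alpha>" "Gamma (2 * \<alpha> + 1) = 2 * \<alpha> * Gamma (2 * \<alpha>)"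
      using Gamma_plus1[of \<alpha>] Gamma_plus1[of "2 * \<alpha>"] assms by (auto simp: nonpos_Ints_def)
    have s: "\<alpha> + 1 + \<alpha> = 2 * \<alpha> + 1" by simp
    have "Beta (\<alpha> + 1) \<alpha> = Gamma \<alpha> * Gamma \<alpha> / (2 * Gamma (2 * \<alpha>))"
      unfolding Beta_def s g1 using assms by (simp add: field_simps)
    moreover have "Gamma \<alpha> * Gamma (\<alpha> + 1/2) = 2 powr (1 - 2 * \<alpha>) * sqrt pi * Gamma (2 * \<alpha>)"
      by (rule Gamma_legendre_duplication_real[OF assms])
    moreover have "4 powr (\<alpha> - 1) * 2 powr (1 - 2 * \<alpha>) = 1 / 2"
    proof -
      have "(4::real) powr (\<alpha> - 1) = 2 powr (2 * (\<alpha> - 1))" using powr_powr[of 2 2 "\<alpha> - 1"] by simp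
      then have "4 powr (\<alpha> - 1) * 2 powr (1 - 2 * \<alpha>) = (2::real) powr (- 1)"
        by (simp add: powr_add[symmetric] del: powr_minus_divide)
      then show ?thesis by (simp add: powr_minus)
    qed
    ultimately have *: "4 powr (\<alpha> - 1) * (Gamma \<alpha> * Gamma (\<alpha> + 1/2)) = 1/2 * (sqrt pi * Gamma (2 * \<alpha>))"
      "Beta (\<alpha> + 1) \<alpha> = Gamma \<alpha> * Gamma \<alpha> / (2 * Gamma (2 * \<alpha>))" by simp_all
    have "2 * (C * 2 * 4 powr (\<alpha> - 1) * Beta (\<alpha> + 1) \<alpha>)
      = 2 * (4 powr (\<alpha> - 1) * (Gamma \<alpha> * Gamma (\<alpha> + 1/2))) / (sqrt pi * Gamma (2 * \<alpha>))"
      unfolding C_def *(2) using pos by (simp add: field_simps)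
    then show ?thesis unfolding *(1) using pos by simp
  qed
  finally show "emeasure (mu_meas \<alpha>) (space (mu_meas \<alpha>)) = 1" by simp
qed

lemma AE_mu_meas:
  assumes "\<alpha> > 0"
  shows "AE u in mu_meas \<alpha>. u \<in> {-1..1}"
  unfolding mu_meas_def by (subst AE_density) (auto simp: indicator_def intro!: AE_I2)

lemma integral_mu_meas:
  assumes "\<alpha> > 0" "g \<in> borel_measurable borel"
  shows "(\<integral>u. g u \<partial>mu_meas \<alpha>) = (LINT u:{-1..1}|lborel. (g u :: real) * mu_dens \<alpha> u)"
  unfolding mu_meas_def set_lebesgue_integral_def
  using assms mu_dens_ind_nonneg[OF assms(1)] by (subst integral_density) (auto simp: mult_ac)

lemma integrable_mu_meas_iff:
  assumes "\<alpha> > 0" "g \<in> borel_measurable borel"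
  shows "integrable (mu_meas \<alpha>) g \<longleftrightarrow> set_integrable lborel {-1..1} (\<lambda>u. (g u :: real) * mu_dens \<alpha> u)"
  unfolding mu_meas_def set_integrable_def
  using assms mu_dens_ind_nonneg[OF assms(1)] by (subst integrable_density) (auto simp: mult_ac)

lemma integrable_mu_meas:
  fixes g :: "real \<Rightarrow> real"
  assumes "\<alpha> > 0" "continuous_on UNIV g"
  shows "integrable (mu_meas \<alpha>) g"
  using prob_space_mu_meas[OF assms(1)] AE_mu_meas[OF assms(1)] assms(2)
  by (intro integrable_continuous_AE_compact[where K = "{-1..1}"]) (auto simp: prob_space.finite_measure)

text \<open>The density times \<open>1 - u\<close> is \<open>C (1 - u^2)^\<alpha>\<close>, and the
  derivative of this is \<open>- \<alpha>\<close> times the difference of the densities at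
  \<open>u\<close> and \<open>- u\<close>. The asymmetric factor \<open>1 + u\<close> of the density
  thus turns integration by parts into the reflection \<open>u -> - u\<close>, with the multiplicity
  as coefficient.\<close>

lemma integral_by_parts_mu:
  fixes g :: "real \<Rightarrow> real"
  assumes "\<alpha> > 0" and der: "\<And>u. (g has_real_derivative g' u) (at u)" and cg': "continuous_on UNIV g'"
  shows "(\<integral>u. (1 - u) * g' u \<partial>mu_meas \<alpha>) = \<alpha> * ((\<integral>u. g u \<partial>mu_meas \<alpha>) - (\<integral>u. g (- u) \<partial>mu_meas \<alpha>))"
proof -
  define C where "C = Gamma (\<alpha> + 1/2) / (sqrt pi * Gamma \<alpha>)"
  have cg: "continuous_on UNIV g"
    using der by (intro continuous_at_imp_continuous_on ballI) (metis DERIV_isCont)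
  have cgm: "continuous_on UNIV (\<lambda>u. g (- u))"
    by (intro continuous_on_compose2[OF cg] continuous_intros) auto
  have [measurable]: "g \<in> borel_measurable borel" "g' \<in> borel_measurable borel"
    using cg cg' by (auto intro: borel_measurable_continuous_onI)
  define G1 where "G1 = (\<lambda>u. (1 - u) * g' u * mu_dens \<alpha> u)"
  define G2 where "G2 = (\<lambda>u. g u * mu_dens \<alpha> u)"
  define G3 where "G3 = (\<lambda>u. g u * mu_dens \<alpha> (- u))"
  have i1: "set_integrable lborel {-1..1} G1" and e1: "(LINT u:{-1..1}|lborel. G1 u) = (\<integral>u. (1 - u) * g' u \<partial>mu_meas \<alpha>)"
    unfolding G1_def using assms(1) cg'
    by (auto simp: integral_mu_meas integrable_mu_meas_iff[symmetric] intro!: integrable_mu_meas continuous_intros)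
  have i2: "set_integrable lborel {-1..1} G2" and e2: "(LINT u:{-1..1}|lborel. G2 u) = (\<integral>u. g u \<partial>mu_meas \<alpha>)"
    unfolding G2_def using assms(1) cg
    by (auto simp: integral_mu_meas integrable_mu_meas_iff[symmetric] intro!: integrable_mu_meas)
  have i3': "set_integrable lborel {-1..1} (\<lambda>u. g (- u) * mu_dens \<alpha> u)"
    using assms(1) cgm by (auto simp: integrable_mu_meas_iff[symmetric] intro!: integrable_mu_meas)
  have ind: "indicator {-1..1} (- u) = (indicator {-1..1} u :: real)" for u :: real
    by (auto simp: indicator_def)
  have i3: "set_integrable lborel {-1..1} G3"
    using lborel_integrable_real_affine[OF i3'[unfolded set_integrable_def], of "-1" 0]
    unfolding set_integrable_def G3_def by (simp add: ind)
  have e3: "(LINT u:{-1..1}|lborel. G3 u) = (\<integral>u. g (- u) \<partial>mu_meas \<alpha>)"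
    using lborel_integral_real_affine[of "-1" "\<lambda>u. indicator {-1..1} u *\<^sub>R (g (- u) * mu_dens \<alpha> u)" 0] assms(1)
    unfolding set_lebesgue_integral_def G3_def
    by (subst integral_mu_meas) (auto simp: ind set_lebesgue_integral_def)
  define G where "G = (\<lambda>u. G1 u - \<alpha> * (G2 u - G3 u))"
  have iG: "set_integrable lborel {-1..1} G"
    unfolding G_def using i1 i2 i3 by (intro set_integral_diff set_integrable_mult_right) auto
  \<comment> \<open>The antiderivative of \<open>G\<close>. It vanishes at both ends since
    \<open>\<alpha> > 0\<close>. For \<open>\<alpha> < 1\<close> the weight in \<open>G\<close> may
    blow up there, hence the fundamental theorem in its interior form.\<close>
  define F where "F = (\<lambda>u. C * ((1 - u\<^sup>2) powr \<alpha> * g u))"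
  have sq: "1 - u\<^sup>2 \<ge> 0" if "u \<in> {-1..1}" for u :: real
    using that by (auto simp: abs_square_le_1 abs_le_iff)
  have "(G has_integral (F 1 - F (-1))) {-1..1}"
  proof (rule fundamental_theorem_of_calculus_interior)
    show "continuous_on {-1..1} F"
      unfolding F_def using assms(1) sq
      by (intro continuous_intros continuous_on_powr' continuous_on_subset[OF cg]) auto
    fix u :: real assume u: "u \<in> {-1<..<1}"
    have sq': "1 - u\<^sup>2 > 0" using u by (auto simp: abs_square_less_1 abs_less_iff)
    have p: "(1 - u\<^sup>2) powr \<alpha> = (1 - u) * (1 + u) * (1 - u\<^sup>2) powr (\<alpha> - 1)"
      using sq' powr_add[of "1 - u\<^sup>2" 1 "\<alpha> - 1"] by (simp add: power2_eq_square algebra_simps)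
    have "((\<lambda>u. (1 - u\<^sup>2) powr \<alpha>) has_real_derivative \<alpha> * (1 - u\<^sup>2) powr (\<alpha> - 1) * (- 2 * u)) (at u)"
      using sq' by (auto intro!: derivative_eq_intros)
    then have "(F has_real_derivative C * (\<alpha> * (1 - u\<^sup>2) powr (\<alpha> - 1) * (- 2 * u) * g u + (1 - u\<^sup>2) powr \<alpha> * g' u)) (at u)"
      unfolding F_def using sq' by (auto intro!: derivative_eq_intros der)
    moreover have "C * (\<alpha> * (1 - u\<^sup>2) powr (\<alpha> - 1) * (- 2 * u) * g u + (1 - u\<^sup>2) powr \<alpha> * g' u) = G u"
      unfolding p G_def G1_def G2_def G3_def mu_dens_def C_def[symmetric] by (simp add: algebra_simps)
    ultimately show "(F has_vector_derivative G u) (at u)"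
      by (simp add: has_real_derivative_iff_has_vector_derivative)
  qed auto
  then have "integral {-1..1} G = 0" by (simp add: F_def integral_unique)
  then have "(LINT u:{-1..1}|lborel. G u) = 0"
    using set_borel_integral_eq_integral(2)[OF iG] by simp
  moreover have "(LINT u:{-1..1}|lborel. G u)
    = (LINT u:{-1..1}|lborel. G1 u) - \<alpha> * ((LINT u:{-1..1}|lborel. G2 u) - (LINT u:{-1..1}|lborel. G3 u))"
    unfolding G_def using i1 i2 i3 by (simp add: set_integral_diff)
  ultimately show ?thesis unfolding e1 e2 e3 by simp
qed

section \<open>The product measure\<close>

text \<open>Points of the square are pairs \<open>(v, u)\<close>: the variable of the outer integral comes first.\<close>
definition mu2 :: "real \<Rightarrow> real \<Rightarrow> (real \<times> real) measure" where
  "mu2 \<alpha> \<beta> = mu_meas \<beta> \<Otimes>\<^sub>M mu_meas \<alpha>"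

abbreviation unit_square :: "(real \<times> real) set" where
  "unit_square \<equiv> {-1..1} \<times> {-1..1}"

lemma compact_unit_square: "compact unit_square"
  by (intro compact_Times compact_Icc)

context
  fixes \<alpha> \<beta> :: real
  assumes \<alpha>: "\<alpha> > 0" and \<beta>: "\<beta> > 0"
begin

interpretation A: prob_space "mu_meas \<alpha>" by (rule prob_space_mu_meas[OF \<alpha>])
interpretation B: prob_space "mu_meas \<beta>" by (rule prob_space_mu_meas[OF \<beta>])
interpretation P: pair_prob_space "mu_meas \<beta>" "mu_meas \<alpha>" by unfold_locales

lemma prob_space_mu2: "prob_space (mu2 \<alpha> \<beta>)"
  unfolding mu2_def by (rule P.prob_space_axioms)

lemma sets_mu2: "sets (mu2 \<alpha> \<beta>) = sets borel"
proof -
  have "sets (mu_meas \<beta> \<Otimes>\<^sub>M mu_meas \<alpha>) = sets (borel \<Otimes>\<^sub>M borel)"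
    by (intro sets_pair_measure_cong) auto
  then show ?thesis unfolding mu2_def borel_prod .
qed

lemma AE_mu2: "AE x in mu2 \<alpha> \<beta>. x \<in> unit_square"
  unfolding mu2_def
proof (rule P.AE_pair_measure)
  have "unit_square \<in> sets (mu_meas \<beta> \<Otimes>\<^sub>M mu_meas \<alpha>)"
    by (intro pair_measureI) auto
  then show "{x \<in> space (mu_meas \<beta> \<Otimes>\<^sub>M mu_meas \<alpha>). x \<in> unit_square} \<in> sets (mu_meas \<beta> \<Otimes>\<^sub>M mu_meas \<alpha>)"
    by (simp add: space_pair_measure)
  show "AE x in mu_meas \<beta>. AE y in mu_meas \<alpha>. (x, y) \<in> unit_square"
    using AE_mu_meas[OF \<beta>] AE_mu_meas[OF \<alpha>] by (auto elim!: eventually_mono)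
qed

lemma finite_measure_mu2: "finite_measure (mu2 \<alpha> \<beta>)"
  using prob_space_mu2 prob_space.finite_measure by blast

lemma integrable_mu2: "continuous_on UNIV (g :: real \<times> real \<Rightarrow> real) \<Longrightarrow> integrable (mu2 \<alpha> \<beta>) g"
  by (rule integrable_continuous_AE_compact[OF finite_measure_mu2 sets_mu2 AE_mu2 compact_unit_square])

lemma integral_mu2_fst:
  "continuous_on UNIV (g :: real \<times> real \<Rightarrow> real) \<Longrightarrow>
    (\<integral>x. g x \<partial>mu2 \<alpha> \<beta>) = (\<integral>v. (\<integral>u. g (v, u) \<partial>mu_meas \<alpha>) \<partial>mu_meas \<beta>)"
  using P.integral_fst'[of g] integrable_mu2[of g] unfolding mu2_def by simp

lemma integral_mu2_snd:
  "continuous_on UNIV (g :: real \<times> real \<Rightarrow> real) \<Longrightarrow>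
    (\<integral>x. g x \<partial>mu2 \<alpha> \<beta>) = (\<integral>u. (\<integral>v. g (v, u) \<partial>mu_meas \<beta>) \<partial>mu_meas \<alpha>)"
  using P.integral_snd[of "\<lambda>v u. g (v, u)"] integrable_mu2[of g] unfolding mu2_def by simp

lemma continuous_on_slices:
  fixes g :: "real \<times> real \<Rightarrow> real"
  assumes "continuous_on UNIV g"
  shows "continuous_on UNIV (\<lambda>u. g (v, u))" "continuous_on UNIV (\<lambda>v. g (v, u))"
  by (rule continuous_on_compose2[OF assms]; (auto intro!: continuous_on_Pair continuous_on_const continuous_on_id))+

lemma integrable_slice_integrals:
  fixes g :: "real \<times> real \<Rightarrow> real"
  assumes "continuous_on UNIV g"
  shows "integrable (mu_meas \<beta>) (\<lambda>v. \<integral>u. g (v, u) \<partial>mu_meas \<alpha>)"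
    and "integrable (mu_meas \<alpha>) (\<lambda>u. \<integral>v. g (v, u) \<partial>mu_meas \<beta>)"
  using P.integrable_fst'[of g] P.integrable_snd[of "\<lambda>v u. g (v, u)"] integrable_mu2[OF assms] unfolding mu2_def by auto

lemma integral_by_parts_snd:
  fixes g g' :: "real \<times> real \<Rightarrow> real"
  assumes g: "continuous_on UNIV g" and g': "continuous_on UNIV g'"
    and der: "\<And>v u. ((\<lambda>u. g (v, u)) has_real_derivative g' (v, u)) (at u)"
  shows "(\<integral>x. (1 - snd x) * g' x \<partial>mu2 \<alpha> \<beta>) = \<alpha> * ((\<integral>x. g x \<partial>mu2 \<alpha> \<beta>) - (\<integral>x. g (fst x, - snd x) \<partial>mu2 \<alpha> \<beta>))"
proof -
  have c1: "continuous_on UNIV (\<lambda>x. (1 - snd x) * g' x)" using g' by (intro continuous_intros)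
  have c2: "continuous_on UNIV (\<lambda>x. g (fst x, - snd x))"
    by (rule continuous_on_compose2[OF g]) (auto intro!: continuous_intros)
  have "(\<integral>u. (1 - snd (v, u)) * g' (v, u) \<partial>mu_meas \<alpha>)
      = \<alpha> * ((\<integral>u. g (v, u) \<partial>mu_meas \<alpha>) - (\<integral>u. g (fst (v, u), - snd (v, u)) \<partial>mu_meas \<alpha>))" for v
    using integral_by_parts_mu[OF \<alpha>, of "\<lambda>u. g (v, u)" "\<lambda>u. g' (v, u)"] der continuous_on_slices[OF g'] by simp
  then show ?thesis
    unfolding integral_mu2_fst[OF c1] integral_mu2_fst[OF c2] integral_mu2_fst[OF g]
    using integrable_slice_integrals(1)[OF g] integrable_slice_integrals(1)[OF c2] by simp
qed

lemma integral_by_parts_fst: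
  fixes g g' :: "real \<times> real \<Rightarrow> real"
  assumes g: "continuous_on UNIV g" and g': "continuous_on UNIV g'"
    and der: "\<And>v u. ((\<lambda>v. g (v, u)) has_real_derivative g' (v, u)) (at v)"
  shows "(\<integral>x. (1 - fst x) * g' x \<partial>mu2 \<alpha> \<beta>) = \<beta> * ((\<integral>x. g x \<partial>mu2 \<alpha> \<beta>) - (\<integral>x. g (- fst x, snd x) \<partial>mu2 \<alpha> \<beta>))"
proof -
  have c1: "continuous_on UNIV (\<lambda>x. (1 - fst x) * g' x)" using g' by (intro continuous_intros)
  have c2: "continuous_on UNIV (\<lambda>x. g (- fst x, snd x))"
    by (rule continuous_on_compose2[OF g]) (auto intro!: continuous_intros)
  have "(\<integral>v. (1 - fst (v, u)) * g' (v, u) \<partial>mu_meas \<beta>)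
      = \<beta> * ((\<integral>v. g (v, u) \<partial>mu_meas \<beta>) - (\<integral>v. g (- fst (v, u), snd (v, u)) \<partial>mu_meas \<beta>))" for u
    using integral_by_parts_mu[OF \<beta>, of "\<lambda>v. g (v, u)" "\<lambda>v. g' (v, u)"] der continuous_on_slices[OF g'] by simp
  then show ?thesis
    unfolding integral_mu2_snd[OF c1] integral_mu2_snd[OF c2] integral_mu2_snd[OF g]
    using integrable_slice_integrals(2)[OF g] integrable_slice_integrals(2)[OF c2] by simp
qed

end

definition fps_lint :: "'a measure \<Rightarrow> ('a \<Rightarrow> real fps) \<Rightarrow> real fps" where
  "fps_lint M f = Abs_fps (\<lambda>n. \<integral>t. f t $ n \<partial>M)"

lemma fps_lint_nth [simp]: "fps_lint M f $ n = (\<integral>t. f t $ n \<partial>M)"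
  by (simp add: fps_lint_def)

lemma fps_lint_mult:
  assumes "\<And>n. integrable M (\<lambda>t. f t $ n)"
  shows "fps_lint M (\<lambda>t. A * f t) = A * fps_lint M f"
  using assms by (intro fps_ext) (simp add: fps_mult_nth Bochner_Integration.integral_sum)

lemma fps_lint_add:
  assumes "\<And>n. integrable M (\<lambda>t. f t $ n)" "\<And>n. integrable M (\<lambda>t. g t $ n)"
  shows "fps_lint M (\<lambda>t. f t + g t) = fps_lint M f + fps_lint M g"
  using assms by (intro fps_ext) simp

lemma fps_lint_diff:
  assumes "\<And>n. integrable M (\<lambda>t. f t $ n)" "\<And>n. integrable M (\<lambda>t. g t $ n)"
  shows "fps_lint M (\<lambda>t. f t - g t) = fps_lint M f - fps_lint M g"
  using assms by (intro fps_ext) simp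

lemma fps_deriv_fps_lint: "fps_deriv (fps_lint M f) = fps_lint M (\<lambda>t. fps_deriv (f t))"
  by (rule fps_ext) simp

text \<open>Agreement of \<open>F\<close> and \<open>f\<close> is asked on the square only. Outside
  it the arccosine in \<open>q_uv\<close> is uncontrolled, so the integrands of the theorem are
  matched there with nothing, and inside with integrable series.\<close>

lemma integral_mu2_iterated:
  fixes f :: "real \<times> real \<Rightarrow> real"
  assumes \<alpha>: "\<alpha> > 0" and \<beta>: "\<beta> > 0" and f: "integrable (mu2 \<alpha> \<beta>) f"
    and eq: "\<And>u v. u \<in> {-1..1} \<Longrightarrow> v \<in> {-1..1} \<Longrightarrow> F u v = f (v, u)"
  shows "(LINT v:{-1..1}|lborel. (LINT u:{-1..1}|lborel. F u v * mu_dens \<alpha> u) * mu_dens \<beta> v) = (\<integral>x. f x \<partial>mu2 \<alpha> \<beta>)"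
proof -
  interpret A: prob_space "mu_meas \<alpha>" by (rule prob_space_mu_meas[OF \<alpha>])
  interpret B: prob_space "mu_meas \<beta>" by (rule prob_space_mu_meas[OF \<beta>])
  interpret P: pair_prob_space "mu_meas \<beta>" "mu_meas \<alpha>" by unfold_locales
  have f': "integrable (mu_meas \<beta> \<Otimes>\<^sub>M mu_meas \<alpha>) f" using f unfolding mu2_def .
  have "(\<lambda>u. f (v, u)) \<in> borel_measurable (mu_meas \<alpha>)" for v
    using measurable_Pair2[OF borel_measurable_integrable[OF f']] by simp
  then have slice: "(\<lambda>u. f (v, u)) \<in> borel_measurable borel" for v
    by (simp add: measurable_cong_sets[OF sets_mu_meas refl])
  have "(\<lambda>v. \<integral>u. f (v, u) \<partial>mu_meas \<alpha>) \<in> borel_measurable (mu_meas \<beta>)"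
    by (rule borel_measurable_integrable[OF P.integrable_fst'[OF f']])
  then have outer: "(\<lambda>v. \<integral>u. f (v, u) \<partial>mu_meas \<alpha>) \<in> borel_measurable borel"
    by (simp add: measurable_cong_sets[OF sets_mu_meas refl])
  have "(\<integral>x. f x \<partial>mu2 \<alpha> \<beta>) = (\<integral>v. (\<integral>u. f (v, u) \<partial>mu_meas \<alpha>) \<partial>mu_meas \<beta>)"
    unfolding mu2_def by (rule P.integral_fst'[OF f', symmetric])
  also have "\<dots> = (LINT v:{-1..1}|lborel. (\<integral>u. f (v, u) \<partial>mu_meas \<alpha>) * mu_dens \<beta> v)"
    by (rule integral_mu_meas[OF \<beta> outer])
  also have "\<dots> = (LINT v:{-1..1}|lborel. (LINT u:{-1..1}|lborel. f (v, u) * mu_dens \<alpha> u) * mu_dens \<beta> v)"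
    unfolding integral_mu_meas[OF \<alpha> slice] ..
  also have "\<dots> = (LINT v:{-1..1}|lborel. (LINT u:{-1..1}|lborel. F u v * mu_dens \<alpha> u) * mu_dens \<beta> v)"
  proof (rule set_lebesgue_integral_cong; (intro allI impI)?)
    fix v :: real assume v: "v \<in> {-1..1}"
    have "(LINT u:{-1..1}|lborel. f (v, u) * mu_dens \<alpha> u) = (LINT u:{-1..1}|lborel. F u v * mu_dens \<alpha> u)"
      by (rule set_lebesgue_integral_cong) (use eq v in auto)
    then show "(LINT u:{-1..1}|lborel. f (v, u) * mu_dens \<alpha> u) * mu_dens \<beta> v
      = (LINT u:{-1..1}|lborel. F u v * mu_dens \<alpha> u) * mu_dens \<beta> v" by simp
  qed simp
  finally show ?thesis by simp
qed

section \<open>The generating series\<close>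

lemma fps_prod_nth_0_eq_1:
  assumes "\<And>i. i \<in> S \<Longrightarrow> (f i :: real fps) $ 0 = 1"
  shows "prod f S $ 0 = 1"
  using assms by (induction S rule: infinite_finite_induct) auto

text \<open>This eliminates \<open>Arg\<close>: the trigonometric terms of the theorem, once
  multiplied by \<open>|z|^k\<close>, become polynomials in Re z and Im z.\<close>

lemma Re_Im_power_polar:
  "Re (z ^ k) = cmod z ^ k * cos (real k * Arg z)" "Im (z ^ k) = cmod z ^ k * sin (real k * Arg z)"
proof -
  have "z ^ k = rcis (cmod z ^ k) (real k * Arg z)"
    by (subst rcis_cmod_Arg[of z, symmetric]) (rule DeMoivre2)
  then show "Re (z ^ k) = cmod z ^ k * cos (real k * Arg z)" "Im (z ^ k) = cmod z ^ k * sin (real k * Arg z)"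
    by auto
qed

locale dihedral_kernel =
  fixes k :: nat and \<alpha> \<beta> :: real and w :: complex
  assumes k: "k \<ge> 1" and \<alpha>: "\<alpha> > 0" and \<beta>: "\<beta> > 0"
begin

abbreviation "g \<equiv> \<alpha> + \<beta>"

abbreviation "\<mu> \<equiv> mu2 \<alpha> \<beta>"

text \<open>\<open>pX\<close>, \<open>qX\<close>, \<open>PP\<close>, \<open>FF\<close>, \<open>MM\<close>, \<open>JJ\<close> are \<open>p\<close>, \<open>q\<close>, \<open>P\<close>, \<open>F\<close>, \<open>M\<close>, \<open>J\<close> of the introduction and \<open>AA\<close> is
  \<open>1 - a\<^sub>k X\<close>. Primed constants are derivatives in \<open>z\<close>, with the direction as second argument.\<close>
definition pX :: "complex \<Rightarrow> real fps" where
  "pX z = fps_const (2 / 2 ^ k * Re (z ^ k) * Re (w ^ k)) * fps_X ^ k"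

definition qX :: "complex \<Rightarrow> real fps" where
  "qX z = fps_const (2 / 2 ^ k * Im (z ^ k) * Im (w ^ k)) * fps_X ^ k"

definition PP :: "complex \<Rightarrow> real fps" where
  "PP z = chebP k (cmod z * cmod w)"

definition FF :: "complex \<Rightarrow> real \<times> real \<Rightarrow> real fps" where
  "FF z x = PP z - fps_const (fst x) * pX z - fps_const (snd x) * qX z"

definition rot :: "nat \<Rightarrow> complex \<Rightarrow> complex" where
  "rot j z = cis (2 * pi * real j / real k) * z"

definition AA :: "complex \<Rightarrow> real fps" where
  "AA z = lin (cinner z w)"

text \<open>The value of \<open>F\<close> at \<open>u = v = 1\<close>, written as a product over the
  rotations so that it is visibly polynomial in Re z and Im z.\<close>

definition DD :: "complex \<Rightarrow> real fps" where
  "DD z = (\<Prod>j<k. AA (rot j z))"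

definition MM :: "complex \<Rightarrow> real fps" where
  "MM z = (\<Prod>j\<in>{1..<k}. AA (rot j z))"

lemma norm_rot [simp]: "cmod (rot j z) = cmod z"
  by (simp add: rot_def norm_mult)

lemma rot_0 [simp]: "rot 0 z = z"
  by (simp add: rot_def)

lemma rot_power: "rot j z ^ k = z ^ k"
proof -
  have "cis (2 * pi * real j / real k) ^ k = cis (2 * pi * real j)"
    using k by (simp add: Complex.DeMoivre)
  then show ?thesis by (simp add: rot_def power_mult_distrib)
qed

lemma AA_nth_0 [simp]: "AA z $ 0 = 1"
  by (simp add: AA_def)

lemma AA_neq_0 [simp]: "AA z \<noteq> 0"
  using AA_nth_0[of z] by (metis fps_zero_nth zero_neq_one)

lemma AA_MM: "AA z * MM z = DD z"
proof -
  have "{..<k} = insert 0 {1..<k}" using k by auto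
  then show ?thesis by (simp add: DD_def MM_def)
qed

lemma cinner_rot:
  "cinner (rot j z) w = cmod z * cmod w * cos ((real k * (Arg z - Arg w) + 2 * pi * real j) / real k)"
proof -
  have "rot j z * cnj w = rcis 1 (2 * pi * real j / real k) * rcis (cmod z) (Arg z) * cnj (rcis (cmod w) (Arg w))"
    unfolding rot_def rcis_cmod_Arg by (simp add: rcis_def)
  also have "\<dots> = rcis (cmod z * cmod w) (2 * pi * real j / real k + Arg z - Arg w)"
    by (simp add: rcis_def cis_cnj cis_mult algebra_simps)
  also have "2 * pi * real j / real k + Arg z - Arg w = (real k * (Arg z - Arg w) + 2 * pi * real j) / real k"
    using k by (simp add: field_simps)
  finally show ?thesis by (simp add: cinner_def)
qed

text \<open>This is \<open>prod_lin_cos\<close> with \<open>t = k (Arg z - Arg w)\<close>; the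
  addition theorem for the cosine splits the correction into \<open>p + q\<close>.\<close>

lemma DD_eq: "DD z = PP z - pX z - qX z"
proof -
  have "DD z = PP z - fps_const (2 / 2 ^ k * (cmod z * cmod w) ^ k * cos (real k * (Arg z - Arg w))) * fps_X ^ k"
    unfolding DD_def AA_def cinner_rot PP_def by (rule prod_lin_cos[OF k])
  also have "2 / 2 ^ k * (cmod z * cmod w) ^ k * cos (real k * (Arg z - Arg w))
     = 2 / 2 ^ k * Re (z ^ k) * Re (w ^ k) + 2 / 2 ^ k * Im (z ^ k) * Im (w ^ k)"
    unfolding Re_Im_power_polar right_diff_distrib cos_diff
    by (simp add: power_mult_distrib algebra_simps)
  also have "fps_const (2 / 2 ^ k * Re (z ^ k) * Re (w ^ k) + 2 / 2 ^ k * Im (z ^ k) * Im (w ^ k)) * fps_X ^ k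
     = pX z + qX z"
    unfolding fps_const_add[symmetric] distrib_right pX_def qX_def ..
  finally show ?thesis by (simp add: algebra_simps)
qed

lemma FF_eq_DD: "FF z x = DD z + fps_const (1 - fst x) * pX z + fps_const (1 - snd x) * qX z"
  unfolding FF_def DD_eq by (simp add: algebra_simps flip: fps_const_sub)

lemma xi_uv_bounded:
  assumes "u \<in> {-1..1}" "v \<in> {-1..1}"
  shows "\<bar>xi_uv u v a b\<bar> \<le> 1"
proof -
  have "\<bar>xi_uv u v a b\<bar> \<le> \<bar>v\<bar> * \<bar>cos a * cos b\<bar> + \<bar>u\<bar> * \<bar>sin a * sin b\<bar>"
    unfolding xi_uv_def by (rule order.trans[OF abs_triangle_ineq]) (simp add: abs_mult mult.assoc)
  also have "\<dots> \<le> 1 * \<bar>cos a * cos b\<bar> + 1 * \<bar>sin a * sin b\<bar>"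
    using assms by (intro add_mono mult_right_mono) auto
  also have "\<dots> \<le> 1"
  proof -
    \<comment> \<open>Depending on the signs of the two products, their absolute values add up to
      one or the other.\<close>
    have "\<bar>cos a * cos b\<bar> + \<bar>sin a * sin b\<bar> = \<bar>cos (a + b)\<bar> \<or> \<bar>cos a * cos b\<bar> + \<bar>sin a * sin b\<bar> = \<bar>cos (a - b)\<bar>"
      unfolding cos_add cos_diff by linarith
    then show ?thesis using abs_cos_le_one[of "a + b"] abs_cos_le_one[of "a - b"] by auto
  qed
  finally show ?thesis .
qed

text \<open>The other special case of \<open>prod_lin_cos\<close>, with \<open>t = q_uv\<close>. On
  the square the argument of the arccosine lies in \<open>[-1, 1]\<close>, so \<open>cos t\<close>
  is \<open>xi_uv\<close>.\<close>

lemma FF_prod: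
  assumes "u \<in> {-1..1}" "v \<in> {-1..1}"
  shows "FF z (v, u) = (\<Prod>j<k. lin (a_coef k z w u v j))"
proof -
  let ?q = "q_uv u v (real k * Arg z) (real k * Arg w)"
  have "(\<Prod>j<k. lin (a_coef k z w u v j))
      = (\<Prod>j<k. lin (cmod z * cmod w * cos ((?q + 2 * pi * real j) / real k)))"
    by (intro prod.cong refl) (simp add: a_coef_def)
  also have "\<dots> = PP z - fps_const (2 / 2 ^ k * (cmod z * cmod w) ^ k * cos ?q) * fps_X ^ k"
    unfolding PP_def by (rule prod_lin_cos[OF k])
  also have "cos ?q = xi_uv u v (real k * Arg z) (real k * Arg w)"
    using xi_uv_bounded[OF assms] unfolding q_uv_def by (simp add: abs_le_iff cos_arccos minus_le_iff)
  also have "2 / 2 ^ k * (cmod z * cmod w) ^ k * xi_uv u v (real k * Arg z) (real k * Arg w)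
    = v * (2 / 2 ^ k * Re (z ^ k) * Re (w ^ k)) + u * (2 / 2 ^ k * Im (z ^ k) * Im (w ^ k))"
    unfolding Re_Im_power_polar xi_uv_def by (simp add: power_mult_distrib algebra_simps)
  also have "fps_const (v * (2 / 2 ^ k * Re (z ^ k) * Re (w ^ k)) + u * (2 / 2 ^ k * Im (z ^ k) * Im (w ^ k))) * fps_X ^ k
    = fps_const v * pX z + fps_const u * qX z"
    unfolding fps_const_add[symmetric] fps_const_mult[of v, symmetric] fps_const_mult[of u, symmetric]
      distrib_right pX_def qX_def mult.assoc ..
  finally show ?thesis by (simp add: FF_def algebra_simps)
qed

lemma pX_nth_0 [simp]: "pX z $ 0 = 0" and qX_nth_0 [simp]: "qX z $ 0 = 0"
  using k by (auto simp: pX_def qX_def)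

lemma DD_nth_0 [simp]: "DD z $ 0 = 1"
  unfolding DD_def by (rule fps_prod_nth_0_eq_1) simp

lemma FF_nth_0 [simp]: "FF z x $ 0 = 1"
  unfolding FF_eq_DD by simp

text \<open>\<open>PP\<close> is defined through \<open>|z|\<close>, which is not differentiable at
  0. Read in this form its coefficients are polynomials in Re z and Im z; \<open>PP'\<close> below
  is defined accordingly.\<close>

lemma PP_eq: "PP z = DD z + pX z + qX z"
  unfolding DD_eq by simp

lemma DD_rot: "DD (rot j z) = DD z"
  unfolding DD_eq PP_def pX_def qX_def by (simp add: rot_power)

section \<open>Derivatives in \<open>z\<close> and continuity of the factors\<close>

definition DD' :: "complex \<Rightarrow> complex \<Rightarrow> real fps" where
  "DD' z h = - (\<Sum>i<k. fps_const (cinner (rot i h) w) * fps_X * MM (rot i z))"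

definition pX' :: "complex \<Rightarrow> complex \<Rightarrow> real fps" where
  "pX' z h = fps_const (2 / 2 ^ k * Re (of_nat k * z ^ (k - 1) * h) * Re (w ^ k)) * fps_X ^ k"

definition qX' :: "complex \<Rightarrow> complex \<Rightarrow> real fps" where
  "qX' z h = fps_const (2 / 2 ^ k * Im (of_nat k * z ^ (k - 1) * h) * Im (w ^ k)) * fps_X ^ k"

definition PP' :: "complex \<Rightarrow> complex \<Rightarrow> real fps" where
  "PP' z h = DD' z h + pX' z h + qX' z h"

definition FF' :: "complex \<Rightarrow> complex \<Rightarrow> real \<times> real \<Rightarrow> real fps" where
  "FF' z h x = PP' z h - fps_const (fst x) * pX' z h - fps_const (snd x) * qX' z h"

lemma AA_has_derivative:
  "fps_has_derivative (\<lambda>z. AA (rot i z)) (\<lambda>h. - (fps_const (cinner (rot i h) w) * fps_X)) z"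
proof -
  have "((\<lambda>z. cinner (rot i z) w) has_derivative (\<lambda>h. cinner (rot i h) w)) (at z)"
    unfolding cinner_def rot_def by (auto intro!: derivative_eq_intros)
  from fps_has_derivative_diff[OF fps_has_derivative_const
      fps_has_derivative_mult[OF fps_has_derivative_fps_const[OF this] fps_has_derivative_const]]
  show ?thesis unfolding AA_def by simp
qed

lemma DD_has_derivative: "fps_has_derivative DD (DD' z) z"
proof -
  have "fps_has_derivative DD (\<lambda>h. \<Sum>i<k. - (fps_const (cinner (rot i h) w) * fps_X) *
      (\<Prod>j\<in>{..<k} - {i}. AA (rot j z))) z"
    unfolding DD_def by (rule fps_has_derivative_prod) (auto intro: AA_has_derivative)
  \<comment> \<open>\<open>DD\<close> is invariant under rotations, so both sides are
    \<open>DD z\<close> divided by \<open>AA (rot i z)\<close>.\<close>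
  moreover have "(\<Prod>j\<in>{..<k} - {i}. AA (rot j z)) = MM (rot i z)" if "i < k" for i
  proof -
    have "AA (rot i z) * (\<Prod>j\<in>{..<k} - {i}. AA (rot j z)) = DD z"
      unfolding DD_def using that by (simp add: prod.remove)
    also have "\<dots> = AA (rot i z) * MM (rot i z)" unfolding AA_MM DD_rot ..
    finally show ?thesis by simp
  qed
  ultimately show ?thesis unfolding DD'_def by (simp add: sum_negf)
qed

lemma power_has_derivative:
  "((\<lambda>z. z ^ k) has_derivative (\<lambda>h. of_nat k * z ^ (k - 1) * h)) (at (z :: complex))"
  by (auto intro!: derivative_eq_intros)

lemma pX_has_derivative: "fps_has_derivative pX (pX' z) z"
proof -
  have "((\<lambda>z. 2 / 2 ^ k * Re (z ^ k) * Re (w ^ k)) has_derivative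
      (\<lambda>h. 2 / 2 ^ k * Re (of_nat k * z ^ (k - 1) * h) * Re (w ^ k))) (at z)"
    by (intro has_derivative_mult_left has_derivative_mult_right has_derivative_Re power_has_derivative)
  from fps_has_derivative_mult[OF fps_has_derivative_fps_const[OF this] fps_has_derivative_const]
  show ?thesis unfolding pX_def pX'_def by simp
qed

lemma qX_has_derivative: "fps_has_derivative qX (qX' z) z"
proof -
  have "((\<lambda>z. 2 / 2 ^ k * Im (z ^ k) * Im (w ^ k)) has_derivative
      (\<lambda>h. 2 / 2 ^ k * Im (of_nat k * z ^ (k - 1) * h) * Im (w ^ k))) (at z)"
    by (intro has_derivative_mult_left has_derivative_mult_right has_derivative_Im power_has_derivative)
  from fps_has_derivative_mult[OF fps_has_derivative_fps_const[OF this] fps_has_derivative_const]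
  show ?thesis unfolding qX_def qX'_def by simp
qed

lemma PP_has_derivative: "fps_has_derivative PP (PP' z) z"
  unfolding PP_eq[abs_def] PP'_def
  by (intro fps_has_derivative_add DD_has_derivative pX_has_derivative qX_has_derivative)

lemma FF_has_derivative: "fps_has_derivative (\<lambda>z. FF z x) (\<lambda>h. FF' z h x) z"
proof -
  have sc: "fps_has_derivative (\<lambda>z. fps_const c * f z) (\<lambda>h. fps_const c * f' h) z"
    if "fps_has_derivative f f' z" for c f f'
    using fps_has_derivative_mult[OF fps_has_derivative_const that] by simp
  show ?thesis unfolding FF_def FF'_def
    by (intro fps_has_derivative_diff sc PP_has_derivative pX_has_derivative qX_has_derivative)
qed

lemma AA_continuous: "continuous_on S f \<Longrightarrow> fps_continuous_on S (\<lambda>x. AA (f x))"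
  unfolding AA_def cinner_def by (intro fps_continuous_intros continuous_intros)

lemma rot_continuous: "continuous_on S f \<Longrightarrow> continuous_on S (\<lambda>x. rot i (f x))"
  unfolding rot_def by (intro continuous_intros)

lemma MM_continuous: "continuous_on S f \<Longrightarrow> fps_continuous_on S (\<lambda>x. MM (f x))"
  unfolding MM_def by (intro fps_continuous_intros AA_continuous rot_continuous)

lemma pqP_continuous:
  assumes "continuous_on S f"
  shows "fps_continuous_on S (\<lambda>x. pX (f x))" "fps_continuous_on S (\<lambda>x. qX (f x))"
    "fps_continuous_on S (\<lambda>x. PP (f x))"
    "fps_continuous_on S (\<lambda>x. pX' (f x) h)" "fps_continuous_on S (\<lambda>x. qX' (f x) h)"
    "fps_continuous_on S (\<lambda>x. PP' (f x) h)"
  unfolding PP_eq PP'_def DD_def DD'_def pX_def qX_def pX'_def qX'_def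
  by (intro fps_continuous_intros continuous_intros AA_continuous MM_continuous rot_continuous assms)+

lemma FF_continuous:
  assumes "continuous_on S f" "continuous_on S h"
  shows "fps_continuous_on S (\<lambda>x. FF (f x) (h x))" "fps_continuous_on S (\<lambda>x. FF' (f x) \<xi> (h x))"
  unfolding FF_def FF'_def
  by (intro fps_continuous_intros pqP_continuous continuous_on_fst continuous_on_snd assms)+

section \<open>Weighted integrals of powers of \<open>F\<close> over the square\<close>

definition GG :: "(real \<times> real \<Rightarrow> real) \<Rightarrow> real \<Rightarrow> complex \<Rightarrow> real fps" where
  "GG a c z = fps_lint \<mu> (\<lambda>x. fps_const (a x) * fpow c (FF z x))"

lemma GG_integrand_continuous:
  assumes "continuous_on UNIV a"
  shows "fps_continuous_on UNIV (\<lambda>x. fps_const (a x) * fpow c (FF z x))"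
  using assms by (intro fps_continuous_intros FF_continuous continuous_on_const continuous_on_id)

lemma integrable_coeffs: "fps_continuous_on UNIV f \<Longrightarrow> integrable \<mu> (\<lambda>x. f x $ n)"
  unfolding fps_continuous_on_def by (intro integrable_mu2[OF \<alpha> \<beta>]) auto

lemmas GG_integrable = integrable_coeffs[OF GG_integrand_continuous]

text \<open>\<open>F\<close>, its derivative in \<open>X\<close> and its derivatives in
  \<open>z\<close> all have the shape \<open>A - v B - u C\<close>. This one formula therefore gives
  the recurrence in the exponent and both kinds of derivative.\<close>

lemma GG_linear_combination:
  assumes "continuous_on UNIV a"
  shows "fps_lint \<mu> (\<lambda>x. fps_const (a x) * (fps_const r * fpow c (FF z x)
       * (A - fps_const (fst x) * B - fps_const (snd x) * C)))
   = fps_const r * (A * GG a c z - B * GG (\<lambda>x. fst x * a x) c z - C * GG (\<lambda>x. snd x * a x) c z)"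
proof -
  have c: "continuous_on UNIV (\<lambda>x::real\<times>real. fst x * a x)" "continuous_on UNIV (\<lambda>x::real\<times>real. snd x * a x)"
    using assms by (auto intro!: continuous_intros)
  define T where "T = (\<lambda>b x. fps_const (b x) * fpow c (FF z x))"
  have ic: "fps_continuous_on UNIV (\<lambda>x. D * T b x)" if "continuous_on UNIV b" for D b
    unfolding T_def using that by (intro fps_continuous_on_mult fps_continuous_on_const GG_integrand_continuous)
  have int: "fps_lint \<mu> (\<lambda>x. D * T b x) = D * GG b c z" if "continuous_on UNIV b" for D b
    unfolding T_def GG_def by (intro fps_lint_mult GG_integrable that)
  note ii = integrable_coeffs fps_continuous_on_diff ic assms c
  have comb: "fps_lint \<mu> (\<lambda>x. U * T a x - V * T (\<lambda>x. fst x * a x) x - W * T (\<lambda>x. snd x * a x) x)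
     = U * GG a c z - V * GG (\<lambda>x. fst x * a x) c z - W * GG (\<lambda>x. snd x * a x) c z" for U V W
    unfolding int[OF assms, symmetric] int[OF c(1), symmetric] int[OF c(2), symmetric]
  proof -
    have "fps_lint \<mu> (\<lambda>x. U * T a x - V * T (\<lambda>x. fst x * a x) x - W * T (\<lambda>x. snd x * a x) x)
     = fps_lint \<mu> (\<lambda>x. U * T a x - V * T (\<lambda>x. fst x * a x) x)
       - fps_lint \<mu> (\<lambda>x. W * T (\<lambda>x. snd x * a x) x)"
      by (rule fps_lint_diff) (intro ii)+
    also have "fps_lint \<mu> (\<lambda>x. U * T a x - V * T (\<lambda>x. fst x * a x) x)
       = fps_lint \<mu> (\<lambda>x. U * T a x) - fps_lint \<mu> (\<lambda>x. V * T (\<lambda>x. fst x * a x) x)"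
      by (rule fps_lint_diff) (intro ii)+
    finally show "fps_lint \<mu> (\<lambda>x. U * T a x - V * T (\<lambda>x. fst x * a x) x - W * T (\<lambda>x. snd x * a x) x)
      = fps_lint \<mu> (\<lambda>x. U * T a x) - fps_lint \<mu> (\<lambda>x. V * T (\<lambda>x. fst x * a x) x)
       - fps_lint \<mu> (\<lambda>x. W * T (\<lambda>x. snd x * a x) x)" .
  qed
  have eq: "fps_const (a x) * (fps_const r * fpow c (FF z x) * (A - fps_const (fst x) * B - fps_const (snd x) * C))
    = (fps_const r * A) * T a x - (fps_const r * B) * T (\<lambda>x. fst x * a x) x
      - (fps_const r * C) * T (\<lambda>x. snd x * a x) x" for x
    unfolding T_def fps_const_mult[symmetric] by (simp only: algebra_simps)
  show ?thesis
    unfolding eq comb by (simp only: right_diff_distrib mult.assoc)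
qed

lemma GG_recurrence:
  assumes "continuous_on UNIV a"
  shows "GG a c z = PP z * GG a (c - 1) z - pX z * GG (\<lambda>x. fst x * a x) (c - 1) z
       - qX z * GG (\<lambda>x. snd x * a x) (c - 1) z"
proof -
  have "fpow c (FF z x) = fps_const 1 * fpow (c - 1) (FF z x) * (PP z - fps_const (fst x) * pX z - fps_const (snd x) * qX z)" for x
    using fpow_shift[OF FF_nth_0[of z x], of "c - 1"] unfolding FF_def by (simp add: mult.commute)
  then show ?thesis unfolding GG_def[of a c] using GG_linear_combination[OF assms, of 1 "c - 1" z "PP z" "pX z" "qX z"]
    by simp
qed

lemma fps_deriv_GG:
  assumes "continuous_on UNIV a"
  shows "fps_deriv (GG a c z) = fps_const c * (fps_deriv (PP z) * GG a (c - 1) z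
     - fps_deriv (pX z) * GG (\<lambda>x. fst x * a x) (c - 1) z - fps_deriv (qX z) * GG (\<lambda>x. snd x * a x) (c - 1) z)"
proof -
  have "fps_deriv (FF z x) = fps_deriv (PP z) - fps_const (fst x) * fps_deriv (pX z) - fps_const (snd x) * fps_deriv (qX z)" for x
    unfolding FF_def by simp
  then show ?thesis
    unfolding GG_def[of a c] fps_deriv_fps_lint
    by (simp add: fps_deriv_fpow GG_linear_combination[OF assms])
qed

lemma GG_has_derivative:
  assumes "continuous_on UNIV a"
  shows "fps_has_derivative (GG a c) (\<lambda>h. fps_const c * (PP' z h * GG a (c - 1) z
     - pX' z h * GG (\<lambda>x. fst x * a x) (c - 1) z - qX' z h * GG (\<lambda>x. snd x * a x) (c - 1) z)) z"
proof -
  let ?f' = "\<lambda>z h x. fps_const (a x) * (fps_const c * fpow (c - 1) (FF z x) * FF' z h x)"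
  have d: "fps_has_derivative (\<lambda>z. fps_const (a x) * fpow c (FF z x)) (\<lambda>h. ?f' z h x) z" for x z
    using fps_has_derivative_mult[OF fps_has_derivative_const fps_has_derivative_fpow[OF FF_has_derivative]]
    by simp
  have "fps_has_derivative (GG a c) (\<lambda>h. fps_lint \<mu> (?f' z h)) z"
    unfolding fps_has_derivative_def GG_def fps_lint_nth
  proof (intro allI has_derivative_integral_compact[where K = unit_square and f' = "\<lambda>z h x. ?f' z h x $ n" for n]
      finite_measure_mu2 sets_mu2 AE_mu2 compact_unit_square \<alpha> \<beta>)
    show "((\<lambda>z. (fps_const (a x) * fpow c (FF z x)) $ n) has_derivative (\<lambda>h. ?f' z h x $ n)) (at z)" for n z x
      using d unfolding fps_has_derivative_def by blast
    show "continuous_on UNIV (\<lambda>x. (fps_const (a x) * fpow c (FF z x)) $ n)" for n z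
      using GG_integrand_continuous[OF assms] unfolding fps_continuous_on_def by blast
    show "continuous_on UNIV (\<lambda>(z, x). ?f' z h x $ n)" for n h
    proof -
      have "continuous_on UNIV (\<lambda>p::complex \<times> real \<times> real. a (snd p))"
        by (rule continuous_on_compose2[OF assms]) (auto intro!: continuous_intros)
      then have "fps_continuous_on UNIV (\<lambda>p. ?f' (fst p) h (snd p))"
        by (intro fps_continuous_intros FF_continuous continuous_intros)
      then show ?thesis unfolding fps_continuous_on_def by (simp add: case_prod_unfold)
    qed
  qed
  moreover have "fps_lint \<mu> (?f' z h) = fps_const c * (PP' z h * GG a (c - 1) z
     - pX' z h * GG (\<lambda>x. fst x * a x) (c - 1) z - qX' z h * GG (\<lambda>x. snd x * a x) (c - 1) z)" for h
    unfolding FF'_def by (rule GG_linear_combination[OF assms])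
  ultimately show ?thesis by simp
qed

lemma GG_diff:
  assumes "continuous_on UNIV a" "continuous_on UNIV b"
  shows "GG (\<lambda>x. a x - b x) c z = GG a c z - GG b c z"
  unfolding GG_def using assms
  by (subst fps_lint_diff[symmetric]) (auto simp: GG_integrable left_diff_distrib simp flip: fps_const_sub
      simp del: fps_mult_left_const_nth)

definition JJ :: "complex \<Rightarrow> real fps" where
  "JJ z = GG (\<lambda>x. 1) (- g - 1) z"

definition II :: "complex \<Rightarrow> real fps" where
  "II z = fps_const (g + 1) * GG (\<lambda>x. 1) (- g - 2) z"

text \<open>Differentiating \<open>J\<close> produces integrals of \<open>F^(-g-2)\<close> with the
  weights 1, \<open>v\<close>, \<open>u\<close> and the factor \<open>g + 1\<close>. The weights
  \<open>1 - v\<close> here and \<open>1 - u\<close> in \<open>Ke\<close> replace the last two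
  because integration by parts yields exactly these; they belong to the odd and to the even
  reflections.\<close>

definition Ko :: "complex \<Rightarrow> real fps" where
  "Ko z = fps_const (g + 1) * GG (\<lambda>x. 1 - fst x) (- g - 2) z"

definition Ke :: "complex \<Rightarrow> real fps" where
  "Ke z = fps_const (g + 1) * GG (\<lambda>x. 1 - snd x) (- g - 2) z"

lemma GG_fst_snd:
  "fps_const (g + 1) * GG (\<lambda>x. fst x * 1) (- g - 2) z = II z - Ko z"
  "fps_const (g + 1) * GG (\<lambda>x. snd x * 1) (- g - 2) z = II z - Ke z"
  unfolding II_def Ko_def Ke_def
  by (subst GG_diff; (auto intro!: continuous_intros simp: algebra_simps))+

text \<open>The integrated form of \<open>F = D + (1 - v) p + (1 - u) q\<close>, after
  multiplication by \<open>(g + 1) F^(-g-2)\<close>.\<close>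

lemma JJ_recurrence: "fps_const (g + 1) * JJ z = DD z * II z + pX z * Ko z + qX z * Ke z"
proof -
  have "fps_const (g + 1) * JJ z = PP z * II z - pX z * (fps_const (g + 1) * GG (\<lambda>x. fst x * 1) (- g - 2) z)
     - qX z * (fps_const (g + 1) * GG (\<lambda>x. snd x * 1) (- g - 2) z)"
  proof -
    have e: "- g - 1 - 1 = - g - 2" by simp
    have alg: "C * (A * G0 - B * G1 - D * G2) = A * (C * G0) - B * (C * G1) - D * (C * G2)"
      for A B C D G0 G1 G2 :: "real fps" by (simp add: algebra_simps)
    show ?thesis
      unfolding JJ_def II_def GG_recurrence[OF continuous_on_const, of 1 "- g - 1" z] e by (rule alg)
  qed
  then show ?thesis unfolding GG_fst_snd DD_eq by (simp add: algebra_simps)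
qed

lemma fps_deriv_JJ:
  "fps_deriv (JJ z) = - II z * fps_deriv (PP z) + (II z - Ko z) * fps_deriv (pX z) + (II z - Ke z) * fps_deriv (qX z)"
proof -
  have c: "fps_const (- g - 1) = - fps_const (g + 1)" by simp
  have alg: "- C * (A * G0 - B * G1 - D * G2) = - (A * (C * G0)) + B * (C * G1) + D * (C * G2)"
    for A B C D G0 G1 G2 :: "real fps" by (simp add: algebra_simps)
  have e: "- g - 1 - 1 = - g - 2" by simp
  have "fps_deriv (JJ z) = - (fps_deriv (PP z) * II z)
      + fps_deriv (pX z) * (fps_const (g + 1) * GG (\<lambda>x. fst x * 1) (- g - 2) z)
      + fps_deriv (qX z) * (fps_const (g + 1) * GG (\<lambda>x. snd x * 1) (- g - 2) z)"
    unfolding JJ_def fps_deriv_GG[OF continuous_on_const] II_def c e by (rule alg)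
  then show ?thesis unfolding GG_fst_snd by (simp add: algebra_simps)
qed

definition JJ' :: "complex \<Rightarrow> complex \<Rightarrow> real fps" where
  "JJ' z h = - II z * PP' z h + (II z - Ko z) * pX' z h + (II z - Ke z) * qX' z h"

lemma JJ_has_derivative: "fps_has_derivative JJ (JJ' z) z"
proof -
  have c: "fps_const (- g - 1) = - fps_const (g + 1)" by simp
  have alg: "- C * (A * G0 - B * G1 - D * G2) = - (A * (C * G0)) + B * (C * G1) + D * (C * G2)"
    for A B C D G0 G1 G2 :: "real fps" by (simp add: algebra_simps)
  have e: "- g - 1 - 1 = - g - 2" by simp
  have "fps_const (- g - 1) * (PP' z h * GG (\<lambda>x. 1) (- g - 1 - 1) z
     - pX' z h * GG (\<lambda>x. fst x * 1) (- g - 1 - 1) z - qX' z h * GG (\<lambda>x. snd x * 1) (- g - 1 - 1) z)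
     = - (PP' z h * II z)
      + pX' z h * (fps_const (g + 1) * GG (\<lambda>x. fst x * 1) (- g - 2) z)
      + qX' z h * (fps_const (g + 1) * GG (\<lambda>x. snd x * 1) (- g - 2) z)" for h
    unfolding II_def c e by (rule alg)
  then have "fps_const (- g - 1) * (PP' z h * GG (\<lambda>x. 1) (- g - 1 - 1) z
     - pX' z h * GG (\<lambda>x. fst x * 1) (- g - 1 - 1) z - qX' z h * GG (\<lambda>x. snd x * 1) (- g - 1 - 1) z) = JJ' z h" for h
    unfolding GG_fst_snd JJ'_def by (simp add: algebra_simps)
  then show ?thesis
    using GG_has_derivative[OF continuous_on_const, of 1 "- g - 1" z] unfolding JJ_def[abs_def] by simp
qed

end

section \<open>Reflections\<close>

lemma fps_deriv_prod:
  fixes f :: "'i \<Rightarrow> real fps"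
  assumes "finite S"
  shows "fps_deriv (\<Prod>i\<in>S. f i) = (\<Sum>i\<in>S. fps_deriv (f i) * (\<Prod>j\<in>S - {i}. f j))"
  using assms
proof (induction S rule: finite_induct)
  case (insert a S)
  have "(\<Prod>j\<in>insert a S - {i}. f j) = f a * (\<Prod>j\<in>S - {i}. f j)" if "i \<in> S" for i
  proof -
    have "insert a S - {i} = insert a (S - {i})" using that insert.hyps by auto
    then show ?thesis using insert.hyps by simp
  qed
  moreover have "insert a S - {a} = S" using insert.hyps by auto
  ultimately show ?case using insert
    by (simp add: sum_distrib_left algebra_simps cong: sum.cong)
qed simp

lemma dih_refl_eq: "dih_refl k j z = z - 2 * of_real (cinner (dih_root k j) z) * dih_root k j"
proof -
  let ?r = "dih_root k j"
  have "?r * ?r = - cis (real j * pi / real k)"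
    by (simp add: dih_root_def cis_mult algebra_simps)
  moreover have "cmod ?r = 1" by (simp add: dih_root_def norm_mult)
  then have "?r * cnj ?r = 1" using complex_norm_square[of ?r] by simp
  moreover have "2 * of_real (cinner ?r z) = ?r * cnj z + cnj ?r * z"
    by (simp add: cinner_def complex_eq_iff)
  moreover have "(?r * cnj z + cnj ?r * z) * ?r = (?r * ?r) * cnj z + (?r * cnj ?r) * z"
    by (simp add: algebra_simps)
  ultimately have "2 * of_real (cinner ?r z) * ?r = - cis (real j * pi / real k) * cnj z + z"
    by simp
  then show ?thesis by (simp add: dih_refl_def algebra_simps)
qed

lemma cinner_dih_refl:
  "cinner (dih_refl k j z) w = cinner z w - 2 * cinner (dih_root k j) z * cinner (dih_root k j) w"
proof -
  have "cinner (z - 2 * of_real a * r) w = cinner z w - 2 * a * cinner r w" for a r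
    by (simp add: cinner_def algebra_simps)
  then show ?thesis unfolding dih_refl_eq by simp
qed

lemma power_dih_refl:
  assumes "k \<ge> 1"
  shows "dih_refl k j z ^ k = (- 1) ^ j * cnj (z ^ k)"
proof -
  have "cis (real j * pi / real k) ^ k = cis (real j * pi)"
    using assms by (simp add: Complex.DeMoivre)
  also have "\<dots> = (- 1) ^ j" using Complex.DeMoivre[of pi j] by simp
  finally show ?thesis by (simp add: dih_refl_def power_mult_distrib mult.commute)
qed

lemma prod_minus_dih_refl:
  assumes "k \<ge> 1"
  shows "(\<Prod>i<k. z - dih_refl k (2 * i + e) z) = z ^ k - (- 1) ^ e * cnj (z ^ k)"
proof -
  have "dih_refl k (2 * i + e) z = cis (2 * pi * real i / real k) * dih_refl k e z" for i
    using assms by (simp add: dih_refl_def cis_mult add_divide_distrib algebra_simps)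
  then show ?thesis
    using prod_roots_unity[OF assms, of z "dih_refl k e z"] power_dih_refl[OF assms, of e z] by simp
qed

text \<open>Since \<open>z\<close> minus its mirror image is \<open>2 <root, z> root\<close>, the
  function \<open>z^k - (-1)^e cnj (z^k)\<close> is a constant times the product of the forms
  \<open><root, z>\<close> of one class. The claim is its logarithmic derivative. For
  \<open>e = 0\<close> it concerns Im z^k, the variable part of \<open>q\<close>; for
  \<open>e = 1\<close> Re z^k, that of \<open>p\<close>.\<close>

lemma sum_log_derivative_roots:
  assumes k: "k \<ge> 1" and reg: "dih_regular k z" and e: "e \<le> 1"
  shows "of_real (\<Sum>i<k. cinner (dih_root k (2 * i + e)) h / cinner (dih_root k (2 * i + e)) z)
      * (z ^ k - (- 1) ^ e * cnj (z ^ k))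
    = of_nat k * z ^ (k - 1) * h - (- 1) ^ e * cnj (of_nat k * z ^ (k - 1) * h)"
proof -
  let ?r = "\<lambda>i z. cinner (dih_root k (2 * i + e)) z"
  define C where "C = (\<Prod>i<k. 2 * dih_root k (2 * i + e))"
  have fac: "z ^ k - (- 1) ^ e * cnj (z ^ k) = of_real (\<Prod>i<k. ?r i z) * C" for z
    unfolding prod_minus_dih_refl[OF k, symmetric] dih_refl_eq C_def of_real_prod prod.distrib[symmetric]
    by (intro prod.cong) auto
  have rpos: "?r i z \<noteq> 0" if "i < k" for i
  proof -
    have "2 * i + e < 2 * k" using that e by simp
    then show ?thesis using reg unfolding dih_regular_def by blast
  qed
  have "((\<lambda>z. \<Prod>i<k. ?r i z) has_derivative (\<lambda>h. \<Sum>i<k. ?r i h * (\<Prod>j\<in>{..<k} - {i}. ?r j z))) (at z)"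
    unfolding cinner_def by (rule has_derivative_prod) (auto intro!: derivative_eq_intros)
  then have d1: "((\<lambda>z. of_real (\<Prod>i<k. ?r i z) * C) has_derivative
      (\<lambda>h. of_real (\<Sum>i<k. ?r i h * (\<Prod>j\<in>{..<k} - {i}. ?r j z)) * C)) (at z)"
    by (intro has_derivative_mult_left has_derivative_of_real)
  have d2: "((\<lambda>z. z ^ k - (- 1) ^ e * cnj (z ^ k)) has_derivative
      (\<lambda>h. of_nat k * z ^ (k - 1) * h - (- 1) ^ e * cnj (of_nat k * z ^ (k - 1) * h))) (at z)"
    by (intro has_derivative_diff has_derivative_mult_right has_derivative_cnj) (auto intro!: derivative_eq_intros)
  have "of_nat k * z ^ (k - 1) * h - (- 1) ^ e * cnj (of_nat k * z ^ (k - 1) * h)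
     = of_real (\<Sum>i<k. ?r i h * (\<Prod>j\<in>{..<k} - {i}. ?r j z)) * C"
    by (rule fun_cong[OF has_derivative_unique[OF d2[unfolded fac] d1]])
  also have "(\<Sum>i<k. ?r i h * (\<Prod>j\<in>{..<k} - {i}. ?r j z)) = (\<Sum>i<k. ?r i h / ?r i z) * (\<Prod>i<k. ?r i z)"
    unfolding sum_distrib_right
  proof (intro sum.cong refl)
    fix i assume i: "i \<in> {..<k}"
    then have "(\<Prod>i<k. ?r i z) = ?r i z * (\<Prod>j\<in>{..<k} - {i}. ?r j z)" by (simp add: prod.remove)
    then show "?r i h * (\<Prod>j\<in>{..<k} - {i}. ?r j z) = ?r i h / ?r i z * (\<Prod>i<k. ?r i z)"
      using rpos[of i] i by simp
  qed
  finally show ?thesis unfolding fac by (simp add: mult.assoc)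
qed

lemma fps_has_derivative_compose_linear:
  assumes "bounded_linear L" "fps_has_derivative f f' (L z)"
  shows "fps_has_derivative (\<lambda>z. f (L z)) (\<lambda>h. f' (L h)) z"
  using assms has_derivative_compose[OF bounded_linear_imp_has_derivative[OF assms(1)]]
  unfolding fps_has_derivative_def by blast

lemma bounded_linear_dih_refl: "bounded_linear (dih_refl k j)"
  unfolding dih_refl_def[abs_def]
  by (intro bounded_linear_mult_const bounded_linear_cnj)

text \<open>With \<open>N = D * J\<close>, the left-hand side is the part of the Dunkl operator that a derivation acting on
  \<open>P\<close>, \<open>p\<close>, \<open>q\<close> by \<open>P'\<close>, \<open>p'\<close>, \<open>q'\<close> contributes; it vanishes for every such derivation.\<close>
lemma derivation_identity:
  fixes P p q P' p' q' J Jx Jy I X Y D De Do J' a b :: "'a::comm_ring_1"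
  assumes D: "D = P - p - q" "De = P - p + q" "Do = P + p - q"
    and rec: "(a + b + 1) * J = D * I + p * X + q * Y"
    and J': "J' = - I * P' + (I - X) * p' + (I - Y) * q'"
    and Jx: "b * Jx = b * J - p * X" and Jy: "a * Jy = a * J - q * Y"
  shows "(P' - p' - q') * J + D * J' + q' * (De * Y - 2 * (a * J)) + a * Jy * (P' - p' + q')
     + p' * (Do * X - 2 * (b * J)) + b * Jx * (P' + p' - q') = 0"
proof -
  have "(P' - p' - q') * J + D * J' + q' * (De * Y - 2 * (a * J)) + a * Jy * (P' - p' + q')
     + p' * (Do * X - 2 * (b * J)) + b * Jx * (P' + p' - q')
     = (P' - p' - q') * ((a + b + 1) * J - D * I - p * X - q * Y)"
    unfolding Jx Jy J' D by (simp add: algebra_simps)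
  then show ?thesis unfolding rec by simp
qed

context dihedral_kernel
begin

lemma dih_refl_rot: "dih_refl k (2 * i + e) z = rot i (dih_refl k e z)"
  using k by (simp add: dih_refl_def rot_def cis_mult add_divide_distrib algebra_simps)

lemma PP_refl [simp]: "PP (dih_refl k j z) = PP z"
  by (simp add: PP_def)

text \<open>A reflection sends \<open>z^k\<close> to \<open>cnj (z^k)\<close> for even
  \<open>j\<close> and to its negative for odd \<open>j\<close>. On \<open>F\<close> this has the
  same effect as \<open>u -> - u\<close> and \<open>v -> - v\<close>, respectively.\<close>

lemma pq_refl:
  "even j \<Longrightarrow> pX (dih_refl k j z) = pX z" "even j \<Longrightarrow> qX (dih_refl k j z) = - qX z"
  "odd j \<Longrightarrow> pX (dih_refl k j z) = - pX z" "odd j \<Longrightarrow> qX (dih_refl k j z) = qX z"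
  unfolding pX_def qX_def power_dih_refl[OF k]
  by (auto simp del: complex_cnj_power simp flip: fps_const_neg)

text \<open>Integration by parts for \<open>F^(-g-1)\<close>, whose derivatives in \<open>u\<close>
  and \<open>v\<close> are \<open>(g + 1) q F^(-g-2)\<close> and
  \<open>(g + 1) p F^(-g-2)\<close>.\<close>

lemma JJ_reflections:
  "fps_const \<alpha> * fps_lint \<mu> (\<lambda>x. fpow (- g - 1) (FF z (fst x, - snd x))) = fps_const \<alpha> * JJ z - qX z * Ke z"
  "fps_const \<beta> * fps_lint \<mu> (\<lambda>x. fpow (- g - 1) (FF z (- fst x, snd x))) = fps_const \<beta> * JJ z - pX z * Ko z"
proof -
  have c: "fps_const (- g - 1) = - fps_const (g + 1)" by simp
  have e: "- g - 1 - 1 = - g - 2" by simp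
  have J: "JJ z $ n = (\<integral>x. fpow (- g - 1) (FF z x) $ n \<partial>\<mu>)" for n
    by (simp add: JJ_def GG_def)
  have cont: "fps_continuous_on UNIV (\<lambda>x. fpow c (FF z x) * A)" for c A
    by (intro fps_continuous_intros FF_continuous continuous_on_const continuous_on_id)
  have der: "((\<lambda>t. fpow (- g - 1) (E - fps_const t * B) $ n) has_real_derivative
      (fpow (- g - 2) (E - fps_const t * B) * (fps_const (g + 1) * B)) $ n) (at t)"
    if "E $ 0 = 1" "B $ 0 = 0" for E B n t
  proof -
    have "fps_has_derivative (\<lambda>t. E - fps_const t * B) (\<lambda>h. - (fps_const h * B)) t"
      using fps_has_derivative_diff[OF fps_has_derivative_const
          fps_has_derivative_mult[OF fps_has_derivative_fps_const[OF has_derivative_ident] fps_has_derivative_const]]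
      by simp
    then have "fps_has_derivative (\<lambda>t. fpow (- g - 1) (E - fps_const t * B))
       (\<lambda>h. fps_const (- g - 1) * fpow (- g - 1 - 1) (E - fps_const t * B) * - (fps_const h * B)) t"
      using that by (intro fps_has_derivative_fpow) auto
    moreover have "fps_const (- g - 1) * fpow (- g - 1 - 1) (E - fps_const t * B) * - (fps_const h * B)
      = fps_const h * (fpow (- g - 2) (E - fps_const t * B) * (fps_const (g + 1) * B))" for h
      unfolding c e by (simp only: mult_ac mult_minus_left mult_minus_right minus_minus)
    ultimately have "fps_has_derivative (\<lambda>t. fpow (- g - 1) (E - fps_const t * B))
      (\<lambda>h. fps_const h * (fpow (- g - 2) (E - fps_const t * B) * (fps_const (g + 1) * B))) t" by (simp only:)
    then have "((\<lambda>t. fpow (- g - 1) (E - fps_const t * B) $ n) has_derivative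
      (\<lambda>h. h * (fpow (- g - 2) (E - fps_const t * B) * (fps_const (g + 1) * B)) $ n)) (at t)"
      unfolding fps_has_derivative_def fps_mult_left_const_nth by blast
    then show ?thesis unfolding has_field_derivative_def mult_commute_abs .
  qed
  have lint: "fps_lint \<mu> (\<lambda>x. fps_const (a x) * (fpow (- g - 2) (FF z x) * (fps_const (g + 1) * B)))
     = B * (fps_const (g + 1) * GG a (- g - 2) z)" if "continuous_on UNIV a" for a B
  proof -
    have eq: "fps_const (a x) * (fpow (- g - 2) (FF z x) * (fps_const (g + 1) * B))
      = (B * fps_const (g + 1)) * (fps_const (a x) * fpow (- g - 2) (FF z x))" for x
      by (simp only: mult_ac)
    show ?thesis unfolding eq GG_def fps_lint_mult[OF GG_integrable[OF that]] by (rule mult.assoc)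
  qed
  show "fps_const \<alpha> * fps_lint \<mu> (\<lambda>x. fpow (- g - 1) (FF z (fst x, - snd x))) = fps_const \<alpha> * JJ z - qX z * Ke z"
  proof (rule fps_ext)
    fix n
    have "(\<integral>x. (1 - snd x) * (fpow (- g - 2) (FF z x) * (fps_const (g + 1) * qX z)) $ n \<partial>\<mu>)
       = \<alpha> * ((\<integral>x. fpow (- g - 1) (FF z x) $ n \<partial>\<mu>) - (\<integral>x. fpow (- g - 1) (FF z (fst x, - snd x)) $ n \<partial>\<mu>))"
    proof (rule integral_by_parts_snd[OF \<alpha> \<beta>])
      show "continuous_on UNIV (\<lambda>x. fpow (- g - 1) (FF z x) $ n)"
        using cont[of "- g - 1" 1] by (simp add: fps_continuous_on_def)
      show "continuous_on UNIV (\<lambda>x. (fpow (- g - 2) (FF z x) * (fps_const (g + 1) * qX z)) $ n)"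
        using cont unfolding fps_continuous_on_def by blast
      show "((\<lambda>u. fpow (- g - 1) (FF z (v, u)) $ n) has_real_derivative
          (fpow (- g - 2) (FF z (v, u)) * (fps_const (g + 1) * qX z)) $ n) (at u)" for v u
        using der[of "PP z - fps_const v * pX z" "qX z" n u] FF_nth_0[of z "(v, 0)"] unfolding FF_def by simp
    qed
    moreover have "(qX z * Ke z) $ n = (\<integral>x. (1 - snd x) * (fpow (- g - 2) (FF z x) * (fps_const (g + 1) * qX z)) $ n \<partial>\<mu>)"
      unfolding Ke_def lint[symmetric, OF continuous_on_diff[OF continuous_on_const continuous_on_snd[OF continuous_on_id]]]
      by simp
    ultimately show "(fps_const \<alpha> * fps_lint \<mu> (\<lambda>x. fpow (- g - 1) (FF z (fst x, - snd x)))) $ n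
        = (fps_const \<alpha> * JJ z - qX z * Ke z) $ n"
      by (simp add: J right_diff_distrib)
  qed
  show "fps_const \<beta> * fps_lint \<mu> (\<lambda>x. fpow (- g - 1) (FF z (- fst x, snd x))) = fps_const \<beta> * JJ z - pX z * Ko z"
  proof (rule fps_ext)
    fix n
    have "(\<integral>x. (1 - fst x) * (fpow (- g - 2) (FF z x) * (fps_const (g + 1) * pX z)) $ n \<partial>\<mu>)
       = \<beta> * ((\<integral>x. fpow (- g - 1) (FF z x) $ n \<partial>\<mu>) - (\<integral>x. fpow (- g - 1) (FF z (- fst x, snd x)) $ n \<partial>\<mu>))"
    proof (rule integral_by_parts_fst[OF \<alpha> \<beta>])
      show "continuous_on UNIV (\<lambda>x. fpow (- g - 1) (FF z x) $ n)"
        using cont[of "- g - 1" 1] by (simp add: fps_continuous_on_def)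
      show "continuous_on UNIV (\<lambda>x. (fpow (- g - 2) (FF z x) * (fps_const (g + 1) * pX z)) $ n)"
        using cont unfolding fps_continuous_on_def by blast
      have FF: "FF z (v, u) = (PP z - fps_const u * qX z) - fps_const v * pX z" for v u
        by (simp add: FF_def)
      show "((\<lambda>v. fpow (- g - 1) (FF z (v, u)) $ n) has_real_derivative
          (fpow (- g - 2) (FF z (v, u)) * (fps_const (g + 1) * pX z)) $ n) (at v)" for v u
        using der[of "PP z - fps_const u * qX z" "pX z" n v] FF_nth_0[of z "(0, u)"] unfolding FF by simp
    qed
    moreover have "(pX z * Ko z) $ n = (\<integral>x. (1 - fst x) * (fpow (- g - 2) (FF z x) * (fps_const (g + 1) * pX z)) $ n \<partial>\<mu>)"
      unfolding Ko_def lint[symmetric, OF continuous_on_diff[OF continuous_on_const continuous_on_fst[OF continuous_on_id]]]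
      by simp
    ultimately show "(fps_const \<beta> * fps_lint \<mu> (\<lambda>x. fpow (- g - 1) (FF z (- fst x, snd x)))) $ n
        = (fps_const \<beta> * JJ z - pX z * Ko z) $ n"
      by (simp add: J right_diff_distrib)
  qed
qed

lemma JJ_refl:
  "even j \<Longrightarrow> fps_const \<alpha> * JJ (dih_refl k j z) = fps_const \<alpha> * JJ z - qX z * Ke z"
  "odd j \<Longrightarrow> fps_const \<beta> * JJ (dih_refl k j z) = fps_const \<beta> * JJ z - pX z * Ko z"
proof -
  have "even j \<Longrightarrow> FF (dih_refl k j z) x = FF z (fst x, - snd x)" for x
    unfolding FF_def by (simp add: pq_refl flip: fps_const_neg)
  then have "even j \<Longrightarrow> JJ (dih_refl k j z) = fps_lint \<mu> (\<lambda>x. fpow (- g - 1) (FF z (fst x, - snd x)))"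
    by (simp add: JJ_def GG_def)
  then show "even j \<Longrightarrow> fps_const \<alpha> * JJ (dih_refl k j z) = fps_const \<alpha> * JJ z - qX z * Ke z"
    using JJ_reflections(1) by simp
  have "odd j \<Longrightarrow> FF (dih_refl k j z) x = FF z (- fst x, snd x)" for x
    unfolding FF_def by (simp add: pq_refl flip: fps_const_neg)
  then have "odd j \<Longrightarrow> JJ (dih_refl k j z) = fps_lint \<mu> (\<lambda>x. fpow (- g - 1) (FF z (- fst x, snd x)))"
    by (simp add: JJ_def GG_def)
  then show "odd j \<Longrightarrow> fps_const \<beta> * JJ (dih_refl k j z) = fps_const \<beta> * JJ z - pX z * Ko z"
    using JJ_reflections(2) by simp
qed

lemma DD_refl:
  "even j \<Longrightarrow> DD (dih_refl k j z) = PP z - pX z + qX z"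
  "odd j \<Longrightarrow> DD (dih_refl k j z) = PP z + pX z - qX z"
  unfolding DD_eq by (simp_all add: pq_refl)

text \<open>Both sides are derivatives of \<open>DD (dih_refl k j z)\<close>, one by the chain rule
  and one from the formula of \<open>DD_refl\<close>.\<close>

lemma DD'_refl:
  "even j \<Longrightarrow> DD' (dih_refl k j z) (dih_refl k j h) = PP' z h - pX' z h + qX' z h"
  "odd j \<Longrightarrow> DD' (dih_refl k j z) (dih_refl k j h) = PP' z h + pX' z h - qX' z h"
proof -
  have d: "fps_has_derivative (\<lambda>z. DD (dih_refl k j z)) (\<lambda>h. DD' (dih_refl k j z) (dih_refl k j h)) z"
    by (rule fps_has_derivative_compose_linear[OF bounded_linear_dih_refl DD_has_derivative])
  { assume j: "even j"
    have "fps_has_derivative (\<lambda>z. PP z - pX z + qX z) (\<lambda>h. PP' z h - pX' z h + qX' z h) z"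
      by (intro fps_has_derivative_add fps_has_derivative_diff PP_has_derivative pX_has_derivative qX_has_derivative)
    moreover have "fps_has_derivative (\<lambda>z. PP z - pX z + qX z) (\<lambda>h. DD' (dih_refl k j z) (dih_refl k j h)) z"
      using d unfolding DD_refl(1)[OF j] .
    ultimately show "DD' (dih_refl k j z) (dih_refl k j h) = PP' z h - pX' z h + qX' z h"
      by (rule fps_has_derivative_unique[rotated]) }
  { assume j: "odd j"
    have "fps_has_derivative (\<lambda>z. PP z + pX z - qX z) (\<lambda>h. PP' z h + pX' z h - qX' z h) z"
      by (intro fps_has_derivative_add fps_has_derivative_diff PP_has_derivative pX_has_derivative qX_has_derivative)
    moreover have "fps_has_derivative (\<lambda>z. PP z + pX z - qX z) (\<lambda>h. DD' (dih_refl k j z) (dih_refl k j h)) z"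
      using d unfolding DD_refl(2)[OF j] .
    ultimately show "DD' (dih_refl k j z) (dih_refl k j h) = PP' z h + pX' z h - qX' z h"
      by (rule fps_has_derivative_unique[rotated]) }
qed

text \<open>Every factor satisfies \<open>X dA/dX = A - 1\<close>, so each term of the product rule
  is \<open>DD\<close> minus the product with one factor removed.\<close>

lemma fps_deriv_DD: "fps_X * fps_deriv (DD z) = of_nat k * DD z - (\<Sum>i<k. MM (rot i z))"
proof -
  have eq: "fps_X * (fps_deriv (AA (rot i z)) * (\<Prod>j\<in>{..<k} - {i}. AA (rot j z))) = DD z - MM (rot i z)"
    if i: "i < k" for i
  proof -
    have "AA (rot i z) * (\<Prod>j\<in>{..<k} - {i}. AA (rot j z)) = DD z"
      unfolding DD_def using i by (simp add: prod.remove)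
    moreover have AM: "AA (rot i z) * MM (rot i z) = DD z" unfolding AA_MM DD_rot ..
    ultimately have m: "(\<Prod>j\<in>{..<k} - {i}. AA (rot j z)) = MM (rot i z)"
      by (metis AA_neq_0 mult_left_cancel)
    have "fps_X * fps_deriv (AA (rot i z)) = AA (rot i z) - 1" by (simp add: AA_def mult.commute)
    then have "fps_X * (fps_deriv (AA (rot i z)) * MM (rot i z)) = (AA (rot i z) - 1) * MM (rot i z)"
      by (metis mult.assoc)
    then show ?thesis unfolding m by (simp add: left_diff_distrib AM)
  qed
  show ?thesis
    unfolding DD_def[of z] fps_deriv_prod[OF finite_lessThan] sum_distrib_left
    by (simp add: eq sum_subtractf flip: DD_def)
qed

end

section \<open>The Dunkl equation of the generating series\<close>

lemma sum_lessThan_double: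
  "(\<Sum>j<2 * n. f j) = (\<Sum>i<n. f (2 * i + 0)) + (\<Sum>i<n. f (2 * i + (1::nat)))" for f :: "nat \<Rightarrow> 'a::comm_monoid_add"
  by (induction n) (simp_all add: ac_simps)

text \<open>The two assumed vanishing expressions are instances of \<open>derivation_identity\<close>: one for the derivation
  along a direction, one for the Euler derivation, marked by the prefix \<open>t\<close>.\<close>
lemma dunkl_ring_identity:
  fixes J Jx Jy X Y D De Do p q a b p' q' :: "'a::comm_ring_1"
  assumes De: "D - De = - (2 * q)" and Do: "D - Do = - (2 * p)"
    and Jx: "b * Jx = b * J - p * X" and Jy: "a * Jy = a * J - q * Y"
    and q': "Sy * q = q'" and p': "Sx * p = p'"
    and id1: "D' * J + D * J' + q' * (De * Y - 2 * (a * J)) + a * Jy * De'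
      + p' * (Do * X - 2 * (b * J)) + b * Jx * Do' = 0"
    and id2: "tD * J + D * tJ + K * q * (De * Y - 2 * (a * J)) + a * Jy * tDe
      + K * p * (Do * X - 2 * (b * J)) + b * Jx * tDo = 0"
  shows "D * J' + D' * J + a * (Sy * (D * J - De * Jy) + Jy * (De' + W * (K * De - tDe)))
     + b * (Sx * (D * J - Do * Jx) + Jx * (Do' + W * (K * Do - tDo)))
     = W * (K * (a + b) * (D * J) + (tD * J + D * tJ))"
proof -
  have "a * (D * J - De * Jy) = a * J * (D - De) + De * (a * J) - De * (a * Jy)"
    by (simp add: algebra_simps)
  then have ay: "a * (D * J - De * Jy) = q * (De * Y - 2 * (a * J))"
    unfolding Jy De by (simp add: algebra_simps)
  have "b * (D * J - Do * Jx) = b * J * (D - Do) + Do * (b * J) - Do * (b * Jx)"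
    by (simp add: algebra_simps)
  then have bx: "b * (D * J - Do * Jx) = p * (Do * X - 2 * (b * J))"
    unfolding Jx Do by (simp add: algebra_simps)
  \<comment> \<open>The two sides differ by the expression in \<open>id1\<close> minus
    \<open>W\<close> times the one in \<open>id2\<close>, once \<open>ay\<close> and
    \<open>bx\<close> are inserted.\<close>
  have "D * J' + D' * J + a * (Sy * (D * J - De * Jy) + Jy * (De' + W * (K * De - tDe)))
     + b * (Sx * (D * J - Do * Jx) + Jx * (Do' + W * (K * Do - tDo)))
     - W * (K * (a + b) * (D * J) + (tD * J + D * tJ))
   = (D' * J + D * J' + Sy * (a * (D * J - De * Jy)) + a * Jy * De' + Sx * (b * (D * J - Do * Jx)) + b * Jx * Do')
    - W * (tD * J + D * tJ + K * (a * (D * J - De * Jy)) + a * Jy * tDe + K * (b * (D * J - Do * Jx)) + b * Jx * tDo)"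
    by (simp add: algebra_simps)
  also have "\<dots> = 0"
    unfolding ay bx using id1 id2 by (simp only: mult.assoc[symmetric] q' p') simp
  finally show ?thesis by simp
qed

context dihedral_kernel
begin

definition LL :: "complex \<Rightarrow> real fps" where
  "LL z = MM z * JJ z"

definition MM' :: "complex \<Rightarrow> complex \<Rightarrow> real fps" where
  "MM' z h = (\<Sum>i\<in>{1..<k}. - (fps_const (cinner (rot i h) w) * fps_X) * (\<Prod>j\<in>{1..<k} - {i}. AA (rot j z)))"

definition LL' :: "complex \<Rightarrow> complex \<Rightarrow> real fps" where
  "LL' z h = MM z * JJ' z h + MM' z h * JJ z"

lemma MM_has_derivative: "fps_has_derivative MM (MM' z) z"
  unfolding MM_def[abs_def] MM'_def by (rule fps_has_derivative_prod) (auto intro: AA_has_derivative)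

lemma LL_has_derivative: "fps_has_derivative LL (LL' z) z"
  unfolding LL_def[abs_def] LL'_def by (intro fps_has_derivative_mult MM_has_derivative JJ_has_derivative)

lemma AA_LL: "AA z * LL z = DD z * JJ z"
  unfolding LL_def mult.assoc[symmetric] AA_MM ..

text \<open>The product rule applied to both sides of \<open>A L = D J\<close>. This keeps
  \<open>MM'\<close> out of the proof of the Dunkl equation.\<close>

lemma AA_LL': "AA z * LL' z h = fps_const (cinner h w) * fps_X * LL z + (DD z * JJ' z h + DD' z h * JJ z)"
proof -
  have "fps_has_derivative (\<lambda>z. AA z * LL z) (\<lambda>h. AA z * LL' z h + - (fps_const (cinner h w) * fps_X) * LL z) z"
    using fps_has_derivative_mult[OF AA_has_derivative[of 0] LL_has_derivative] by simp
  moreover have "fps_has_derivative (\<lambda>z. AA z * LL z) (\<lambda>h. DD z * JJ' z h + DD' z h * JJ z) z"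
    unfolding AA_LL by (intro fps_has_derivative_mult DD_has_derivative JJ_has_derivative)
  ultimately have "AA z * LL' z h + - (fps_const (cinner h w) * fps_X) * LL z = DD z * JJ' z h + DD' z h * JJ z"
    by (rule fps_has_derivative_unique)
  then show ?thesis by (simp add: algebra_simps)
qed

lemma JJ_rot: "JJ (rot i z) = JJ z"
  unfolding JJ_def GG_def FF_def PP_def pX_def qX_def by (simp add: rot_power)

text \<open>Here \<open>A L = D J\<close>, and the reflection with root \<open>r\<close> changes
  \<open>A\<close> by \<open>2 <r, z> <r, w> X\<close>, a multiple of the denominator. So each
  summand splits into \<open><r, h> / <r, z>\<close> times a factor common to the class, and a part
  without denominator. In the latter \<open>2 <r, h> <r, w>\<close> is \<open><h, w>\<close> minus
  the value of \<open><., w>\<close> at the reflected \<open>h\<close>; summing over the class gives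
  the derivative of \<open>D\<close> at \<open>y\<close> and the sum of the
  \<open>MM (rot i y)\<close>, which \<open>fps_deriv_DD\<close> evaluates.\<close>

lemma reflection_class_sum:
  fixes z h :: complex and c :: real and e :: nat
  assumes reg: "dih_regular k z" and e: "e \<le> 1"
  defines "y \<equiv> dih_refl k e z" and "W \<equiv> fps_const (cinner h w) * fps_X"
  defines "S \<equiv> \<Sum>i<k. cinner (dih_root k (2 * i + e)) h / cinner (dih_root k (2 * i + e)) z"
  shows "AA z * (\<Sum>i<k. fps_const (c * cinner (dih_root k (2 * i + e)) h / cinner (dih_root k (2 * i + e)) z)
        * (LL z - LL (dih_refl k (2 * i + e) z)))
    = fps_const c * (fps_const S * (DD z * JJ z - DD y * JJ y)
        + JJ y * (DD' y (dih_refl k e h) + W * (of_nat k * DD y - fps_X * fps_deriv (DD y))))"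
proof -
  let ?R = "\<lambda>i. dih_root k (2 * i + e)"
  have each: "AA z * (fps_const (c * cinner (?R i) h / cinner (?R i) z) * (LL z - LL (dih_refl k (2 * i + e) z)))
    = fps_const c * (fps_const (cinner (?R i) h / cinner (?R i) z) * (DD z * JJ z - DD y * JJ y)
       + JJ y * (fps_const (2 * cinner (?R i) h * cinner (?R i) w) * fps_X * MM (rot i y)))" if "i < k" for i
  proof -
    have r: "cinner (?R i) z \<noteq> 0"
    proof -
      have "2 * i + e < 2 * k" using that e by simp
      then show ?thesis using reg unfolding dih_regular_def by blast
    qed
    have A: "AA z = AA (rot i y) - fps_const (2 * cinner (?R i) z * cinner (?R i) w) * fps_X"
      unfolding y_def dih_refl_rot[symmetric] AA_def cinner_dih_refl
      by (simp add: algebra_simps flip: fps_const_sub)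
    have L: "LL (dih_refl k (2 * i + e) z) = MM (rot i y) * JJ y"
      unfolding LL_def dih_refl_rot y_def[symmetric] JJ_rot ..
    have "AA z * LL (dih_refl k (2 * i + e) z) = DD y * JJ y
       - fps_const (2 * cinner (?R i) z * cinner (?R i) w) * fps_X * MM (rot i y) * JJ y"
    proof -
      have "AA (rot i y) * (MM (rot i y) * JJ y) = DD y * JJ y"
        unfolding mult.assoc[symmetric] AA_MM DD_rot ..
      then show ?thesis unfolding A L by (simp add: left_diff_distrib mult.assoc)
    qed
    then have "AA z * (fps_const (c * cinner (?R i) h / cinner (?R i) z) * (LL z - LL (dih_refl k (2 * i + e) z)))
      = fps_const (c * cinner (?R i) h / cinner (?R i) z) * (DD z * JJ z - DD y * JJ y)
       + fps_const (c * cinner (?R i) h / cinner (?R i) z) * (fps_const (2 * cinner (?R i) z * cinner (?R i) w) * fps_X * MM (rot i y) * JJ y)"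
      using AA_LL[of z] by (simp only: mult.left_commute[of "AA z"] right_diff_distrib) (simp only: algebra_simps)
    also have "fps_const (c * cinner (?R i) h / cinner (?R i) z) * (fps_const (2 * cinner (?R i) z * cinner (?R i) w) * fps_X * MM (rot i y) * JJ y)
      = fps_const c * (JJ y * (fps_const (2 * cinner (?R i) h * cinner (?R i) w) * fps_X * MM (rot i y)))"
    proof -
      have "fps_const (c * cinner (?R i) h / cinner (?R i) z) * fps_const (2 * cinner (?R i) z * cinner (?R i) w)
         = fps_const c * fps_const (2 * cinner (?R i) h * cinner (?R i) w)"
        using r by simp
      then have "fps_const (c * cinner (?R i) h / cinner (?R i) z) * fps_const (2 * cinner (?R i) z * cinner (?R i) w) * (fps_X * MM (rot i y) * JJ y)
         = fps_const c * fps_const (2 * cinner (?R i) h * cinner (?R i) w) * (fps_X * MM (rot i y) * JJ y)"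
        by (simp only:)
      then show ?thesis by (simp only: mult_ac)
    qed
    finally have F: "AA z * (fps_const (c * cinner (?R i) h / cinner (?R i) z) * (LL z - LL (dih_refl k (2 * i + e) z)))
      = fps_const (c * cinner (?R i) h / cinner (?R i) z) * (DD z * JJ z - DD y * JJ y)
        + fps_const c * (JJ y * (fps_const (2 * cinner (?R i) h * cinner (?R i) w) * fps_X * MM (rot i y)))" .
    have cc: "fps_const (c * cinner (?R i) h / cinner (?R i) z) = fps_const c * fps_const (cinner (?R i) h / cinner (?R i) z)"
      by simp
    show ?thesis unfolding F distrib_left unfolding cc mult.assoc ..
  qed
  have "(\<Sum>i<k. fps_const (2 * cinner (?R i) h * cinner (?R i) w) * fps_X * MM (rot i y))
      = DD' y (dih_refl k e h) + W * (\<Sum>i<k. MM (rot i y))"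
    unfolding DD'_def dih_refl_rot[symmetric] cinner_dih_refl W_def sum_distrib_left sum_negf[symmetric] sum.distrib[symmetric]
    by (intro sum.cong refl) (simp add: algebra_simps flip: fps_const_sub)
  moreover have "(\<Sum>i<k. MM (rot i y)) = of_nat k * DD y - fps_X * fps_deriv (DD y)"
    unfolding fps_deriv_DD by simp
  ultimately have sumM: "(\<Sum>i<k. fps_const (2 * cinner (?R i) h * cinner (?R i) w) * fps_X * MM (rot i y))
      = DD' y (dih_refl k e h) + W * (of_nat k * DD y - fps_X * fps_deriv (DD y))" by simp
  have sumS: "(\<Sum>i<k. fps_const (cinner (?R i) h / cinner (?R i) z)) = fps_const S"
  proof -
    have "(\<Sum>i<n. fps_const (f i)) = fps_const (\<Sum>i<n. f i)" for f :: "nat \<Rightarrow> real" and n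
      by (induction n) auto
    then show ?thesis unfolding S_def .
  qed
  have "AA z * (\<Sum>i<k. fps_const (c * cinner (?R i) h / cinner (?R i) z) * (LL z - LL (dih_refl k (2 * i + e) z)))
    = (\<Sum>i<k. fps_const c * (fps_const (cinner (?R i) h / cinner (?R i) z) * (DD z * JJ z - DD y * JJ y)
       + JJ y * (fps_const (2 * cinner (?R i) h * cinner (?R i) w) * fps_X * MM (rot i y))))"
    unfolding sum_distrib_left by (intro sum.cong refl each) simp
  then show ?thesis
    by (simp only: sum_distrib_left[symmetric] sum.distrib sum_distrib_right[symmetric] sumS sumM)
qed

text \<open>After multiplication by \<open>A\<close> only \<open>D\<close>, \<open>J\<close> and
  their reflected values occur, and the claim becomes \<open>dunkl_ring_identity\<close> with
  \<open>W = <h, w> X\<close>. Series form an integral domain, so the nonzero factor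
  \<open>A\<close> can be cancelled at the end.\<close>

theorem dunkl_equation_LL:
  assumes reg: "dih_regular k z"
  shows "LL' z h + (\<Sum>j<2*k. fps_const (dih_mult \<alpha> \<beta> j * cinner (dih_root k j) h / cinner (dih_root k j) z)
        * (LL z - LL (dih_refl k j z)))
    = fps_const (cinner h w) * fps_X * (fps_const (real k * g + 1) * LL z + fps_X * fps_deriv (LL z))"
proof -
  define W where "W = fps_const (cinner h w) * fps_X"
  define y0 y1 where "y0 = dih_refl k 0 z" and "y1 = dih_refl k 1 z"
  define S0 where "S0 = (\<Sum>i<k. cinner (dih_root k (2 * i + 0)) h / cinner (dih_root k (2 * i + 0)) z)"
  define S1 where "S1 = (\<Sum>i<k. cinner (dih_root k (2 * i + 1)) h / cinner (dih_root k (2 * i + 1)) z)"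
  have q': "fps_const S0 * qX z = qX' z h"
  proof -
    have "Im (of_real S0 * (z ^ k - (- 1) ^ 0 * cnj (z ^ k)))
      = Im (of_nat k * z ^ (k - 1) * h - (- 1) ^ 0 * cnj (of_nat k * z ^ (k - 1) * h))"
      unfolding S0_def by (subst sum_log_derivative_roots[OF k reg]) auto
    then have "S0 * Im (z ^ k) = Im (of_nat k * z ^ (k - 1) * h)"
      by (simp del: complex_cnj_power complex_cnj_mult add: algebra_simps)
    then have "S0 * (2 / 2 ^ k * Im (z ^ k) * Im (w ^ k)) = 2 / 2 ^ k * Im (of_nat k * z ^ (k - 1) * h) * Im (w ^ k)"
      by (metis mult.assoc mult.left_commute)
    then show ?thesis unfolding qX_def qX'_def mult.assoc[symmetric] fps_const_mult by (simp only: mult.assoc)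
  qed
  have p': "fps_const S1 * pX z = pX' z h"
  proof -
    have "Re (of_real S1 * (z ^ k - (- 1) ^ 1 * cnj (z ^ k)))
      = Re (of_nat k * z ^ (k - 1) * h - (- 1) ^ 1 * cnj (of_nat k * z ^ (k - 1) * h))"
      unfolding S1_def by (subst sum_log_derivative_roots[OF k reg]) auto
    then have "S1 * Re (z ^ k) = Re (of_nat k * z ^ (k - 1) * h)"
      by (simp del: complex_cnj_power complex_cnj_mult add: algebra_simps)
    then have "S1 * (2 / 2 ^ k * Re (z ^ k) * Re (w ^ k)) = 2 / 2 ^ k * Re (of_nat k * z ^ (k - 1) * h) * Re (w ^ k)"
      by (metis mult.assoc mult.left_commute)
    then show ?thesis unfolding pX_def pX'_def mult.assoc[symmetric] fps_const_mult by (simp only: mult.assoc)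
  qed
  \<comment> \<open>\<open>p\<close> and \<open>q\<close> are multiples of \<open>X^k\<close>, so
    the Euler derivation acts on them as the number \<open>k\<close>; this is the \<open>K\<close>
    of \<open>dunkl_ring_identity\<close>.\<close>
  have tX: "fps_X * fps_deriv (fps_const c * fps_X ^ k) = of_nat k * (fps_const c * fps_X ^ k)" for c :: real
  proof (rule fps_ext)
    fix n
    have "(fps_X * fps_deriv f) $ n = real n * f $ n" for f :: "real fps" by (cases n) auto
    then show "(fps_X * fps_deriv (fps_const c * fps_X ^ k)) $ n = (of_nat k * (fps_const c * fps_X ^ k)) $ n"
      by (simp add: fps_of_nat[symmetric] fps_X_power_nth)
  qed
  have tq: "fps_X * fps_deriv (qX z) = of_nat k * qX z" and tp: "fps_X * fps_deriv (pX z) = of_nat k * pX z"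
    unfolding qX_def pX_def by (rule tX)+
  have rec: "(fps_const \<alpha> + fps_const \<beta> + 1) * JJ z = DD z * II z + pX z * Ko z + qX z * Ke z"
  proof -
    have "fps_const (g + 1) = fps_const \<alpha> + fps_const \<beta> + 1"
      by (simp only: fps_const_add[symmetric] fps_const_1_eq_1)
    then show ?thesis using JJ_recurrence[of z] by (simp only:)
  qed
  have Jy: "fps_const \<alpha> * JJ y0 = fps_const \<alpha> * JJ z - qX z * Ke z"
    unfolding y0_def by (rule JJ_refl) simp
  have Jx: "fps_const \<beta> * JJ y1 = fps_const \<beta> * JJ z - pX z * Ko z"
    unfolding y1_def by (rule JJ_refl) simp
  have De: "DD y0 = PP z - pX z + qX z" and Do: "DD y1 = PP z + pX z - qX z"
    unfolding y0_def y1_def by (rule DD_refl, simp)+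
  have De': "DD' y0 (dih_refl k 0 h) = PP' z h - pX' z h + qX' z h"
    and Do': "DD' y1 (dih_refl k 1 h) = PP' z h + pX' z h - qX' z h"
    unfolding y0_def y1_def by (rule DD'_refl, simp)+
  have D': "DD' z h = PP' z h - pX' z h - qX' z h" unfolding PP'_def by simp
  have id1: "DD' z h * JJ z + DD z * JJ' z h + qX' z h * (DD y0 * Ke z - 2 * (fps_const \<alpha> * JJ z))
      + fps_const \<alpha> * JJ y0 * DD' y0 (dih_refl k 0 h)
      + pX' z h * (DD y1 * Ko z - 2 * (fps_const \<beta> * JJ z)) + fps_const \<beta> * JJ y1 * DD' y1 (dih_refl k 1 h) = 0"
    unfolding De' Do' D'
    by (rule derivation_identity[OF DD_eq De Do rec JJ'_def Jx Jy])
  have tJ: "fps_X * fps_deriv (JJ z) = - II z * (fps_X * fps_deriv (PP z))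
      + (II z - Ko z) * (fps_X * fps_deriv (pX z)) + (II z - Ke z) * (fps_X * fps_deriv (qX z))"
    unfolding fps_deriv_JJ by (simp only: algebra_simps)
  have id2: "(fps_X * fps_deriv (DD z)) * JJ z + DD z * (fps_X * fps_deriv (JJ z))
      + of_nat k * qX z * (DD y0 * Ke z - 2 * (fps_const \<alpha> * JJ z))
      + fps_const \<alpha> * JJ y0 * (fps_X * fps_deriv (DD y0))
      + of_nat k * pX z * (DD y1 * Ko z - 2 * (fps_const \<beta> * JJ z)) + fps_const \<beta> * JJ y1 * (fps_X * fps_deriv (DD y1)) = 0"
  proof -
    have e: "fps_X * fps_deriv (DD z) = fps_X * fps_deriv (PP z) - fps_X * fps_deriv (pX z) - fps_X * fps_deriv (qX z)"
      "fps_X * fps_deriv (DD y0) = fps_X * fps_deriv (PP z) - fps_X * fps_deriv (pX z) + fps_X * fps_deriv (qX z)"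
      "fps_X * fps_deriv (DD y1) = fps_X * fps_deriv (PP z) + fps_X * fps_deriv (pX z) - fps_X * fps_deriv (qX z)"
      unfolding DD_eq[of z] De Do by (simp_all add: algebra_simps)
    show ?thesis unfolding e tq[symmetric] tp[symmetric]
      by (rule derivation_identity[OF DD_eq De Do rec tJ Jx Jy])
  qed
  have main: "DD z * JJ' z h + DD' z h * JJ z
     + fps_const \<alpha> * (fps_const S0 * (DD z * JJ z - DD y0 * JJ y0)
         + JJ y0 * (DD' y0 (dih_refl k 0 h) + W * (of_nat k * DD y0 - fps_X * fps_deriv (DD y0))))
     + fps_const \<beta> * (fps_const S1 * (DD z * JJ z - DD y1 * JJ y1)
         + JJ y1 * (DD' y1 (dih_refl k 1 h) + W * (of_nat k * DD y1 - fps_X * fps_deriv (DD y1))))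
     = W * (of_nat k * (fps_const \<alpha> + fps_const \<beta>) * (DD z * JJ z)
         + (fps_X * fps_deriv (DD z) * JJ z + DD z * (fps_X * fps_deriv (JJ z))))"
    by (rule dunkl_ring_identity[OF _ _ Jx Jy q' p' id1 id2]) (simp_all add: DD_eq[of z] De Do)
  have sums: "(\<Sum>j<2*k. fps_const (dih_mult \<alpha> \<beta> j * cinner (dih_root k j) h / cinner (dih_root k j) z)
        * (LL z - LL (dih_refl k j z)))
     = (\<Sum>i<k. fps_const (\<alpha> * cinner (dih_root k (2 * i + 0)) h / cinner (dih_root k (2 * i + 0)) z)
        * (LL z - LL (dih_refl k (2 * i + 0) z)))
     + (\<Sum>i<k. fps_const (\<beta> * cinner (dih_root k (2 * i + 1)) h / cinner (dih_root k (2 * i + 1)) z)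
        * (LL z - LL (dih_refl k (2 * i + 1) z)))"
    unfolding sum_lessThan_double by (simp add: dih_mult_def)
  have "AA z * (LL' z h + (\<Sum>j<2*k. fps_const (dih_mult \<alpha> \<beta> j * cinner (dih_root k j) h / cinner (dih_root k j) z)
        * (LL z - LL (dih_refl k j z))))
     = W * LL z + W * (of_nat k * (fps_const \<alpha> + fps_const \<beta>) * (DD z * JJ z)
         + (fps_X * fps_deriv (DD z) * JJ z + DD z * (fps_X * fps_deriv (JJ z))))"
    unfolding main[symmetric]
    unfolding sums distrib_left[of "AA z"] AA_LL'
      reflection_class_sum[OF reg zero_le_one] reflection_class_sum[OF reg order.refl]
      W_def y0_def y1_def S0_def S1_def by (simp only: add.assoc)
  also have "\<dots> = AA z * (W * (fps_const (real k * g + 1) * LL z + fps_X * fps_deriv (LL z)))"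
  proof -
    have "fps_deriv (AA z * LL z) = fps_deriv (DD z * JJ z)" unfolding AA_LL ..
    then have "AA z * fps_deriv (LL z) + fps_deriv (AA z) * LL z = DD z * fps_deriv (JJ z) + fps_deriv (DD z) * JJ z"
      by simp
    then have "fps_X * (AA z * fps_deriv (LL z) + fps_deriv (AA z) * LL z)
        = fps_X * (DD z * fps_deriv (JJ z) + fps_deriv (DD z) * JJ z)" by simp
    moreover have "fps_X * fps_deriv (AA z) = AA z - 1" by (simp add: AA_def mult.commute)
    then have "fps_X * (fps_deriv (AA z) * LL z) = (AA z - 1) * LL z" by (metis mult.assoc)
    ultimately have t: "AA z * (fps_X * fps_deriv (LL z)) + DD z * JJ z - LL z
       = fps_X * fps_deriv (DD z) * JJ z + DD z * (fps_X * fps_deriv (JJ z))"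
      unfolding AA_LL[symmetric] by (simp add: algebra_simps)
    have c: "fps_const (real k * g + 1) = of_nat k * (fps_const \<alpha> + fps_const \<beta>) + 1"
      by (simp add: fps_of_nat[symmetric])
    have "AA z * (W * (fps_const (real k * g + 1) * LL z + fps_X * fps_deriv (LL z)))
       = W * (fps_const (real k * g + 1) * (AA z * LL z) + AA z * (fps_X * fps_deriv (LL z)))"
      by (simp only: algebra_simps)
    also have "\<dots> = W * LL z + W * (of_nat k * (fps_const \<alpha> + fps_const \<beta>) * (DD z * JJ z)
         + (AA z * (fps_X * fps_deriv (LL z)) + DD z * JJ z - LL z))"
      unfolding c AA_LL by (simp only: algebra_simps mult_1_left)
    finally show ?thesis unfolding t by simp
  qed
  finally show ?thesis unfolding W_def by simp
qed

end

section \<open>The Dunkl kernel as a Borel sum\<close>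

lemma geo_bounded_fps_const_continuous:
  fixes f :: "'a::topological_space \<Rightarrow> real"
  assumes "compact S" "continuous_on S f"
  shows "geo_bounded S (\<lambda>x. fps_const (f x))"
proof -
  have "bounded (f ` S)" by (intro compact_imp_bounded compact_continuous_image assms)
  then obtain B where "\<And>x. x \<in> S \<Longrightarrow> \<bar>f x\<bar> \<le> B" by (auto simp: bounded_iff)
  then show ?thesis by (rule geo_bounded_fps_const)
qed

lemma geo_bounded_subset: "geo_bounded T f \<Longrightarrow> g ` S \<subseteq> T \<Longrightarrow> geo_bounded S (\<lambda>x. f (g x))"
  unfolding geo_bounded_def by (meson image_subset_iff)

lemma pochhammer_series_uniform:
  fixes c :: real
  assumes "c \<ge> 1" "geo_bounded S f"
  shows "uniform_limit S (\<lambda>n x. \<Sum>i<n. f x $ i / pochhammer c i) (\<lambda>x. \<Sum>i. f x $ i / pochhammer c i) sequentially"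
proof -
  obtain C R where f: "\<And>x n. x \<in> S \<Longrightarrow> \<bar>f x $ n\<bar> \<le> C * R ^ n"
    using assms(2) unfolding geo_bounded_def by blast
  show ?thesis
  proof (rule Weierstrass_m_test)
    show "summable (\<lambda>n. C * R ^ n / pochhammer c n)" by (rule pochhammer_summable_majorant[OF assms(1)])
    show "norm (f x $ n / pochhammer c n) \<le> C * R ^ n / pochhammer c n" if "x \<in> S" for n x
      using f[OF that] assms(1) by (auto simp: pochhammer_nonneg intro!: divide_right_mono)
  qed
qed

lemma pochhammer_series_summable:
  fixes c :: real
  assumes "c \<ge> 1" "geo_bounded S f" "x \<in> S"
  shows "summable (\<lambda>n. f x $ n / pochhammer c n)"
proof (rule summable_norm_cancel)
  show "summable (\<lambda>n. norm (f x $ n / pochhammer c n))"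
    using geo_bounded_summable[OF assms(2,3,1)] assms(1) by (simp add: pochhammer_nonneg)
qed

lemma pochhammer_series_continuous:
  fixes c :: real and f :: "complex \<Rightarrow> real fps"
  assumes "c \<ge> 1" "\<And>R. geo_bounded (cball 0 R) f" "fps_continuous_on UNIV f"
  shows "continuous_on UNIV (\<lambda>z. \<Sum>n. f z $ n / pochhammer c n)"
proof -
  have "continuous_on (ball 0 R) (\<lambda>z. \<Sum>n. f z $ n / pochhammer c n)" for R
  proof (rule uniform_limit_theorem)
    have "geo_bounded (ball 0 R) f" using geo_bounded_subset[OF assms(2)[of R], of id "ball 0 R"] by auto
    then show "uniform_limit (ball 0 R) (\<lambda>n x. \<Sum>i<n. f x $ i / pochhammer c i) (\<lambda>x. \<Sum>i. f x $ i / pochhammer c i) sequentially"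
      by (rule pochhammer_series_uniform[OF assms(1)])
    show "\<forall>\<^sub>F n in sequentially. continuous_on (ball 0 R) (\<lambda>x. \<Sum>i<n. f x $ i / pochhammer c i)"
      using assms(3) unfolding fps_continuous_on_def divide_inverse
      by (intro always_eventually allI continuous_intros) (auto intro: continuous_on_subset)
  qed simp
  then have "continuous (at z) (\<lambda>z. \<Sum>n. f z $ n / pochhammer c n)" for z
    by (meson continuous_on_eq_continuous_at open_ball centre_in_ball mem_ball_0 less_add_one)
  then show ?thesis by (simp add: continuous_on_eq_continuous_at)
qed

text \<open>Termwise differentiation requires the derived series to converge uniformly relative to
  \<open>norm h\<close>. Linearity reduces this to \<open>h = 1\<close> and \<open>h = \<i>\<close>,
  each with half of the allowed error.\<close>

lemma pochhammer_series_has_derivative: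
  fixes c :: real and f :: "complex \<Rightarrow> real fps"
  assumes c: "c \<ge> 1" and der: "\<And>z. fps_has_derivative f (f' z) z"
    and geo: "\<And>R. geo_bounded (cball 0 R) f" and geo': "\<And>R h. geo_bounded (cball 0 R) (\<lambda>z. f' z h)"
  shows "((\<lambda>z. \<Sum>n. f z $ n / pochhammer c n) has_derivative (\<lambda>h. \<Sum>n. f' z h $ n / pochhammer c n)) (at z)"
proof -
  define R where "R = cmod z + 1"
  define S where "S = ball (0::complex) R"
  define G where "G = (\<lambda>x h. \<Sum>n. f' x h $ n / pochhammer c n)"
  have z: "z \<in> S" by (simp add: S_def R_def)
  have sub: "geo_bounded S F" if "geo_bounded (cball 0 R) F" for F
    using geo_bounded_subset[OF that, of id S] by (auto simp: S_def)
  have lin: "f' x h $ n = Re h * f' x 1 $ n + Im h * f' x \<i> $ n" for x h n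
  proof -
    have "linear (\<lambda>h. f' x h $ n)" using der has_derivative_linear unfolding fps_has_derivative_def by blast
    then have "f' x (Re h *\<^sub>R 1 + Im h *\<^sub>R \<i>) $ n = Re h * f' x 1 $ n + Im h * f' x \<i> $ n"
      by (simp add: linear_iff)
    moreover have "Re h *\<^sub>R 1 + Im h *\<^sub>R \<i> = h" by (simp add: complex_eq_iff)
    ultimately show ?thesis by simp
  qed
  have sm: "summable (\<lambda>n. f' x h $ n / pochhammer c n)" if "x \<in> S" for x h
    by (rule pochhammer_series_summable[OF c sub[OF geo'] that])
  have "\<exists>g. \<forall>x\<in>S. (\<lambda>n. f x $ n / pochhammer c n) sums (g x) \<and> (g has_derivative G x) (at x within S)"
  proof (rule has_derivative_series)
    show "convex S" by (simp add: S_def)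
    show "((\<lambda>x. f x $ n / pochhammer c n) has_derivative (\<lambda>h. f' x h $ n / pochhammer c n)) (at x within S)" for n x
    proof -
      have "((\<lambda>x. f x $ n) has_derivative (\<lambda>h. f' x h $ n)) (at x)"
        using der[of x] unfolding fps_has_derivative_def by blast
      from has_derivative_mult_left[OF has_derivative_at_withinI[OF this]]
      show ?thesis unfolding divide_inverse .
    qed
    show "z \<in> S" by fact
    show "(\<lambda>n. f z $ n / pochhammer c n) sums (\<Sum>n. f z $ n / pochhammer c n)"
      by (intro summable_sums pochhammer_series_summable[OF c sub[OF geo] z])
    fix e :: real assume e: "e > 0"
    have u: "\<forall>\<^sub>F n in sequentially. \<forall>x\<in>S. dist (\<Sum>i<n. f' x h $ i / pochhammer c i) (G x h) < e / 2" for h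
      using pochhammer_series_uniform[OF c sub[OF geo'[of R h]]] half_gt_zero[OF e]
      unfolding uniform_limit_iff G_def by blast
    show "\<forall>\<^sub>F n in sequentially. \<forall>x\<in>S. \<forall>h. norm ((\<Sum>i<n. f' x h $ i / pochhammer c i) - G x h) \<le> e * norm h"
      using u[of 1] u[of \<i>]
    proof eventually_elim
      case (elim n)
      show ?case
      proof (intro ballI allI)
        fix x h assume x: "x \<in> S"
        let ?s = "\<lambda>h. (\<Sum>i<n. f' x h $ i / pochhammer c i) - G x h"
        have "G x h = Re h * G x 1 + Im h * G x \<i>"
          unfolding G_def using sm[OF x]
          by (subst lin) (simp add: add_divide_distrib suminf_add[symmetric] suminf_mult summable_mult flip: times_divide_eq_right)
        moreover have "(\<Sum>i<n. f' x h $ i / pochhammer c i)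
          = Re h * (\<Sum>i<n. f' x 1 $ i / pochhammer c i) + Im h * (\<Sum>i<n. f' x \<i> $ i / pochhammer c i)"
          by (subst lin) (simp add: add_divide_distrib sum.distrib sum_distrib_left)
        ultimately have "?s h = Re h * ?s 1 + Im h * ?s \<i>" by (simp add: algebra_simps)
        also have "\<bar>\<dots>\<bar> \<le> \<bar>Re h\<bar> * \<bar>?s 1\<bar> + \<bar>Im h\<bar> * \<bar>?s \<i>\<bar>"
          by (rule order.trans[OF abs_triangle_ineq]) (simp add: abs_mult)
        also have "\<dots> \<le> cmod h * (e / 2) + cmod h * (e / 2)"
          using elim x by (intro add_mono mult_mono abs_Re_le_cmod abs_Im_le_cmod) (auto simp: dist_real_def intro: less_imp_le)
        finally show "norm (?s h) \<le> e * norm h" by (simp add: field_simps)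
      qed
    qed
  qed
  then obtain G0 where G0: "\<And>x. x \<in> S \<Longrightarrow> (\<lambda>n. f x $ n / pochhammer c n) sums (G0 x)"
    "\<And>x. x \<in> S \<Longrightarrow> (G0 has_derivative G x) (at x within S)" by blast
  have "(G0 has_derivative G z) (at z)"
    using G0(2)[OF z] at_within_open[OF z] by (simp add: S_def)
  then have "((\<lambda>z. \<Sum>n. f z $ n / pochhammer c n) has_derivative G z) (at z)"
    by (rule has_derivative_transform_within_open[of _ _ _ _ S]) (use z G0(1) sums_unique in \<open>auto simp: S_def\<close>)
  then show ?thesis unfolding G_def .
qed

context dihedral_kernel
begin

section \<open>Coefficient bounds for the generating series, locally uniform in
  \<open>z\<close>\<close>

lemma abs_a_coef_le: "j < k \<Longrightarrow> \<bar>a_coef k z w u v j\<bar> \<le> cmod z * cmod w"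
  by (simp add: a_coef_def abs_mult mult_left_le)

text \<open>On the square \<open>F\<close> splits into the real linear factors
  \<open>1 - a_j X\<close> with \<open>|a_j| \<le> |z| |w|\<close>, and the powers of these have
  explicit coefficients.\<close>

lemma geo_bounded_fpow_FF:
  assumes "c > 0"
  shows "geo_bounded (cball 0 R \<times> unit_square) (\<lambda>p. fpow (- c) (FF (fst p) (snd p)))"
proof -
  have "geo_bounded (cball 0 R \<times> unit_square) (\<lambda>p. \<Prod>j<k. fpow (- c) (lin (a_coef k (fst p) w (snd (snd p)) (fst (snd p)) j)))"
  proof (intro geo_bounded_prod geo_bounded_fpow_lin assms)
    fix j p assume "j \<in> {..<k}" "p \<in> cball (0::complex) R \<times> unit_square"
    then have "\<bar>a_coef k (fst p) w (snd (snd p)) (fst (snd p)) j\<bar> \<le> cmod (fst p) * cmod w" "cmod (fst p) \<le> R"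
      by (auto intro: abs_a_coef_le)
    moreover from this(2) have "cmod (fst p) * cmod w \<le> R * cmod w" by (intro mult_right_mono) auto
    ultimately show "\<bar>a_coef k (fst p) w (snd (snd p)) (fst (snd p)) j\<bar> \<le> R * cmod w" by linarith
  qed
  moreover have "fpow (- c) (FF z (v, u)) = (\<Prod>j<k. fpow (- c) (lin (a_coef k z w u v j)))"
    if "u \<in> {-1..1}" "v \<in> {-1..1}" for z u v
    unfolding FF_prod[OF that] by (rule fpow_prod) simp
  ultimately show ?thesis unfolding geo_bounded_def by (fastforce simp: mem_Times_iff)
qed

lemma geo_bounded_GG:
  assumes "c > 0" "continuous_on UNIV a"
  shows "geo_bounded (cball 0 R) (GG a (- c))"
proof -
  interpret prob_space "\<mu>" by (rule prob_space_mu2[OF \<alpha> \<beta>])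
  have "bounded (a ` unit_square)"
    by (intro compact_imp_bounded compact_continuous_image compact_unit_square continuous_on_subset[OF assms(2)]) auto
  then obtain A where A: "\<And>x. x \<in> unit_square \<Longrightarrow> \<bar>a x\<bar> \<le> A" by (auto simp: bounded_iff)
  have A0: "A \<ge> 0" using A[of "(0, 0)"] by auto
  obtain C r where C: "C \<ge> 0" "r \<ge> 0"
    and b: "\<And>p n. p \<in> cball 0 R \<times> unit_square \<Longrightarrow> \<bar>fpow (- c) (FF (fst p) (snd p)) $ n\<bar> \<le> C * r ^ n"
    using geo_bounded_fpow_FF[OF assms(1)] unfolding geo_bounded_def by blast
  show ?thesis
  proof (rule geo_boundedI[of "A * C" r])
    fix z n assume z: "z \<in> cball (0::complex) R"
    have "\<bar>GG a (- c) z $ n\<bar> \<le> (\<integral>x. \<bar>(fps_const (a x) * fpow (- c) (FF z x)) $ n\<bar> \<partial>\<mu>)"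
      unfolding GG_def fps_lint_nth by (rule integral_abs_bound)
    also have "\<dots> \<le> (\<integral>x. A * (C * r ^ n) \<partial>\<mu>)"
    proof (rule integral_mono_AE)
      show "integrable \<mu> (\<lambda>x. \<bar>(fps_const (a x) * fpow (- c) (FF z x)) $ n\<bar>)"
        by (intro integrable_abs GG_integrable assms)
      show "AE x in \<mu>. \<bar>(fps_const (a x) * fpow (- c) (FF z x)) $ n\<bar> \<le> A * (C * r ^ n)"
        using AE_mu2[OF \<alpha> \<beta>]
      proof eventually_elim
        case (elim x)
        have "\<bar>a x\<bar> * \<bar>fpow (- c) (FF z x) $ n\<bar> \<le> A * (C * r ^ n)"
          using b[of "(z, x)" n] elim z by (intro mult_mono A A0) auto
        then show ?case by (simp add: abs_mult)
      qed
    qed simp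
    also have "\<dots> = A * C * r ^ n" by (simp add: prob_space)
    finally show "\<bar>GG a (- c) z $ n\<bar> \<le> A * C * r ^ n" .
  qed (use C A0 in auto)
qed

lemma geo_bounded_AA: "geo_bounded (cball 0 R) (\<lambda>z. AA (rot i z))"
  unfolding AA_def cinner_def rot_def
  by (intro geo_bounded_intros geo_bounded_fps_const_continuous compact_cball continuous_intros)

lemma geo_bounded_MM: "geo_bounded (cball 0 R) MM"
  unfolding MM_def[abs_def] by (intro geo_bounded_intros geo_bounded_AA)

lemma geo_bounded_MM': "geo_bounded (cball 0 R) (\<lambda>z. MM' z h)"
  unfolding MM'_def by (intro geo_bounded_intros geo_bounded_AA)

lemma geo_bounded_MM_rot: "geo_bounded (cball 0 R) (\<lambda>z. MM (rot i z))"
  by (rule geo_bounded_subset[OF geo_bounded_MM[of R]]) auto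

lemma geo_bounded_pqP':
  "geo_bounded (cball 0 R) (\<lambda>z. pX' z h)" "geo_bounded (cball 0 R) (\<lambda>z. qX' z h)"
  "geo_bounded (cball 0 R) (\<lambda>z. PP' z h)"
  unfolding PP'_def DD'_def pX'_def qX'_def
  by (intro geo_bounded_intros geo_bounded_fps_const_continuous compact_cball continuous_intros geo_bounded_MM_rot)+

lemma geo_bounded_JJ: "geo_bounded (cball 0 R) JJ"
  using geo_bounded_GG[of "g + 1" "\<lambda>x. 1"] \<alpha> \<beta> unfolding JJ_def[abs_def] by simp

lemma geo_bounded_IK:
  "geo_bounded (cball 0 R) II" "geo_bounded (cball 0 R) Ko" "geo_bounded (cball 0 R) Ke"
proof -
  have gb: "geo_bounded (cball 0 R) (\<lambda>z. fps_const (g + 1) * GG a (- g - 2) z)" if "continuous_on UNIV a" for a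
    using geo_bounded_GG[of "g + 2" a] that \<alpha> \<beta> by (intro geo_bounded_intros) auto
  show "geo_bounded (cball 0 R) II" "geo_bounded (cball 0 R) Ko" "geo_bounded (cball 0 R) Ke"
    unfolding II_def[abs_def] Ko_def[abs_def] Ke_def[abs_def] by (intro gb continuous_intros)+
qed

lemma geo_bounded_LL: "geo_bounded (cball 0 R) LL"
  unfolding LL_def[abs_def] by (intro geo_bounded_mult geo_bounded_MM geo_bounded_JJ)

lemma geo_bounded_LL': "geo_bounded (cball 0 R) (\<lambda>z. LL' z h)"
  unfolding LL'_def JJ'_def
  by (intro geo_bounded_intros geo_bounded_MM geo_bounded_MM' geo_bounded_JJ geo_bounded_IK geo_bounded_pqP')

lemma fps_continuous_on_GG:
  assumes "continuous_on UNIV a"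
  shows "fps_continuous_on UNIV (GG a c)"
  using GG_has_derivative[OF assms] unfolding fps_continuous_on_def fps_has_derivative_def
  by (auto intro!: continuous_at_imp_continuous_on has_derivative_continuous)

lemma fps_continuous_on_LL': "fps_continuous_on UNIV (\<lambda>z. LL' z h)"
  unfolding LL'_def JJ'_def MM'_def JJ_def II_def Ko_def Ke_def
  by (intro fps_continuous_intros fps_continuous_on_GG MM_continuous AA_continuous rot_continuous pqP_continuous
      continuous_intros)

section \<open>The candidate for the kernel and its Dunkl equation\<close>

definition EE :: "complex \<Rightarrow> real" where
  "EE z = (\<Sum>n. LL z $ n / pochhammer (real k * g + 1) n)"

lemma kg: "real k * g + 1 \<ge> 1"
  using \<alpha> \<beta> by simp

lemma EE_has_derivative:
  "(EE has_derivative (\<lambda>h. \<Sum>n. LL' z h $ n / pochhammer (real k * g + 1) n)) (at z)"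
  unfolding EE_def[abs_def]
  by (rule pochhammer_series_has_derivative[OF kg LL_has_derivative geo_bounded_LL geo_bounded_LL'])

lemma EE_0: "EE 0 = 1"
proof -
  interpret prob_space "\<mu>" by (rule prob_space_mu2[OF \<alpha> \<beta>])
  have "AA 0 = 1" by (simp add: AA_def cinner_def)
  then have MM: "MM 0 = 1" by (simp add: MM_def rot_def)
  have DD: "DD 0 = 1" using AA_MM[of 0] MM \<open>AA 0 = 1\<close> by simp
  have "pX 0 = 0" "qX 0 = 0" using k by (auto simp: pX_def qX_def power_0_left)
  then have "FF 0 x = 1" for x unfolding FF_eq_DD DD by simp
  moreover have "fpow c 1 = 1" for c by (simp add: fpow_def)
  ultimately have "JJ 0 = 1"
    by (intro fps_ext) (simp add: JJ_def GG_def prob_space)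
  then have "LL 0 = 1" by (simp add: LL_def MM)
  then have "EE 0 = (\<Sum>n. if n = 0 then 1 else 0)" unfolding EE_def by (intro suminf_cong) simp
  also have "\<dots> = 1" by (subst suminf_finite[of "{0}"]) auto
  finally show ?thesis .
qed

lemma summable_LL: "summable (\<lambda>n. LL z $ n / pochhammer (real k * g + 1) n)"
  by (rule pochhammer_series_summable[OF kg geo_bounded_LL[of "cmod z"]]) simp

lemma summable_LL': "summable (\<lambda>n. LL' z h $ n / pochhammer (real k * g + 1) n)"
  by (rule pochhammer_series_summable[OF kg geo_bounded_LL'[of "cmod z"], of z]) simp

text \<open>In coefficient \<open>n + 1\<close> of \<open>dunkl_equation_LL\<close> the right-hand
  side carries the factor \<open>k g + 1 + n\<close>, which is the quotient of the weights
  \<open>(k g + 1)_(n+1)\<close> and \<open>(k g + 1)_n\<close>. Dividing by the weight leaves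
  coefficient \<open>n\<close> of the original series.\<close>

lemma dunkl_op_EE:
  assumes "dih_regular k z"
  shows "dunkl_op k \<alpha> \<beta> h EE z = cinner h w * EE z"
proof -
  let ?c = "real k * g + 1"
  let ?x = "\<lambda>j. dih_mult \<alpha> \<beta> j * cinner (dih_root k j) h / cinner (dih_root k j) z"
  have fd: "frechet_derivative EE (at z) = (\<lambda>h. \<Sum>n. LL' z h $ n / pochhammer ?c n)"
    using frechet_derivative_at[OF EE_has_derivative] by simp
  have "(\<lambda>n. LL' z h $ n / pochhammer ?c n
      + (\<Sum>j<2*k. ?x j * (LL z $ n / pochhammer ?c n - LL (dih_refl k j z) $ n / pochhammer ?c n)))
     sums (frechet_derivative EE (at z) h + (\<Sum>j<2*k. ?x j * (EE z - EE (dih_refl k j z))))"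
    unfolding fd EE_def
    by (intro sums_add sums_sum sums_mult sums_diff summable_sums summable_LL summable_LL')
  moreover have "LL' z h $ n / pochhammer ?c n
      + (\<Sum>j<2*k. ?x j * (LL z $ n / pochhammer ?c n - LL (dih_refl k j z) $ n / pochhammer ?c n))
      = (LL' z h + (\<Sum>j<2*k. fps_const (?x j) * (LL z - LL (dih_refl k j z)))) $ n / pochhammer ?c n" for n
    by (simp add: fps_sum_nth add_divide_distrib sum_divide_distrib diff_divide_distrib right_diff_distrib)
  ultimately have s1: "(\<lambda>n. (fps_const (cinner h w) * fps_X * (fps_const ?c * LL z + fps_X * fps_deriv (LL z))) $ n / pochhammer ?c n)
     sums (frechet_derivative EE (at z) h + (\<Sum>j<2*k. ?x j * (EE z - EE (dih_refl k j z))))"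
    unfolding dunkl_equation_LL[OF assms] by simp
  have coeff: "(fps_const (cinner h w) * fps_X * (fps_const ?c * LL z + fps_X * fps_deriv (LL z))) $ Suc n / pochhammer ?c (Suc n)
      = cinner h w * (LL z $ n / pochhammer ?c n)" for n
  proof -
    have "(fps_X * fps_deriv (LL z)) $ n = real n * LL z $ n" by (cases n) auto
    then have "(fps_const (cinner h w) * fps_X * (fps_const ?c * LL z + fps_X * fps_deriv (LL z))) $ Suc n
       = cinner h w * ((?c + real n) * LL z $ n)"
      by (simp add: mult.assoc distrib_right)
    moreover have "?c + real n > 0" using kg by linarith
    ultimately show ?thesis by (simp add: pochhammer_Suc)
  qed
  have "(\<lambda>n. cinner h w * (LL z $ n / pochhammer ?c n)) sums (cinner h w * EE z)"
    unfolding EE_def by (intro sums_mult summable_sums summable_LL)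
  \<comment> \<open>The factor \<open>X\<close> makes coefficient 0 vanish, so the shift by one
    loses nothing.\<close>
  then have "(\<lambda>n. (fps_const (cinner h w) * fps_X * (fps_const ?c * LL z + fps_X * fps_deriv (LL z))) $ n / pochhammer ?c n)
     sums (cinner h w * EE z)"
    unfolding coeff[symmetric] by (subst (asm) sums_Suc_iff) (simp add: mult.assoc)
  with s1 have "frechet_derivative EE (at z) h + (\<Sum>j<2*k. ?x j * (EE z - EE (dih_refl k j z))) = cinner h w * EE z"
    by (rule sums_unique2)
  then show ?thesis unfolding dunkl_op_def by simp
qed

theorem is_dunkl_kernel_EE: "is_dunkl_kernel k \<alpha> \<beta> w EE"
  unfolding is_dunkl_kernel_def
proof (intro conjI allI impI)
  show "EE 0 = 1" by (rule EE_0)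
  show "EE differentiable (at x)" for x
    using EE_has_derivative unfolding differentiable_def by blast
  have c: "continuous_on UNIV (\<lambda>x. frechet_derivative EE (at x) h)" for h
    unfolding frechet_derivative_at[OF EE_has_derivative, symmetric]
    by (rule pochhammer_series_continuous[OF kg geo_bounded_LL' fps_continuous_on_LL'])
  then show "continuous_on UNIV (\<lambda>x. frechet_derivative EE (at x) 1)"
    "continuous_on UNIV (\<lambda>x. frechet_derivative EE (at x) \<i>)" by auto
qed (auto intro: dunkl_op_EE)

end

section \<open>Integral formulas\<close>

context dihedral_kernel
begin

lemma series_integral:
  fixes c :: real
  assumes c: "c \<ge> 1" and cont: "fps_continuous_on UNIV f" and geo: "geo_bounded unit_square f"
  shows "integrable \<mu> (\<lambda>x. \<Sum>n. f x $ n / pochhammer c n)"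
    and "(\<lambda>n. fps_lint \<mu> f $ n / pochhammer c n) sums (\<integral>x. (\<Sum>n. f x $ n / pochhammer c n) \<partial>\<mu>)"
proof -
  interpret prob_space "\<mu>" by (rule prob_space_mu2[OF \<alpha> \<beta>])
  obtain C R where f: "\<And>x n. x \<in> unit_square \<Longrightarrow> \<bar>f x $ n\<bar> \<le> C * R ^ n"
    using geo unfolding geo_bounded_def by blast
  have int: "integrable \<mu> (\<lambda>x. f x $ n / pochhammer c n)" for n
    using integrable_coeffs[OF cont] by simp
  have bound: "norm (f x $ n / pochhammer c n) \<le> C * R ^ n / pochhammer c n" if "x \<in> unit_square" for x n
    using f[OF that] c by (auto simp: pochhammer_nonneg intro!: divide_right_mono)
  note maj = pochhammer_summable_majorant[OF c, of C R]
  have ae: "AE x in \<mu>. summable (\<lambda>n. norm (f x $ n / pochhammer c n))"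
    using AE_mu2[OF \<alpha> \<beta>]
  proof eventually_elim
    case (elim x)
    show ?case by (rule summable_comparison_test'[OF maj]) (use bound[OF elim] in auto)
  qed
  have sm: "summable (\<lambda>n. \<integral>x. norm (f x $ n / pochhammer c n) \<partial>\<mu>)"
  proof (rule summable_comparison_test'[OF maj])
    fix n
    have "(\<integral>x. norm (f x $ n / pochhammer c n) \<partial>\<mu>) \<le> (\<integral>x. C * R ^ n / pochhammer c n \<partial>\<mu>)"
      using int AE_mu2[OF \<alpha> \<beta>] bound by (intro integral_mono_AE integrable_norm) (auto elim!: eventually_mono)
    then show "norm (\<integral>x. norm (f x $ n / pochhammer c n) \<partial>\<mu>) \<le> C * R ^ n / pochhammer c n"
      by (simp add: prob_space)
  qed
  show "integrable \<mu> (\<lambda>x. \<Sum>n. f x $ n / pochhammer c n)"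
    by (rule integrable_suminf[OF int ae sm])
  show "(\<lambda>n. fps_lint \<mu> f $ n / pochhammer c n) sums (\<integral>x. (\<Sum>n. f x $ n / pochhammer c n) \<partial>\<mu>)"
    using sums_integral[OF int ae sm] by simp
qed

lemma h_fun_sums:
  assumes "\<gamma> > 0" "u \<in> {-1..1}" "v \<in> {-1..1}"
  shows "(\<lambda>n. (fpow (- 1) (AA z) * fpow (- \<gamma>) (FF z (v, u))) $ n / pochhammer (real k * \<gamma> + 1) n)
    sums h_fun k \<gamma> z w u v"
proof -
  have "(\<Prod>i<k + 1. fpow (- (if i < k then \<gamma> else 1)) (lin (a_coef k z w u v i)))
    = (\<Prod>i<k. fpow (- \<gamma>) (lin (a_coef k z w u v i))) * fpow (- 1) (AA z)"
    by (simp add: AA_def a_coef_def[of k z w u v k] cinner_def)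
  also have "(\<Prod>i<k. fpow (- \<gamma>) (lin (a_coef k z w u v i))) = fpow (- \<gamma>) (FF z (v, u))"
    unfolding FF_prod[OF assms(2,3)] by (rule fpow_prod[symmetric]) simp
  finally have "(\<Prod>i<k + 1. fpow (- (if i < k then \<gamma> else 1)) (lin (a_coef k z w u v i)))
    = fpow (- 1) (AA z) * fpow (- \<gamma>) (FF z (v, u))" by (simp add: mult.commute)
  then show ?thesis
    using humbert2_sums[of "real k * \<gamma> + 1" "k + 1" "\<lambda>i. if i < k then \<gamma> else 1" "a_coef k z w u v"] assms(1)
    unfolding h_fun_def by simp
qed

text \<open>\<open>f1\<close> and \<open>f2\<close> are the generating series of the two summands in
  the bracket of the theorem, both with respect to the weight \<open>(k g + 1)_n\<close>.\<close>

definition f1 :: "complex \<Rightarrow> real \<times> real \<Rightarrow> real fps" where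
  "f1 z x = fpow (- 1) (AA z) * fpow (- g) (FF z x)"

definition f2 :: "complex \<Rightarrow> real \<times> real \<Rightarrow> real fps" where
  "f2 z x = fpow (- 1) (AA z) * (fps_const (fst x - 1) * pX z + fps_const (snd x - 1) * qX z) * fpow (- (g + 1)) (FF z x)"

lemma f1_sums:
  "u \<in> {-1..1} \<Longrightarrow> v \<in> {-1..1} \<Longrightarrow>
    (\<lambda>n. f1 z (v, u) $ n / pochhammer (real k * g + 1) n) sums h_fun k g z w u v"
  unfolding f1_def using \<alpha> \<beta> by (intro h_fun_sums) auto

text \<open>The combination of \<open>p\<close> and \<open>q\<close> is a number times
  \<open>X^k\<close>. Shifting by \<open>k\<close> turns the weight for \<open>g\<close> into the
  weight for \<open>g + 1\<close> times \<open>(k g + 1)_k\<close>, and that constant is the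
  quotient of Gamma values.\<close>

lemma f2_sums:
  assumes u: "u \<in> {-1..1}" and v: "v \<in> {-1..1}"
  shows "(\<lambda>n. f2 z (v, u) $ n / pochhammer (real k * g + 1) n) sums
    (2 powr (1 - real k) * Gamma (real k * g + 1) / Gamma (real k * (g + 1) + 1)
            * (cmod z * cmod w) ^ k * xi_uv (u - 1) (v - 1) (real k * Arg z) (real k * Arg w)
            * h_fun k (g + 1) z w u v)"
proof -
  let ?c = "real k * g + 1"
  define \<zeta> where "\<zeta> = 2 / 2 ^ k * (cmod z * cmod w) ^ k * xi_uv (u - 1) (v - 1) (real k * Arg z) (real k * Arg w)"
  define t where "t = fpow (- 1) (AA z) * fpow (- (g + 1)) (FF z (v, u))"
  have "\<zeta> = (v - 1) * (2 / 2 ^ k * Re (z ^ k) * Re (w ^ k)) + (u - 1) * (2 / 2 ^ k * Im (z ^ k) * Im (w ^ k))"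
  proof -
    have alg: "c * (a * b) * ((v - 1) * x * y + (u - 1) * x' * y')
      = (v - 1) * (c * (a * x) * (b * y)) + (u - 1) * (c * (a * x') * (b * y'))"
      for c a b x y x' y' :: real by (simp add: algebra_simps)
    show ?thesis unfolding \<zeta>_def Re_Im_power_polar xi_uv_def power_mult_distrib by (rule alg)
  qed
  then have "fps_const (v - 1) * pX z + fps_const (u - 1) * qX z = fps_const \<zeta> * fps_X ^ k"
    unfolding pX_def qX_def mult.assoc[symmetric] fps_const_mult distrib_right[symmetric] fps_const_add by simp
  then have f2: "f2 z (v, u) = fps_const \<zeta> * (fps_X ^ k * t)"
    unfolding f2_def t_def fst_conv snd_conv by (simp only: mult_ac)
  have poch: "pochhammer ?c (n + k) = pochhammer ?c k * pochhammer (real k * (g + 1) + 1) n" for n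
    using pochhammer_product'[of ?c k n] by (simp add: algebra_simps)
  have ck: "pochhammer ?c k = Gamma (real k * (g + 1) + 1) / Gamma ?c"
  proof -
    have "?c \<notin> \<int>\<^sub>\<le>\<^sub>0" using kg by (auto simp: nonpos_Ints_def)
    then show ?thesis using pochhammer_Gamma[of ?c k] by (simp add: algebra_simps)
  qed
  have "(\<lambda>n. t $ n / pochhammer (real k * (g + 1) + 1) n) sums h_fun k (g + 1) z w u v"
    unfolding t_def using \<alpha> \<beta> by (intro h_fun_sums u v) auto
  then have "(\<lambda>n. \<zeta> / pochhammer ?c k * (t $ n / pochhammer (real k * (g + 1) + 1) n))
      sums (\<zeta> / pochhammer ?c k * h_fun k (g + 1) z w u v)"
    by (rule sums_mult)
  moreover have "\<zeta> / pochhammer ?c k * (t $ n / pochhammer (real k * (g + 1) + 1) n)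
      = f2 z (v, u) $ (n + k) / pochhammer ?c (n + k)" for n
    unfolding poch f2 by (simp add: fps_X_power_mult_nth)
  moreover have "(\<Sum>i<k. f2 z (v, u) $ i / pochhammer ?c i) = 0"
    unfolding f2 by (simp add: fps_X_power_mult_nth)
  ultimately have "(\<lambda>n. f2 z (v, u) $ n / pochhammer ?c n) sums (\<zeta> / pochhammer ?c k * h_fun k (g + 1) z w u v)"
    using sums_iff_shift[of "\<lambda>n. f2 z (v, u) $ n / pochhammer ?c n" k] by simp
  moreover have "\<zeta> / pochhammer ?c k = 2 powr (1 - real k) * Gamma ?c / Gamma (real k * (g + 1) + 1)
            * (cmod z * cmod w) ^ k * xi_uv (u - 1) (v - 1) (real k * Arg z) (real k * Arg w)"
    unfolding ck \<zeta>_def by (simp add: powr_diff powr_realpow)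
  ultimately show ?thesis by simp
qed

text \<open>Factoring out \<open>F^(-g-1) / A\<close> leaves
  \<open>F + (v - 1) p + (u - 1) q\<close>, and this is \<open>D = A M\<close>.\<close>

lemma f1_plus_f2: "f1 z x + f2 z x = MM z * fpow (- g - 1) (FF z x)"
proof -
  have "fpow (- 1) (AA z) * AA z = 1"
    using fpow_shift[OF AA_nth_0[of z], of "- 1"] by (simp add: mult.commute)
  then have M: "fpow (- 1) (AA z) * DD z = MM z"
    unfolding AA_MM[symmetric] mult.assoc[symmetric] by simp
  have F: "fpow (- g) (FF z x) = FF z x * fpow (- g - 1) (FF z x)"
    using fpow_shift[OF FF_nth_0[of z x], of "- g - 1"] by simp
  have D: "FF z x + (fps_const (fst x - 1) * pX z + fps_const (snd x - 1) * qX z) = DD z"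
    unfolding FF_eq_DD by (simp add: algebra_simps flip: fps_const_sub)
  have e: "- (g + 1) = - g - 1" by simp
  have "f1 z x + f2 z x = fpow (- 1) (AA z)
      * (FF z x + (fps_const (fst x - 1) * pX z + fps_const (snd x - 1) * qX z)) * fpow (- g - 1) (FF z x)"
    unfolding f1_def f2_def F e by (simp only: algebra_simps)
  then show ?thesis unfolding D M .
qed

lemma f12_continuous: "fps_continuous_on UNIV (f1 z)" "fps_continuous_on UNIV (f2 z)"
  unfolding f1_def[abs_def] f2_def[abs_def]
  by (intro fps_continuous_intros FF_continuous continuous_intros)+

lemma f12_geo_bounded: "geo_bounded unit_square (f1 z)" "geo_bounded unit_square (f2 z)"
proof -
  have F: "geo_bounded unit_square (\<lambda>x. fpow (- c) (FF z x))" if "c > 0" for c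
  proof -
    have "(\<lambda>x. (z, x)) ` unit_square \<subseteq> cball 0 (cmod z) \<times> unit_square" by auto
    from geo_bounded_subset[OF geo_bounded_fpow_FF[OF that] this] show ?thesis by simp
  qed
  have A: "geo_bounded unit_square (\<lambda>x. fpow (- 1) (AA z))"
    unfolding AA_def by (rule geo_bounded_fpow_lin) auto
  show "geo_bounded unit_square (f1 z)"
    unfolding f1_def[abs_def] using \<alpha> \<beta> by (intro geo_bounded_mult A F) auto
  show "geo_bounded unit_square (f2 z)"
    unfolding f2_def[abs_def] pX_def qX_def using \<alpha> \<beta>
    by (intro geo_bounded_intros A F geo_bounded_fps_const_continuous compact_unit_square continuous_intros) auto
qed

text \<open>The sum of the series stands in for \<open>h_fun\<close>, with which it agrees on the
  square: its integrability follows from the coefficient bounds, with no look at the arccosine.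
  \<open>H1\<close> and \<open>H2\<close> are kept apart because the simplex form integrates the two
  summands separately.\<close>

definition H1 :: "complex \<Rightarrow> real \<times> real \<Rightarrow> real" where
  "H1 z x = (\<Sum>n. f1 z x $ n / pochhammer (real k * g + 1) n)"

definition H2 :: "complex \<Rightarrow> real \<times> real \<Rightarrow> real" where
  "H2 z x = (\<Sum>n. f2 z x $ n / pochhammer (real k * g + 1) n)"

lemma H12_integrable: "integrable \<mu> (H1 z)" "integrable \<mu> (H2 z)"
  unfolding H1_def[abs_def] H2_def[abs_def]
  by (rule series_integral[OF kg] f12_continuous f12_geo_bounded)+

lemma integral_H12: "(\<integral>x. H1 z x \<partial>\<mu>) + (\<integral>x. H2 z x \<partial>\<mu>) = EE z"
proof -
  have "(\<lambda>n. fps_lint \<mu> (f1 z) $ n / pochhammer (real k * g + 1) n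
      + fps_lint \<mu> (f2 z) $ n / pochhammer (real k * g + 1) n)
    sums ((\<integral>x. H1 z x \<partial>\<mu>) + (\<integral>x. H2 z x \<partial>\<mu>))"
    unfolding H1_def H2_def
    by (intro sums_add series_integral(2)[OF kg] f12_continuous f12_geo_bounded)
  moreover have "fps_lint \<mu> (f1 z) + fps_lint \<mu> (f2 z) = LL z"
  proof -
    have "fps_lint \<mu> (f1 z) + fps_lint \<mu> (f2 z) = fps_lint \<mu> (\<lambda>x. f1 z x + f2 z x)"
      by (rule fps_lint_add[symmetric]) (intro integrable_coeffs f12_continuous)+
    also have "\<dots> = fps_lint \<mu> (\<lambda>x. MM z * (fps_const 1 * fpow (- g - 1) (FF z x)))"
      unfolding f1_plus_f2 by simp
    also have "\<dots> = LL z"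
      unfolding LL_def JJ_def GG_def by (intro fps_lint_mult GG_integrable continuous_on_const)
    finally show ?thesis .
  qed
  then have "fps_lint \<mu> (f1 z) $ n / pochhammer (real k * g + 1) n
      + fps_lint \<mu> (f2 z) $ n / pochhammer (real k * g + 1) n
      = LL z $ n / pochhammer (real k * g + 1) n" for n
    by (metis add_divide_distrib fps_add_nth)
  ultimately have "(\<lambda>n. LL z $ n / pochhammer (real k * g + 1) n)
      sums ((\<integral>x. H1 z x \<partial>\<mu>) + (\<integral>x. H2 z x \<partial>\<mu>))" by simp
  then show ?thesis unfolding EE_def using sums_unique by metis
qed

lemma H1_eq: "u \<in> {-1..1} \<Longrightarrow> v \<in> {-1..1} \<Longrightarrow> h_fun k g z w u v = H1 z (v, u)"
  unfolding H1_def by (rule sums_unique[OF f1_sums])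

lemma H2_eq:
  "u \<in> {-1..1} \<Longrightarrow> v \<in> {-1..1} \<Longrightarrow>
    2 powr (1 - real k) * Gamma (real k * g + 1) / Gamma (real k * (g + 1) + 1)
            * (cmod z * cmod w) ^ k * xi_uv (u - 1) (v - 1) (real k * Arg z) (real k * Arg w)
            * h_fun k (g + 1) z w u v = H2 z (v, u)"
  unfolding H2_def by (rule sums_unique[OF f2_sums])

lemma dunkl_kernel_eq: "dunkl_kernel k \<alpha> \<beta> z w = (\<integral>x. H1 z x \<partial>\<mu>) + (\<integral>x. H2 z x \<partial>\<mu>)"
  unfolding integral_H12 by (rule dunkl_kernel_eqI[OF \<alpha> \<beta> is_dunkl_kernel_EE])

end

theorem mainTheorem11:
  fixes k :: nat and \<alpha> \<beta> :: real and z w :: complex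
  assumes "k \<ge> 1" and "\<alpha> > 0" and "\<beta> > 0"
  shows
   "(\<forall>\<gamma>>0. \<forall>u v. h_fun k \<gamma> z w u v =
       exp (a_coef k z w u v k) *
       humbert2 k (\<lambda>_. \<gamma>) (real k * \<gamma> + 1) (\<lambda>j. a_coef k z w u v j - a_coef k z w u v k))
    \<and> dunkl_kernel k \<alpha> \<beta> z w =
      (LINT v:{-1..1}|lborel. (LINT u:{-1..1}|lborel.
         (h_fun k (\<alpha> + \<beta>) z w u v
          + 2 powr (1 - real k) * Gamma (real k * (\<alpha> + \<beta>) + 1) / Gamma (real k * (\<alpha> + \<beta> + 1) + 1)
            * (cmod z * cmod w) ^ k * xi_uv (u - 1) (v - 1) (real k * Arg z) (real k * Arg w)
            * h_fun k (\<alpha> + \<beta> + 1) z w u v) * mu_dens \<alpha> u) * mu_dens \<beta> v)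
    \<and> dunkl_kernel k \<alpha> \<beta> z w =
      Gamma (real k * (\<alpha> + \<beta>) + 1) / Gamma (\<alpha> + \<beta>) ^ k *
      (LINT v:{-1..1}|lborel. (LINT u:{-1..1}|lborel.
         (LINT t:simplexT k|PiM {..<k} (\<lambda>_. lborel).
            exp ((\<Sum>j<k. a_coef k z w u v j * t j) + a_coef k z w u v k * (1 - (\<Sum>j<k. t j)))
            * (\<Prod>j<k. t j powr (\<alpha> + \<beta> - 1))) * mu_dens \<alpha> u) * mu_dens \<beta> v)
      + 2 powr (1 - real k) * Gamma (real k * (\<alpha> + \<beta>) + 1) / Gamma (\<alpha> + \<beta> + 1) ^ k *
      (LINT v:{-1..1}|lborel. (LINT u:{-1..1}|lborel.
         (LINT t:simplexT k|PiM {..<k} (\<lambda>_. lborel).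
            (cmod z * cmod w) ^ k * xi_uv (u - 1) (v - 1) (real k * Arg z) (real k * Arg w)
            * exp ((\<Sum>j<k. a_coef k z w u v j * t j) + a_coef k z w u v k * (1 - (\<Sum>j<k. t j)))
            * (\<Prod>j<k. t j powr (\<alpha> + \<beta>))) * mu_dens \<alpha> u) * mu_dens \<beta> v)"
proof -
  interpret dihedral_kernel k \<alpha> \<beta> w by unfold_locales (use assms in auto)
  \<comment> \<open>The prefactors of the simplex form. The inner simplex integrals will be
    \<open>H1 / C1\<close> and \<open>H2 / C2\<close>, so both have to be nonzero.\<close>
  define C1 where "C1 = Gamma (real k * (\<alpha> + \<beta>) + 1) / Gamma (\<alpha> + \<beta>) ^ k"
  define C2 where "C2 = 2 powr (1 - real k) * Gamma (real k * (\<alpha> + \<beta>) + 1) / Gamma (\<alpha> + \<beta> + 1) ^ k"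
  have pos: "Gamma (real k * (\<alpha> + \<beta>) + 1) > 0" "Gamma (\<alpha> + \<beta>) > 0" "Gamma (\<alpha> + \<beta> + 1) > 0"
    "Gamma (real k * (\<alpha> + \<beta> + 1) + 1) > 0"
    using assms by (auto intro!: Gamma_real_pos add_pos_pos mult_pos_pos)
  have C: "C1 \<noteq> 0" "C2 \<noteq> 0" unfolding C1_def C2_def using pos by auto
  have h: "h_fun k \<gamma> z w u v = Gamma (real k * \<gamma> + 1) / Gamma \<gamma> ^ k *
     (LINT t:simplexT k|PiM {..<k} (\<lambda>_. lborel).
        exp ((\<Sum>j<k. a_coef k z w u v j * t j) + a_coef k z w u v k * (1 - (\<Sum>j<k. t j)))
        * (\<Prod>j<k. t j powr (\<gamma> - 1)))" if "\<gamma> > 0" for \<gamma> u v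
  proof -
    have "Gamma \<gamma> > 0" "Gamma (real k * \<gamma> + 1) > 0"
      using that by (auto intro!: Gamma_real_pos add_nonneg_pos)
    then show ?thesis unfolding simplex_integral_humbert2[OF that] h_fun_def by simp
  qed
  let ?E = "\<lambda>u v t. exp ((\<Sum>j<k. a_coef k z w u v j * t j) + a_coef k z w u v k * (1 - (\<Sum>j<k. t j)))"
  let ?X = "\<lambda>u v. (cmod z * cmod w) ^ k * xi_uv (u - 1) (v - 1) (real k * Arg z) (real k * Arg w)"
  let ?S = "\<lambda>f. LINT t:simplexT k|PiM {..<k} (\<lambda>_. lborel). f t"
  let ?L = "\<lambda>F. LINT v:{-1..1}|lborel. (LINT u:{-1..1}|lborel. F u v * mu_dens \<alpha> u) * mu_dens \<beta> v"
  have I1: "?L (\<lambda>u v. ?S (\<lambda>t. ?E u v t * (\<Prod>j<k. t j powr (\<alpha> + \<beta> - 1)))) = (\<integral>x. H1 z x / C1 \<partial>mu2 \<alpha> \<beta>)"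
  proof (rule integral_mu2_iterated[OF assms(2,3)])
    show "integrable (mu2 \<alpha> \<beta>) (\<lambda>x. H1 z x / C1)" using H12_integrable by simp
    fix u v :: real assume uv: "u \<in> {-1..1}" "v \<in> {-1..1}"
    show "?S (\<lambda>t. ?E u v t * (\<Prod>j<k. t j powr (\<alpha> + \<beta> - 1))) = H1 z (v, u) / C1"
      using h[of "\<alpha> + \<beta>" u v] assms C(1) unfolding H1_eq[OF uv] C1_def[symmetric] by simp
  qed
  have I2: "?L (\<lambda>u v. ?S (\<lambda>t. ?X u v * ?E u v t * (\<Prod>j<k. t j powr (\<alpha> + \<beta>)))) = (\<integral>x. H2 z x / C2 \<partial>mu2 \<alpha> \<beta>)"
  proof (rule integral_mu2_iterated[OF assms(2,3)])
    show "integrable (mu2 \<alpha> \<beta>) (\<lambda>x. H2 z x / C2)" using H12_integrable by simp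
    fix u v :: real assume uv: "u \<in> {-1..1}" "v \<in> {-1..1}"
    define X where "X = ?X u v"
    define I where "I = ?S (\<lambda>t. ?E u v t * (\<Prod>j<k. t j powr (\<alpha> + \<beta>)))"
    have hI: "h_fun k (\<alpha> + \<beta> + 1) z w u v = Gamma (real k * (\<alpha> + \<beta> + 1) + 1) / Gamma (\<alpha> + \<beta> + 1) ^ k * I"
      unfolding I_def using h[of "\<alpha> + \<beta> + 1" u v] assms by simp
    have "H2 z (v, u) = C2 * (X * I)"
      unfolding H2_eq[OF uv, symmetric] hI C2_def X_def using pos by simp
    moreover have "?S (\<lambda>t. ?X u v * ?E u v t * (\<Prod>j<k. t j powr (\<alpha> + \<beta>))) = X * I"
      unfolding X_def[symmetric] I_def mult.assoc[of X] by (rule set_integral_mult_right)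
    ultimately show "?S (\<lambda>t. ?X u v * ?E u v t * (\<Prod>j<k. t j powr (\<alpha> + \<beta>))) = H2 z (v, u) / C2"
      using C by simp
  qed
  show ?thesis
  proof (intro conjI allI impI, goal_cases)
    case (1 \<gamma> u v)
    then show ?case unfolding h_fun_def by (rule humbert2_shift)
  next
    case 2
    show ?case
      unfolding dunkl_kernel_eq Bochner_Integration.integral_add[OF H12_integrable, symmetric]
      by (rule integral_mu2_iterated[OF assms(2,3) Bochner_Integration.integrable_add[OF H12_integrable], symmetric])
        (simp only: H1_eq H2_eq)
  next
    case 3
    show ?case
      unfolding I1 I2 C1_def[symmetric] C2_def[symmetric] dunkl_kernel_eq using C by simp
  qed
qed

end
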